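(* Let $\mathfrak g=\mathfrak{sl}_2$ and let $m\ge1$. As left $\mathbf U^e$-modules and as right $\mathcal P_m^{\Sigma_m}$-modules, we have $$W(m\omega)\cong S^m(L(V)).$$ (That is, there is an isomorphism compatible with both structures.)
   Context: $\mathfrak g=\mathfrak{sl}_2$ with standard basis $x^+,x^-,h$, $\omega$ its fundamental weight ($\omega(h)=1$). $L^e(\mathfrak g)=\mathfrak g\otimes\mathbb C[t,t^{-1}]\oplus\mathbb Cd$ with $[d,x\otimes t^r]=r\,x\otimes t^r$; $\mathbf U^e=U(L^e(\mathfrak g))$, $\mathbf U=U(\mathfrak g\otimes\mathbb C[t,t^{-1}])$; $x_r=x\otimes t^r$. $\mathbf U(0)$ is the (commutative) subalgebra generated by $h_k$, $k\neq0$. Define $\Lambda_{\pm k}$ ($k\ge0$) by $\Lambda^\pm(u)=\sum_{k\ge0}\Lambda_{\pm k}u^k=\exp\left(-\sum_{k\ge1}\frac{h_{\pm k}}{k}u^k\right)$, and $X_0^-(u)=\sum_{k\ge0}x_k^-u^{k+1}$. For a series $f$ in $u$, $f_s$ denotes the coefficient of $u^s$. $W(m\omega)$ is the quotient of $\mathbf U^e$ by the left ideal generated by: $x_k^+$ ($k\in\mathbb Z$); $h_0-m$; $d$; $\Lambda_k$ ($|k|>m$); $\Lambda_m\Lambda_{-k}-\Lambda_{m-k}$ ($1\le k\le m$); $\sum_{j=0}^mx^-_{s-1-j}\Lambda_jf$ ($s\in\mathbb Z$, $f\in\mathbf U(0)$); $(X_0^-(u)^r\Lambda^+(u))_sf$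 ($r\ge1$, $|s|>m$, $f\in\mathbf U(0)$). Right multiplication by $\mathbf U(0)$ on $\mathbf U$ descends to $W(m\omega)$ (identified with the corresponding quotient of $\mathbf U$), and this right action factors through a quotient of $\mathbf U(0)$ isomorphic to $\mathbb C[\Lambda_1,\dots,\Lambda_m,\Lambda_m^{-1}]$. $\mathcal P_m=\mathbb C[t_1^{\pm1},\dots,t_m^{\pm1}]$ and $\mathcal P_m^{\Sigma_m}$ is the subalgebra of invariants under permutation of the variables by the symmetric group $\Sigma_m$. Identify $\mathbb C[\Lambda_1,\dots,\Lambda_m,\Lambda_m^{-1}]$ with $\mathcal P_m^{\Sigma_m}$ by sending $\Lambda_r$ to $(-1)^r$ times the $r$-th elementary symmetric function of $t_1,\dots,t_m$; this makes $W(m\omega)$ a right $\mathcal P_m^{\Sigma_m}$-module. $V$ is the two-dimensional irreducible $\mathfrak{sl}_2$-module, $L(V)=V\otimes\mathbb C[t,t^{-1}]$ with $\mathbf U^e$-action $x_r.(v\otimes t^s)=x.v\otimes t^{r+s}$, $d.(v\otimes t^r)=r\,v\otimes t^r$. $T^m(L(V))$ is the $m$-fold tensor product, a $\mathbf U^e$-module, and $S^m(L(V))\subset T^m(L(V))$ is the $\mathbf U^e$-submodule of symmetric tensors. As a vector space $T^m(L(V))\cong V^{\otimes m}\otimes\mathcal P_m$ (the $j$-th copy of $t$ corresponding to $t_j$), so $T^m(L(V))$ is a right $\mathcal P_m$-module by multiplication, inducing a right $\mathcal P_m^{\Sigma_m}$-module structure on $S^m(L(V))$. *)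

theory Defs
  imports
    Complex_Main
    "HOL-Library.Poly_Mapping"
    "HOL-Library.Set_Algebras"
    "HOL-Computational_Algebra.Formal_Power_Series"
    "HOL-Combinatorics.Permutations"
begin

section \<open>Vector spaces with a basis and tensor algebras\<close>

text \<open>
  A complex vector space with basis indexed by \<open>'b\<close> is rendered as the space of finitely
  supported functions on \<open>'b\<close>; \<open>single b 1\<close> is the basis vector of \<open>b\<close>.
\<close>

type_synonym 'b vec = "'b \<Rightarrow>\<^sub>0 complex"

lemma vec_induct [case_names single add]:
  assumes single: "\<And>b c. P (Poly_Mapping.single b c)"
    and add: "\<And>x y. P x \<Longrightarrow> P y \<Longrightarrow> P (x + y)"
  shows "P (x :: 'b vec)"
proof -
  have "P (\<Sum>b\<in>A. Poly_Mapping.single b (Poly_Mapping.lookup x b))" if "finite A" for A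
    using that
  proof (induction A rule: finite_induct)
    case empty
    show ?case using single[of undefined 0] by simp
  next
    case (insert a A)
    thus ?case by (simp add: single add)
  qed
  moreover have "x = (\<Sum>b\<in>Poly_Mapping.keys x. Poly_Mapping.single b (Poly_Mapping.lookup x b))"
    by (rule poly_mapping_eqI)
      (auto simp: lookup_sum lookup_single when_def in_keys_iff sum.delta)
  ultimately show ?thesis by (metis finite_keys)
qed

definition smult :: "complex \<Rightarrow> 'b vec \<Rightarrow> 'b vec" where
  "smult c x = Poly_Mapping.map ((*) c) x"

definition linext :: "('b \<Rightarrow> 'c vec) \<Rightarrow> 'b vec \<Rightarrow> 'c vec" where
  "linext f x = (\<Sum>b\<in>Poly_Mapping.keys x. smult (Poly_Mapping.lookup x b) (f b))"

lemma lookup_smult: "Poly_Mapping.lookup (smult c x) b = c * Poly_Mapping.lookup x b"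
  by (simp add: smult_def map.rep_eq when_def)

lemma smult_add: "smult c (x + y) = smult c x + smult c y"
  by (rule poly_mapping_eqI) (simp add: lookup_smult lookup_add algebra_simps)

lemma smult_add_left: "smult (c + d) x = smult c x + smult d x"
  by (rule poly_mapping_eqI) (simp add: lookup_smult lookup_add algebra_simps)

lemma smult_smult: "smult c (smult d x) = smult (c * d) x"
  by (rule poly_mapping_eqI) (simp add: lookup_smult)

lemma smult_zero_left [simp]: "smult 0 x = 0"
  by (rule poly_mapping_eqI) (simp add: lookup_smult)

lemma smult_zero [simp]: "smult c 0 = 0"
  by (rule poly_mapping_eqI) (simp add: lookup_smult)

lemma smult_one [simp]: "smult 1 x = x"
  by (rule poly_mapping_eqI) (simp add: lookup_smult)

lemma smult_single [simp]: "smult c (Poly_Mapping.single b d) = Poly_Mapping.single b (c * d)"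
  by (rule poly_mapping_eqI) (simp add: lookup_smult lookup_single when_def)

lemma smult_sum: "smult c (sum f A) = (\<Sum>a\<in>A. smult c (f a))"
  by (induction A rule: infinite_finite_induct) (auto simp: smult_add)

lemma smult_conv_mult: "smult c x = Poly_Mapping.single 0 c * (x :: 'a::monoid_add vec)"
  by (simp add: smult_def mult_map_scale_conv_mult)

lemma smult_mult_left: "smult c (x * y) = smult c x * (y :: 'a::monoid_add vec)"
  by (simp add: smult_conv_mult mult.assoc)

lemma smult_mult_right: "smult c (x * y) = x * smult c (y :: 'a::monoid_add vec)"
proof -
  have comm: "x * Poly_Mapping.single 0 c = Poly_Mapping.single 0 c * x" for x :: "'a vec"
  proof (induction x rule: vec_induct)
    case (single k v) show ?case by (simp add: mult_single mult.commute)
  next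
    case (add f g) thus ?case by (simp add: algebra_simps)
  qed
  show ?thesis by (metis comm smult_conv_mult mult.assoc)
qed

lemma smult_mult_smult:
  "smult c x * smult d y = smult c (smult d (x * (y :: 'a::monoid_add vec)))"
  by (metis smult_mult_left smult_mult_right)

lemma linext_superset:
  assumes "finite A" "Poly_Mapping.keys x \<subseteq> A"
  shows "linext f x = (\<Sum>b\<in>A. smult (Poly_Mapping.lookup x b) (f b))"
  unfolding linext_def
  by (rule sum.mono_neutral_left) (use assms in \<open>auto simp: in_keys_iff\<close>)

lemma linext_zero [simp]: "linext f 0 = 0"
  by (simp add: linext_def)

lemma linext_add: "linext f (x + y) = linext f x + linext f y"
proof -
  let ?A = "Poly_Mapping.keys x \<union> Poly_Mapping.keys y"
  have "linext f (x + y) = (\<Sum>b\<in>?A. smult (Poly_Mapping.lookup (x + y) b) (f b))"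
    by (rule linext_superset) (auto simp: in_keys_iff lookup_add)
  also have "\<dots> = (\<Sum>b\<in>?A. smult (Poly_Mapping.lookup x b) (f b)) + (\<Sum>b\<in>?A. smult (Poly_Mapping.lookup y b) (f b))"
    by (simp add: lookup_add smult_add_left sum.distrib)
  also have "\<dots> = linext f x + linext f y"
    by (subst (1 2) linext_superset[of ?A]) auto
  finally show ?thesis .
qed

lemma linext_smult: "linext f (smult c x) = smult c (linext f x)"
proof -
  have "linext f (smult c x) = (\<Sum>b\<in>Poly_Mapping.keys x. smult (Poly_Mapping.lookup (smult c x) b) (f b))"
    by (rule linext_superset) (auto simp: in_keys_iff lookup_smult)
  thus ?thesis by (simp add: linext_def lookup_smult smult_sum smult_smult)
qed

lemma linext_single [simp]: "linext f (Poly_Mapping.single b c) = smult c (f b)"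
  by (subst linext_superset[of "{b}"]) auto

lemma linext_uminus: "linext f (- x) = - linext f x"
  using linext_add[of f x "- x"] by (simp add: eq_neg_iff_add_eq_0 add.commute)

lemma linext_diff: "linext f (x - y) = linext f x - linext f y"
  using linext_add[of f x "- y"] by (simp add: linext_uminus)

lemma smult_diff: "smult c (x - y) = smult c x - smult c y"
  by (rule poly_mapping_eqI) (simp add: lookup_smult lookup_minus algebra_simps)

lemma linext_sum: "linext f (sum g A) = (\<Sum>a\<in>A. linext f (g a))"
  by (induction A rule: infinite_finite_induct) (auto simp: linext_add)

definition bilinext :: "('b \<Rightarrow> 'c \<Rightarrow> 'd vec) \<Rightarrow> 'b vec \<Rightarrow> 'c vec \<Rightarrow> 'd vec" where
  "bilinext f x y = linext (\<lambda>b. linext (f b) y) x"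

text \<open>
  The tensor algebra of \<open>'b vec\<close> is the monoid algebra of the free monoid on the basis:
  the word \<open>FWord [b\<^sub>1, \<dots>, b\<^sub>n]\<close> stands for the pure tensor of the basis vectors
  \<open>b\<^sub>1, \<dots>, b\<^sub>n\<close>, and the product of \<^typ>\<open>'a \<Rightarrow>\<^sub>0 complex\<close> for this monoid is
  the tensor product.
\<close>

datatype 'b fword = FWord (letters: "'b list")

instantiation fword :: (type) monoid_add
begin
definition "0 = FWord []"
definition "v + w = FWord (letters v @ letters w)"
instance by standard (auto simp: zero_fword_def plus_fword_def)
end

type_synonym 'b tensor = "'b fword vec"

definition tensor_incl :: "'b vec \<Rightarrow> 'b tensor" where
  "tensor_incl = linext (\<lambda>b. Poly_Mapping.single (FWord [b]) 1)"

definition tensor_power :: "nat \<Rightarrow> 'b tensor set" where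
  "tensor_power m = {x. \<forall>w\<in>Poly_Mapping.keys x. length (letters w) = m}"

definition permute_tensor :: "(nat \<Rightarrow> nat) \<Rightarrow> 'b tensor \<Rightarrow> 'b tensor" where
  "permute_tensor \<sigma> =
     linext (\<lambda>w. Poly_Mapping.single (FWord (permute_list \<sigma> (letters w))) 1)"

definition symmetric_power :: "nat \<Rightarrow> 'b tensor set" where
  "symmetric_power m =
     {x \<in> tensor_power m. \<forall>\<sigma>. \<sigma> permutes {..<m} \<longrightarrow> permute_tensor \<sigma> x = x}"

section \<open>The extended loop algebra and its enveloping algebra\<close>

text \<open>The standard basis \<open>x\<^sup>+, x\<^sup>-, h\<close> of \<open>sl\<^sub>2\<close>.\<close>

datatype sl2 = XPlus | XMinus | HH

fun sl2_bracket :: "sl2 \<Rightarrow> sl2 \<Rightarrow> sl2 vec" where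
  "sl2_bracket XPlus XMinus = Poly_Mapping.single HH 1"
| "sl2_bracket XMinus XPlus = Poly_Mapping.single HH (-1)"
| "sl2_bracket HH XPlus = Poly_Mapping.single XPlus 2"
| "sl2_bracket XPlus HH = Poly_Mapping.single XPlus (-2)"
| "sl2_bracket HH XMinus = Poly_Mapping.single XMinus (-2)"
| "sl2_bracket XMinus HH = Poly_Mapping.single XMinus 2"
| "sl2_bracket XPlus XPlus = 0"
| "sl2_bracket XMinus XMinus = 0"
| "sl2_bracket HH HH = 0"

text \<open>
  The basis of the extended loop algebra: \<open>Loop x r\<close> is \<open>x \<otimes> t\<^sup>r\<close> and \<open>Deg\<close> is \<open>d\<close>.
\<close>

datatype ext_loop = Loop sl2 int | Deg

fun basis_bracket :: "ext_loop \<Rightarrow> ext_loop \<Rightarrow> ext_loop vec" where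
  "basis_bracket (Loop x r) (Loop y s) =
     linext (\<lambda>z. Poly_Mapping.single (Loop z (r + s)) 1) (sl2_bracket x y)"
| "basis_bracket Deg (Loop x r) = Poly_Mapping.single (Loop x r) (of_int r)"
| "basis_bracket (Loop x r) Deg = Poly_Mapping.single (Loop x r) (- of_int r)"
| "basis_bracket Deg Deg = 0"

definition lie_bracket :: "ext_loop vec \<Rightarrow> ext_loop vec \<Rightarrow> ext_loop vec" where
  "lie_bracket = bilinext basis_bracket"

definition two_sided_ideal :: "'a::ring_1 set \<Rightarrow> bool" where
  "two_sided_ideal I \<longleftrightarrow>
     0 \<in> I \<and> (\<forall>x\<in>I. \<forall>y\<in>I. x + y \<in> I) \<and> (\<forall>a. \<forall>x\<in>I. a * x \<in> I \<and> x * a \<in> I)"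

definition left_ideal :: "'a::ring_1 set \<Rightarrow> bool" where
  "left_ideal I \<longleftrightarrow> 0 \<in> I \<and> (\<forall>x\<in>I. \<forall>y\<in>I. x + y \<in> I) \<and> (\<forall>a. \<forall>x\<in>I. a * x \<in> I)"

lemma two_sided_ideal_hull: "two_sided_ideal (two_sided_ideal hull S)"
  by (rule hull_in) (auto simp: two_sided_ideal_def)

lemma left_ideal_hull: "left_ideal (left_ideal hull S)"
  by (rule hull_in) (auto simp: left_ideal_def)

definition uea_relations :: "ext_loop tensor set" where
  "uea_relations =
     {tensor_incl x * tensor_incl y - tensor_incl y * tensor_incl x
        - tensor_incl (lie_bracket x y) | x y. True}"

definition uea_ideal :: "ext_loop tensor set" where
  "uea_ideal = two_sided_ideal hull uea_relations"

lemma
  shows uea_ideal_zero: "0 \<in> uea_ideal"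
    and uea_ideal_add: "x \<in> uea_ideal \<Longrightarrow> y \<in> uea_ideal \<Longrightarrow> x + y \<in> uea_ideal"
    and uea_ideal_mult_left: "x \<in> uea_ideal \<Longrightarrow> a * x \<in> uea_ideal"
    and uea_ideal_mult_right: "x \<in> uea_ideal \<Longrightarrow> x * a \<in> uea_ideal"
  using two_sided_ideal_hull[of uea_relations]
  unfolding uea_ideal_def two_sided_ideal_def by blast+

lemma uea_ideal_uminus: "x \<in> uea_ideal \<Longrightarrow> - x \<in> uea_ideal"
  using uea_ideal_mult_left[of x "-1"] by simp

lemma lookup_zero_tensor_mult:
  "Poly_Mapping.lookup ((x :: 'b tensor) * y) 0 = Poly_Mapping.lookup x 0 * Poly_Mapping.lookup y 0"
proof (induction x rule: vec_induct)
  case (single k v)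
  show ?case
  proof (induction y rule: vec_induct)
    case (single l u)
    show ?case
      by (cases k; cases l)
        (auto simp: mult_single lookup_single when_def zero_fword_def plus_fword_def)
  next
    case (add f g) thus ?case by (simp add: algebra_simps lookup_add)
  qed
next
  case (add f g) thus ?case by (simp add: algebra_simps lookup_add)
qed

lemma lookup_zero_tensor_incl: "Poly_Mapping.lookup (tensor_incl x) 0 = 0"
proof (induction x rule: vec_induct)
  case (single k v) show ?case
    by (simp add: tensor_incl_def lookup_single zero_fword_def)
next
  case (add f g) thus ?case by (simp add: tensor_incl_def linext_add lookup_add)
qed

lemma lookup_zero_uea_ideal:
  assumes "x \<in> uea_ideal" shows "Poly_Mapping.lookup x 0 = 0"
proof -
  have "uea_ideal \<subseteq> {x. Poly_Mapping.lookup x 0 = 0}"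
    unfolding uea_ideal_def
    by (rule hull_minimal)
      (auto simp: uea_relations_def two_sided_ideal_def lookup_zero_tensor_mult
        lookup_zero_tensor_incl lookup_add lookup_minus)
  with assms show ?thesis by auto
qed

text \<open>The algebra \<open>U\<^sup>e\<close>: the tensor algebra modulo \<open>x \<otimes> y - y \<otimes> x - [x, y]\<close>.\<close>

quotient_type uea = "ext_loop tensor" / "\<lambda>a b. a - b \<in> uea_ideal"
proof (rule equivpI)
  show "reflp (\<lambda>a b. a - b \<in> uea_ideal)"
    by (rule reflpI) (simp add: uea_ideal_zero)
  show "symp (\<lambda>a b. a - b \<in> uea_ideal)"
    by (rule sympI) (metis minus_diff_eq uea_ideal_uminus)
  show "transp (\<lambda>a b. a - b \<in> uea_ideal)"
    by (rule transpI) (metis diff_add_cancel add_diff_eq uea_ideal_add)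
qed

instantiation uea :: ring_1
begin

lift_definition zero_uea :: uea is 0 .
lift_definition one_uea :: uea is 1 .
lift_definition plus_uea :: "uea \<Rightarrow> uea \<Rightarrow> uea" is "(+)"
  by (metis (no_types) add_diff_add uea_ideal_add)
lift_definition uminus_uea :: "uea \<Rightarrow> uea" is "uminus"
  by (metis (no_types) minus_diff_minus uea_ideal_uminus)
lift_definition minus_uea :: "uea \<Rightarrow> uea \<Rightarrow> uea" is "(-)"
proof -
  fix a b c d :: "ext_loop tensor"
  assume "a - b \<in> uea_ideal" "c - d \<in> uea_ideal"
  hence "(a - b) + - (c - d) \<in> uea_ideal" by (intro uea_ideal_add uea_ideal_uminus)
  thus "a - c - (b - d) \<in> uea_ideal" by (simp add: algebra_simps)
qed
lift_definition times_uea :: "uea \<Rightarrow> uea \<Rightarrow> uea" is "(*)"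
proof -
  fix a b c d :: "ext_loop tensor"
  assume "a - b \<in> uea_ideal" "c - d \<in> uea_ideal"
  hence "(a - b) * c + b * (c - d) \<in> uea_ideal"
    by (intro uea_ideal_add uea_ideal_mult_left uea_ideal_mult_right)
  thus "a * c - b * d \<in> uea_ideal" by (simp add: algebra_simps)
qed

instance
proof
  show "(0::uea) \<noteq> 1"
    by transfer (use lookup_zero_uea_ideal[of "-1"] in auto)
qed (transfer; simp add: algebra_simps uea_ideal_zero)+

end

lift_definition uea_scale :: "complex \<Rightarrow> uea \<Rightarrow> uea" is smult
  by (simp add: smult_conv_mult right_diff_distrib[symmetric] uea_ideal_mult_left)

lift_definition uea_gen :: "ext_loop \<Rightarrow> uea" is "\<lambda>b. Poly_Mapping.single (FWord [b]) 1" .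

abbreviation xplus :: "int \<Rightarrow> uea" where "xplus r \<equiv> uea_gen (Loop XPlus r)"
abbreviation xminus :: "int \<Rightarrow> uea" where "xminus r \<equiv> uea_gen (Loop XMinus r)"
abbreviation hloop :: "int \<Rightarrow> uea" where "hloop r \<equiv> uea_gen (Loop HH r)"
abbreviation deg :: "uea" where "deg \<equiv> uea_gen Deg"

definition subalgebra :: "uea set \<Rightarrow> bool" where
  "subalgebra S \<longleftrightarrow>
     1 \<in> S \<and> (\<forall>a\<in>S. \<forall>b\<in>S. a + b \<in> S \<and> a * b \<in> S) \<and> (\<forall>c. \<forall>a\<in>S. uea_scale c a \<in> S)"

text \<open>
  The enveloping algebra \<open>U\<close> of \<open>sl\<^sub>2 \<otimes> \<complex>[t, t\<^sup>-\<^sup>1]\<close> as a subalgebra of \<open>U\<^sup>e\<close>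
  (the natural map is injective by the Poincare-Birkhoff-Witt theorem).
\<close>

definition U_loop :: "uea set" where
  "U_loop = subalgebra hull {uea_gen (Loop x r) | x r. True}"

definition U_zero :: "uea set" where
  "U_zero = subalgebra hull {hloop k | k. k \<noteq> 0}"

section \<open>The series \<open>\<Lambda>\<^sup>\<plusminus>(u)\<close> and the Weyl module\<close>

text \<open>
  The exponential of a series with zero constant term; the powers \<open>F ^ n\<close> with \<open>n > k\<close>
  do not contribute to the coefficient of \<open>u\<^sup>k\<close>.
\<close>

definition exp_series :: "uea fps \<Rightarrow> uea fps" where
  "exp_series F = Abs_fps (\<lambda>k. \<Sum>n\<le>k. uea_scale (1 / fact n) (fps_nth (F ^ n) k))"

text \<open>\<open>Lambda_series 1\<close> is \<open>\<Lambda>\<^sup>+(u)\<close> and \<open>Lambda_series (-1)\<close> is \<open>\<Lambda>\<^sup>-(u)\<close>.\<close>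

definition Lambda_series :: "int \<Rightarrow> uea fps" where
  "Lambda_series \<epsilon> =
     exp_series (Abs_fps (\<lambda>k. if k = 0 then 0
                              else uea_scale (- 1 / of_nat k) (hloop (\<epsilon> * int k))))"

definition Lambda :: "int \<Rightarrow> uea" where
  "Lambda k = fps_nth (Lambda_series (if k \<ge> 0 then 1 else -1)) (nat \<bar>k\<bar>)"

definition X0_minus_series :: "uea fps" where
  "X0_minus_series = Abs_fps (\<lambda>n. if n = 0 then 0 else xminus (int n - 1))"

text \<open>
  In the last family only \<open>s > m\<close> occurs: the series has no negative powers of \<open>u\<close>, so its
  coefficients at \<open>s < -m\<close> vanish.
\<close>

definition weyl_relations :: "nat \<Rightarrow> uea set" where
  "weyl_relations m =
     {xplus k | k. True}
   \<union> {hloop 0 - of_nat m, deg}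
   \<union> {Lambda k | k. \<bar>k\<bar> > int m}
   \<union> {Lambda (int m) * Lambda (- k) - Lambda (int m - k) | k. 1 \<le> k \<and> k \<le> int m}
   \<union> {(\<Sum>j\<le>m. xminus (s - 1 - int j) * Lambda (int j) * f) | s f. f \<in> U_zero}
   \<union> {fps_nth (X0_minus_series ^ r * Lambda_series 1) s * f | r s f.
        r \<ge> 1 \<and> s > m \<and> f \<in> U_zero}"

definition weyl_ideal :: "nat \<Rightarrow> uea set" where
  "weyl_ideal m = left_ideal hull weyl_relations m"

text \<open>
  The elements of \<open>W(m\<omega>)\<close> are the cosets of \<^term>\<open>weyl_ideal m\<close>; they are added as sets.
\<close>

definition weyl_module :: "nat \<Rightarrow> uea set set" where
  "weyl_module m = range (\<lambda>u. u +o weyl_ideal m)"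

definition weyl_lact :: "nat \<Rightarrow> uea \<Rightarrow> uea set \<Rightarrow> uea set" where
  "weyl_lact m a w = a *o w + weyl_ideal m"

lemma weyl_ideal_left_ideal: "left_ideal (weyl_ideal m)"
  by (simp add: weyl_ideal_def left_ideal_hull)

lemma
  shows weyl_ideal_zero: "0 \<in> weyl_ideal m"
    and weyl_ideal_add: "x \<in> weyl_ideal m \<Longrightarrow> y \<in> weyl_ideal m \<Longrightarrow> x + y \<in> weyl_ideal m"
    and weyl_ideal_mult_left: "x \<in> weyl_ideal m \<Longrightarrow> a * x \<in> weyl_ideal m"
  using weyl_ideal_left_ideal[of m] unfolding left_ideal_def by blast+

lemma weyl_ideal_set_plus: "weyl_ideal m + weyl_ideal m = weyl_ideal m"
proof
  show "weyl_ideal m + weyl_ideal m \<subseteq> weyl_ideal m"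
    by (auto elim!: set_plus_elim intro: weyl_ideal_add)
  show "weyl_ideal m \<subseteq> weyl_ideal m + weyl_ideal m"
    by (rule set_zero_plus2) (rule weyl_ideal_zero)
qed

lemma weyl_coset_add:
  "(u +o weyl_ideal m) + (v +o weyl_ideal m) = (u + v) +o weyl_ideal m"
  by (simp add: set_plus_rearrange weyl_ideal_set_plus)

lemma weyl_lact_coset: "weyl_lact m a (u +o weyl_ideal m) = (a * u) +o weyl_ideal m"
proof
  show "weyl_lact m a (u +o weyl_ideal m) \<subseteq> (a * u) +o weyl_ideal m"
    unfolding weyl_lact_def elt_set_plus_def elt_set_times_def set_plus_def
    by (auto simp: distrib_left add.assoc intro!: weyl_ideal_add weyl_ideal_mult_left)
  show "(a * u) +o weyl_ideal m \<subseteq> weyl_lact m a (u +o weyl_ideal m)"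
    unfolding weyl_lact_def elt_set_plus_def elt_set_times_def set_plus_def
    using weyl_ideal_zero[of m] by force
qed

section \<open>Symmetric Laurent polynomials and the right action on the Weyl module\<close>

text \<open>
  Laurent polynomials in \<open>t\<^sub>0, t\<^sub>1, \<dots>\<close>: an exponent \<open>\<alpha>\<close> of type \<^typ>\<open>nat \<Rightarrow>\<^sub>0 int\<close> stands for
  the monomial \<open>\<Prod>\<^sub>j t\<^sub>j\<^bsup>\<alpha> j\<^esup>\<close>. The variables of \<open>P\<^sub>m\<close> are numbered from \<open>0\<close> to \<open>m - 1\<close>.
\<close>

type_synonym laurent = "(nat \<Rightarrow>\<^sub>0 int) vec"

definition tpow :: "nat \<Rightarrow> int \<Rightarrow> laurent" where
  "tpow j k = Poly_Mapping.single (Poly_Mapping.single j k) 1"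

definition laurent_ring :: "nat \<Rightarrow> laurent set" where
  "laurent_ring m = {p. \<forall>\<alpha>\<in>Poly_Mapping.keys p. Poly_Mapping.keys \<alpha> \<subseteq> {..<m}}"

text \<open>The substitution \<open>t\<^sub>j \<mapsto> t\<^bsub>\<sigma> j\<^esub>\<close> for a permutation \<open>\<sigma>\<close>.\<close>

definition permute_vars :: "(nat \<Rightarrow> nat) \<Rightarrow> laurent \<Rightarrow> laurent" where
  "permute_vars \<sigma> =
     linext (\<lambda>\<alpha>. Poly_Mapping.single (Poly_Mapping.map_key (inv \<sigma>) \<alpha>) 1)"

definition sym_laurent :: "nat \<Rightarrow> laurent set" where
  "sym_laurent m =
     {p \<in> laurent_ring m. \<forall>\<sigma>. \<sigma> permutes {..<m} \<longrightarrow> permute_vars \<sigma> p = p}"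

definition elem_sym :: "nat \<Rightarrow> nat \<Rightarrow> laurent" where
  "elem_sym m r = (\<Sum>A\<in>{A. A \<subseteq> {..<m} \<and> card A = r}. \<Prod>j\<in>A. tpow j 1)"

text \<open>
  \<open>Lambda_expr m f p\<close>: the element \<open>f\<close> of \<open>U(0)\<close> and the Laurent polynomial \<open>p\<close> are values of
  one and the same element of \<open>\<complex>[\<Lambda>\<^sub>1, \<dots>, \<Lambda>\<^sub>m, \<Lambda>\<^sub>m\<^sup>-\<^sup>1]\<close>, where in \<open>P\<^sub>m\<close> one substitutes
  \<open>\<Lambda>\<^sub>r \<mapsto> (-1)\<^sup>r e\<^sub>r\<close>. The inverse of \<open>\<Lambda>\<^sub>m\<close> is represented in \<open>U(0)\<close> by \<open>\<Lambda>\<^bsub>-m\<^esub>\<close>, because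
  \<open>\<Lambda>\<^sub>m \<Lambda>\<^bsub>-m\<^esub> = \<Lambda>\<^sub>0 = 1\<close> holds in the quotient of \<open>U(0)\<close> acting on \<open>W(m\<omega>)\<close>; in \<open>P\<^sub>m\<close> it is
  \<open>(-1)\<^sup>m (t\<^sub>0 \<cdots> t\<^bsub>m-1\<^esub>)\<^sup>-\<^sup>1\<close>.
\<close>

inductive Lambda_expr :: "nat \<Rightarrow> uea \<Rightarrow> laurent \<Rightarrow> bool" for m where
  "Lambda_expr m (uea_scale c 1) (Poly_Mapping.single 0 c)"
| "1 \<le> r \<Longrightarrow> r \<le> m \<Longrightarrow> Lambda_expr m (Lambda (int r)) ((-1) ^ r * elem_sym m r)"
| "Lambda_expr m (Lambda (- int m)) ((-1) ^ m * (\<Prod>j<m. tpow j (-1)))"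
| "Lambda_expr m f p \<Longrightarrow> Lambda_expr m g q \<Longrightarrow> Lambda_expr m (f + g) (p + q)"
| "Lambda_expr m f p \<Longrightarrow> Lambda_expr m g q \<Longrightarrow> Lambda_expr m (f * g) (p * q)"

text \<open>
  The right action of a symmetric Laurent polynomial \<open>p\<close>: the coset \<open>w\<close> is represented by an
  element \<open>u\<close> of \<open>U\<close> (not of \<open>U\<^sup>e\<close>, where right multiplication by \<open>U(0)\<close> does not
  descend, since \<open>d\<close> and \<open>U(0)\<close> do not commute) and \<open>p\<close> by an element \<open>f\<close> of \<open>U(0)\<close>;
  the result is the coset of \<open>u * f\<close>, written here as a sum of sets over all such choices.
\<close>

definition weyl_ract :: "nat \<Rightarrow> uea set \<Rightarrow> laurent \<Rightarrow> uea set" where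
  "weyl_ract m w p =
     {u * f | u f. u \<in> w \<inter> U_loop \<and> Lambda_expr m f p} + weyl_ideal m"

section \<open>The module \<open>T\<^sup>m(L(V))\<close>\<close>

text \<open>
  \<open>V = \<complex>\<^sup>2\<close> with basis \<open>VPlus\<close>, \<open>VMinus\<close> of weights \<open>1\<close> and \<open>-1\<close>; the basis vector
  \<open>(v, s)\<close> of \<open>L(V)\<close> is \<open>v \<otimes> t\<^sup>s\<close>.
\<close>

datatype vbasis = VPlus | VMinus

fun V_act :: "sl2 \<Rightarrow> vbasis \<Rightarrow> vbasis vec" where
  "V_act XPlus VPlus = 0"
| "V_act XPlus VMinus = Poly_Mapping.single VPlus 1"
| "V_act XMinus VPlus = Poly_Mapping.single VMinus 1"
| "V_act XMinus VMinus = 0"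
| "V_act HH VPlus = Poly_Mapping.single VPlus 1"
| "V_act HH VMinus = Poly_Mapping.single VMinus (-1)"

type_synonym lv = "vbasis \<times> int"

fun LV_act :: "ext_loop \<Rightarrow> lv \<Rightarrow> lv vec" where
  "LV_act (Loop x r) (v, s) = linext (\<lambda>w. Poly_Mapping.single (w, r + s) 1) (V_act x v)"
| "LV_act Deg (v, s) = Poly_Mapping.single (v, s) (of_int s)"

text \<open>
  The action on tensors, by the coproduct:
  \<open>x.(v\<^sub>1 \<otimes> \<cdots> \<otimes> v\<^sub>m) = \<Sum>\<^sub>i v\<^sub>1 \<otimes> \<cdots> \<otimes> x.v\<^sub>i \<otimes> \<cdots> \<otimes> v\<^sub>m\<close>.
\<close>

definition word_act :: "ext_loop \<Rightarrow> lv list \<Rightarrow> lv tensor" where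
  "word_act b vs = (\<Sum>i<length vs. Poly_Mapping.single (FWord (take i vs)) 1
      * tensor_incl (LV_act b (vs ! i)) * Poly_Mapping.single (FWord (drop (Suc i) vs)) 1)"

definition gen_act :: "ext_loop \<Rightarrow> lv tensor \<Rightarrow> lv tensor" where
  "gen_act b = linext (\<lambda>w. word_act b (letters w))"

definition tensor_act :: "ext_loop tensor \<Rightarrow> lv tensor \<Rightarrow> lv tensor" where
  "tensor_act a x = linext (\<lambda>w. foldr gen_act (letters w) x) a"

lemma gen_act_linear:
  "gen_act b (x + y) = gen_act b x + gen_act b y"
  "gen_act b (x - y) = gen_act b x - gen_act b y"
  "gen_act b (smult c x) = smult c (gen_act b x)"
  "gen_act b 0 = 0"
  by (simp_all add: gen_act_def linext_add linext_smult linext_diff)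

lemma word_act_Cons:
  "word_act b (v # vs) =
     tensor_incl (LV_act b v) * Poly_Mapping.single (FWord vs) 1
     + Poly_Mapping.single (FWord [v]) 1 * word_act b vs"
proof -
  have 1: "Poly_Mapping.single (FWord []) (1::complex) = 1"
    by (simp flip: zero_fword_def)
  show ?thesis
    unfolding word_act_def list.size add_Suc_right add_0_right sum.lessThan_Suc_shift
    by (simp add: 1 sum_distrib_left mult_single plus_fword_def flip: mult.assoc)
qed

lemma word_act_append:
  "word_act b (vs @ ws) =
     word_act b vs * Poly_Mapping.single (FWord ws) 1
     + Poly_Mapping.single (FWord vs) 1 * word_act b ws"
proof (induction vs)
  case Nil
  show ?case by (simp add: word_act_def flip: zero_fword_def)
next
  case (Cons v vs)
  have 1: "Poly_Mapping.single (FWord vs) 1 * Poly_Mapping.single (FWord ws) (1::complex) =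
      Poly_Mapping.single (FWord (vs @ ws)) 1"
    by (simp add: mult_single plus_fword_def)
  have 2: "Poly_Mapping.single (FWord [v]) 1 * Poly_Mapping.single (FWord vs) (1::complex) =
      Poly_Mapping.single (FWord (v # vs)) 1"
    by (simp add: mult_single plus_fword_def)
  show ?case
    unfolding append_Cons word_act_Cons Cons.IH 1[symmetric] 2[symmetric]
    by (simp add: algebra_simps)
qed

lemma gen_act_single: "gen_act b (Poly_Mapping.single w c) = smult c (word_act b (letters w))"
  by (simp add: gen_act_def)

lemma single_letters:
  "Poly_Mapping.single w c = smult c (Poly_Mapping.single (FWord (letters w)) 1)"
  by simp

lemma gen_act_derivation: "gen_act b (x * y) = gen_act b x * y + x * gen_act b y"
proof (induction x rule: vec_induct)
  case (single k v)
  show ?case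
  proof (induction y rule: vec_induct)
    case (single l u)
    have "gen_act b (Poly_Mapping.single k v * Poly_Mapping.single l u) =
        smult v (smult u (word_act b (letters k @ letters l)))"
      by (simp add: mult_single gen_act_single smult_smult plus_fword_def)
    also have "\<dots> =
        smult v (word_act b (letters k)) * smult u (Poly_Mapping.single (FWord (letters l)) 1)
        + smult v (Poly_Mapping.single (FWord (letters k)) 1) * smult u (word_act b (letters l))"
      by (simp only: word_act_append smult_add smult_mult_smult)
    also have "\<dots> = gen_act b (Poly_Mapping.single k v) * Poly_Mapping.single l u
        + Poly_Mapping.single k v * gen_act b (Poly_Mapping.single l u)"
      by (simp add: gen_act_single)
    finally show ?case .
  next
    case (add f g)
    have "gen_act b (Poly_Mapping.single k v * (f + g)) =
        gen_act b (Poly_Mapping.single k v * f) + gen_act b (Poly_Mapping.single k v * g)"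
      by (simp only: distrib_left gen_act_linear)
    thus ?case by (simp only: add.IH distrib_left gen_act_linear add_ac)
  qed
next
  case (add f g)
  have "gen_act b ((f + g) * y) = gen_act b (f * y) + gen_act b (g * y)"
    by (simp only: distrib_right gen_act_linear)
  thus ?case by (simp only: add.IH distrib_right gen_act_linear add_ac)
qed

lemma gen_act_single_letter:
  "gen_act b (tensor_incl x) = tensor_incl (linext (LV_act b) x)"
proof (induction x rule: vec_induct)
  case (single v c)
  have "word_act b [v] = tensor_incl (LV_act b v)"
    by (simp add: word_act_def flip: zero_fword_def)
  thus ?case
    by (simp add: gen_act_def tensor_incl_def linext_smult)
next
  case (add f g) thus ?case by (simp add: tensor_incl_def linext_add gen_act_linear)
qed

lemma gen_act_one: "gen_act b 1 = 0"
  using gen_act_derivation[of b 1 1] by simp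

lemma foldr_gen_act_linear:
  "foldr gen_act bs (x + y) = foldr gen_act bs x + foldr gen_act bs y"
  "foldr gen_act bs (smult c x) = smult c (foldr gen_act bs x)"
  by (induction bs) (simp_all add: gen_act_linear)

lemma tensor_act_linear:
  "tensor_act (a + b) x = tensor_act a x + tensor_act b x"
  "tensor_act (a - b) x = tensor_act a x - tensor_act b x"
  "tensor_act (smult c a) x = smult c (tensor_act a x)"
  "tensor_act 0 x = 0"
  by (simp_all add: tensor_act_def linext_add linext_smult linext_diff)

lemma tensor_act_linear_right:
  "tensor_act a (x + y) = tensor_act a x + tensor_act a y"
  "tensor_act a (smult c x) = smult c (tensor_act a x)"
  by (simp_all add: tensor_act_def linext_def foldr_gen_act_linear smult_add sum.distrib
      smult_sum smult_smult mult.commute)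

lemma tensor_act_zero_right: "tensor_act a 0 = 0"
  using tensor_act_linear_right(1)[of a 0 0] by simp

lemma tensor_act_mult: "tensor_act (a * b) x = tensor_act a (tensor_act b x)"
proof (induction a rule: vec_induct)
  case (single k v)
  show ?case
  proof (induction b rule: vec_induct)
    case (single l u)
    show ?case
      by (simp add: tensor_act_def mult_single plus_fword_def foldr_gen_act_linear smult_smult)
  next
    case (add f g)
    thus ?case by (simp add: distrib_left tensor_act_linear tensor_act_linear_right)
  qed
next
  case (add f g) thus ?case by (simp add: distrib_right tensor_act_linear)
qed

lemma tensor_act_incl:
  "tensor_act (tensor_incl (Poly_Mapping.single b c)) x = smult c (gen_act b x)"
  by (simp add: tensor_act_def tensor_incl_def)

lemma tensor_incl_add: "tensor_incl (x + y) = tensor_incl x + tensor_incl y"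
  by (simp add: tensor_incl_def linext_add)

lemma tensor_incl_diff: "tensor_incl (x - y) = tensor_incl x - tensor_incl y"
  by (simp add: tensor_incl_def linext_diff)

lemma tensor_act_incl_derivation:
  "tensor_act (tensor_incl b) (x * y) =
     tensor_act (tensor_incl b) x * y + x * tensor_act (tensor_incl b) y"
proof (induction b rule: vec_induct)
  case (single b c)
  show ?case
    by (simp add: tensor_act_incl gen_act_derivation smult_add smult_mult_left
        flip: smult_mult_right)
next
  case (add f g)
  thus ?case by (simp add: tensor_incl_add tensor_act_linear algebra_simps)
qed

lemma tensor_act_incl_letter:
  "tensor_act (tensor_incl b) (tensor_incl x) =
     tensor_incl (linext (\<lambda>c. linext (LV_act c) x) b)"
proof (induction b rule: vec_induct)
  case (single b c)
  show ?case
    by (simp add: tensor_act_incl gen_act_single_letter) (simp add: tensor_incl_def linext_smult)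
next
  case (add f g)
  thus ?case by (simp add: tensor_incl_add tensor_act_linear linext_add)
qed

lemma LV_act_bracket:
  "linext (LV_act a) (LV_act b v) - linext (LV_act b) (LV_act a v) =
     linext (\<lambda>c. LV_act c v) (basis_bracket a b)"
proof (cases v)
  case (Pair w s)
  show ?thesis
  proof (cases a; cases b)
    fix x r y q assume "a = Loop x r" "b = Loop y q"
    thus ?thesis unfolding Pair
      by (cases x; cases y; cases w)
        (auto intro!: poly_mapping_eqI simp: lookup_add lookup_minus lookup_single when_def add_ac)
  next
    fix x r assume "a = Loop x r" "b = Deg"
    thus ?thesis unfolding Pair
      by (cases x; cases w) (auto intro!: poly_mapping_eqI
          simp: lookup_add lookup_minus lookup_single when_def algebra_simps)
  next
    fix x r assume "a = Deg" "b = Loop x r"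
    thus ?thesis unfolding Pair
      by (cases x; cases w) (auto intro!: poly_mapping_eqI
          simp: lookup_add lookup_minus lookup_single when_def algebra_simps)
  next
    assume "a = Deg" "b = Deg"
    thus ?thesis by simp
  qed
qed

lemma gen_act_bracket:
  "gen_act a (gen_act b x) - gen_act b (gen_act a x) =
     tensor_act (tensor_incl (basis_bracket a b)) x"
proof (induction x rule: vec_induct)
  case (single k c)
  have *: "gen_act a (gen_act b (Poly_Mapping.single (FWord vs) 1))
        - gen_act b (gen_act a (Poly_Mapping.single (FWord vs) 1)) =
      tensor_act (tensor_incl (basis_bracket a b)) (Poly_Mapping.single (FWord vs) 1)" for vs
  proof (induction vs)
    case Nil
    have "tensor_act (tensor_incl y) 1 = 0" for y
      using tensor_act_incl_derivation[of y 1 1] by simp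
    thus ?case by (simp add: gen_act_one gen_act_linear flip: zero_fword_def)
  next
    case (Cons v vs)
    let ?v = "tensor_incl (Poly_Mapping.single v 1)"
    let ?vs = "Poly_Mapping.single (FWord vs) (1::complex)"
    have v: "Poly_Mapping.single (FWord (v # vs)) 1 = ?v * ?vs"
      by (simp add: tensor_incl_def mult_single plus_fword_def)
    have "gen_act a (gen_act b ?v) - gen_act b (gen_act a ?v) =
        tensor_act (tensor_incl (basis_bracket a b)) ?v"
      by (simp add: gen_act_single_letter tensor_act_incl_letter LV_act_bracket
          flip: tensor_incl_diff)
    thus ?case
      unfolding v gen_act_derivation tensor_act_incl_derivation Cons.IH[symmetric]
      by (simp add: gen_act_linear gen_act_derivation algebra_simps)
  qed
  have k: "Poly_Mapping.single k c = smult c (Poly_Mapping.single (FWord (letters k)) 1)" by simp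
  show ?case
    unfolding k gen_act_linear tensor_act_linear_right *[symmetric] by (simp add: smult_diff)
next
  case (add f g)
  thus ?case by (simp add: gen_act_linear tensor_act_linear_right algebra_simps)
qed

lemma lie_bracket_add:
  "lie_bracket (x + y) z = lie_bracket x z + lie_bracket y z"
  "lie_bracket x (y + z) = lie_bracket x y + lie_bracket x z"
  by (simp_all add: lie_bracket_def bilinext_def linext_add)
    (simp add: linext_def smult_add sum.distrib)

lemma tensor_act_relation:
  "tensor_act (tensor_incl x * tensor_incl y - tensor_incl y * tensor_incl x
     - tensor_incl (lie_bracket x y)) z = 0"
proof (induction x rule: vec_induct)
  case (single a c)
  show ?case
  proof (induction y rule: vec_induct)
    case (single b d)
    have "tensor_incl (lie_bracket (Poly_Mapping.single a c) (Poly_Mapping.single b d)) =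
        smult c (smult d (tensor_incl (basis_bracket a b)))"
      by (simp add: lie_bracket_def bilinext_def tensor_incl_def linext_smult)
    thus ?case
      by (simp add: tensor_act_linear tensor_act_mult tensor_act_incl gen_act_linear smult_smult
          mult.commute flip: gen_act_bracket smult_diff)
  next
    case (add f g)
    thus ?case
      by (simp add: tensor_incl_add lie_bracket_add algebra_simps tensor_act_linear)
  qed
next
  case (add f g)
  thus ?case
    by (simp add: tensor_incl_add lie_bracket_add algebra_simps tensor_act_linear)
qed

lemma tensor_act_uea_ideal:
  assumes "a \<in> uea_ideal" shows "tensor_act a x = 0"
proof -
  have "uea_relations \<subseteq> {a. \<forall>x. tensor_act a x = 0}"
    unfolding uea_relations_def using tensor_act_relation by blast
  moreover have "two_sided_ideal {a. \<forall>x. tensor_act a x = 0}"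
    by (simp add: two_sided_ideal_def tensor_act_linear tensor_act_mult tensor_act_zero_right)
  ultimately have "uea_ideal \<subseteq> {a. \<forall>x. tensor_act a x = 0}"
    unfolding uea_ideal_def by (rule hull_minimal)
  with assms show ?thesis by auto
qed

lift_definition uea_act :: "uea \<Rightarrow> lv tensor \<Rightarrow> lv tensor" is tensor_act
proof (rule ext)
  fix a b :: "ext_loop tensor" and x :: "lv tensor"
  assume "a - b \<in> uea_ideal"
  hence "tensor_act (a - b) x = 0" by (rule tensor_act_uea_ideal)
  thus "tensor_act a x = tensor_act b x" by (simp add: tensor_act_linear)
qed

lemma uea_act_one: "uea_act 1 x = x"
  by transfer (simp add: tensor_act_def foldr_gen_act_linear flip: single_one,
      simp add: zero_fword_def)

lemma uea_act_mult: "uea_act (a * b) x = uea_act a (uea_act b x)"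
  by transfer (rule tensor_act_mult)

lemma uea_act_gen: "uea_act (uea_gen b) x = gen_act b x"
  by transfer (simp add: tensor_act_def)

text \<open>
  The right action of Laurent polynomials: \<open>t\<^sub>j\<close> multiplies by \<open>t\<close> in the \<open>j\<close>-th tensor
  factor (counted from \<open>0\<close>).
\<close>

definition shift_word :: "lv fword \<Rightarrow> (nat \<Rightarrow>\<^sub>0 int) \<Rightarrow> lv fword" where
  "shift_word w \<alpha> =
     FWord (map (\<lambda>j. (fst (letters w ! j), snd (letters w ! j) + Poly_Mapping.lookup \<alpha> j))
       [0..<length (letters w)])"

definition tensor_ract :: "lv tensor \<Rightarrow> laurent \<Rightarrow> lv tensor" where
  "tensor_ract = bilinext (\<lambda>w \<alpha>. Poly_Mapping.single (shift_word w \<alpha>) 1)"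

end

(*
  Let v be the word v_+ (x) 1, ..., v_+ (x) 1 in the m-fold tensor power; the isomorphism sends the
  class of u to u.v. For lists ks and ls of exponents let orb ks ls be the element of U, recursively
  defined from products of the x^-_k and h_l, that sends v to the sum over all ways to place the
  letters v_- (x) t^k and v_+ (x) t^l at distinct positions and v_+ (x) 1 elsewhere. There is no such
  placement if ks and ls together have more than m entries, and the heart of the matter is that
  orb ks ls is then already zero in W(m omega): the generating relations give this when all k are 0
  and all l are 1, and commutation with the h_c, the recursion, and the invertibility of Lambda_m
  (with Newton's identities) carry it over to all exponents. Since h_0 = m allows one to pad ls with
  zeros, W(m omega) is spanned by the orb ks ls with exactly m exponents, and these are sent to
  symmetrized words. The linear map taking a word with exponents ks, ls to orb ks ls / m! is therefore
  a left inverse on symmetric tensors, so u.v = 0 only if u is zero in W(m omega). That the right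
  action is well defined follows from the injectivity.
*)

theory Submission
  imports Defs
begin

section \<open>Computing in the enveloping algebra\<close>

text \<open>The relations speak of series in the x^- and Lambda, whereas \<open>orb\<close> speaks
  of placements; Newton's identities link the two. On the highest weight vector n letters v_+ (x) t
  give n! e_n(t), and already in the enveloping algebra \<open>orb [] (replicate n 1)\<close> equals
  (-1)^n n! Lambda_n. Adding letters v_- turns this into the coefficients of X_0^-(u)^r Lambda^+(u):
  up to a scalar, the one at u^s belongs to r exponents 0 and s - r exponents 1, so that s > m says
  exactly that there are more letters than positions.

  The obstacle is the side of multiplication. The recursion of \<open>orb\<close> multiplies by h_l
  on the right, under which a left ideal need not be stable; hence vanishing is proved in
  \<open>weyl_core\<close>, and d is dealt with separately by a grading.

  No basis of the enveloping algebra is needed: independence is read off from words in the tensor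
  power. The fundamental theorem on symmetric Laurent polynomials is not presupposed either, but
  comes out of the explicit preimages of symmetric tensors.\<close>

lemma uea_scale_add: "uea_scale c (x + y) = uea_scale c x + uea_scale c y"
  by transfer (simp add: smult_add uea_ideal_zero)

lemma uea_scale_zero [simp]: "uea_scale c 0 = 0"
  by transfer (simp add: uea_ideal_zero)

lemma uea_scale_minus: "uea_scale c (- x) = - uea_scale c x"
  by (metis add_eq_0_iff uea_scale_add uea_scale_zero)

lemma uea_scale_diff: "uea_scale c (x - y) = uea_scale c x - uea_scale c y"
  using uea_scale_add[of c x "- y"] by (simp add: uea_scale_minus)

lemma uea_scale_add_left: "uea_scale (c + d) x = uea_scale c x + uea_scale d x"
  by transfer (simp add: smult_add_left uea_ideal_zero)

lemma uea_scale_scale [simp]: "uea_scale c (uea_scale d x) = uea_scale (c * d) x"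
  by transfer (simp add: smult_smult uea_ideal_zero)

lemma uea_scale_one [simp]: "uea_scale 1 x = x"
  by transfer (simp add: uea_ideal_zero)

lemma uea_scale_zero_left [simp]: "uea_scale 0 x = 0"
  by transfer (simp add: uea_ideal_zero)

lemma uea_scale_minus_left: "uea_scale (- c) x = - uea_scale c x"
  by (metis add.right_inverse add_eq_0_iff uea_scale_add_left uea_scale_zero_left)

lemma uea_scale_mult_left: "uea_scale c x * y = uea_scale c (x * y)"
  by transfer (simp add: smult_mult_left uea_ideal_zero)

lemma uea_scale_mult_right: "x * uea_scale c y = uea_scale c (x * y)"
  by transfer (simp add: smult_mult_right uea_ideal_zero)

lemma uea_scale_sum: "uea_scale c (sum f A) = (\<Sum>a\<in>A. uea_scale c (f a))"
  by (induction A rule: infinite_finite_induct) (auto simp: uea_scale_add)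

lemma uea_scale_of_nat: "uea_scale (of_nat n) x = of_nat n * x"
  by (induction n) (auto simp: uea_scale_add_left algebra_simps)

lemma uea_scale_numeral: "uea_scale (numeral n) x = numeral n * x"
  using uea_scale_of_nat[of "numeral n" x] by simp

text \<open>Every class is represented by a combination of words. The words are built by adding
  generators on the left, which suits arguments modulo a left ideal.\<close>

lemma uea_induct [case_names one gen add scale]:
  assumes one: "P 1"
    and gen: "\<And>b u. P u \<Longrightarrow> P (uea_gen b * u)"
    and add: "\<And>u v. P u \<Longrightarrow> P v \<Longrightarrow> P (u + v)"
    and scale: "\<And>c u. P u \<Longrightarrow> P (uea_scale c u)"
  shows "P u"
proof -
  have word: "P (abs_uea (Poly_Mapping.single (FWord bs) 1))" for bs
  proof (induction bs)
    case Nil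
    show ?case using one by (simp add: one_uea.abs_eq flip: zero_fword_def single_one)
  next
    case (Cons b bs)
    have "Poly_Mapping.single (FWord (b # bs)) (1::complex)
        = Poly_Mapping.single (FWord [b]) 1 * Poly_Mapping.single (FWord bs) 1"
      by (simp add: mult_single plus_fword_def)
    hence "abs_uea (Poly_Mapping.single (FWord (b # bs)) 1)
        = uea_gen b * abs_uea (Poly_Mapping.single (FWord bs) 1)"
      by (simp add: uea_gen_def times_uea.abs_eq)
    with gen[OF Cons.IH] show ?case by simp
  qed
  have "P (abs_uea x)" for x
  proof (induction x rule: vec_induct)
    case (single w c)
    have "abs_uea (Poly_Mapping.single w c)
        = uea_scale c (abs_uea (Poly_Mapping.single (FWord (letters w)) 1))"
      by (simp add: uea_scale.abs_eq)
    with scale[OF word, of c "letters w"] show ?case by simp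
  next
    case (add x y)
    with assms(3) show ?case by (metis plus_uea.abs_eq)
  qed
  thus ?thesis by (metis Quotient3_abs_rep Quotient3_uea)
qed

section \<open>Commutation relations of the generators\<close>

lemma uea_gen_commutator:
  "uea_gen a * uea_gen b =
     uea_gen b * uea_gen a + abs_uea (tensor_incl (basis_bracket a b))"
proof -
  have "tensor_incl (Poly_Mapping.single a 1) * tensor_incl (Poly_Mapping.single b 1)
      - tensor_incl (Poly_Mapping.single b 1) * tensor_incl (Poly_Mapping.single a 1)
      - tensor_incl (lie_bracket (Poly_Mapping.single a 1) (Poly_Mapping.single b 1))
      \<in> uea_relations"
    unfolding uea_relations_def by blast
  also have "uea_relations \<subseteq> uea_ideal"
    unfolding uea_ideal_def by (rule hull_subset)
  finally have *: "Poly_Mapping.single (FWord [a]) 1 * Poly_Mapping.single (FWord [b]) 1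
      - (Poly_Mapping.single (FWord [b]) 1 * Poly_Mapping.single (FWord [a]) 1
      + tensor_incl (basis_bracket a b)) \<in> uea_ideal"
    by (simp add: lie_bracket_def bilinext_def tensor_incl_def algebra_simps)
  have "abs_uea (Poly_Mapping.single (FWord [a]) 1 * Poly_Mapping.single (FWord [b]) 1) =
     abs_uea (Poly_Mapping.single (FWord [b]) 1 * Poly_Mapping.single (FWord [a]) 1
      + tensor_incl (basis_bracket a b))"
    using * by (simp only: uea.abs_eq_iff)
  thus ?thesis
    by (simp only: uea_gen_def map_fun_apply id_apply times_uea.abs_eq plus_uea.abs_eq)
qed

lemma abs_uea_single: "abs_uea (tensor_incl (Poly_Mapping.single b c)) = uea_scale c (uea_gen b)"
  by (simp add: tensor_incl_def uea_gen_def uea_scale.abs_eq)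

lemma abs_uea_zero: "abs_uea (tensor_incl 0) = 0"
  by (simp add: tensor_incl_def zero_uea.abs_eq)

lemma xminus_commute: "xminus a * xminus b = xminus b * xminus a"
  using uea_gen_commutator[of "Loop XMinus a" "Loop XMinus b"] by (simp add: abs_uea_zero)

lemma hloop_commute: "hloop a * hloop b = hloop b * hloop a"
  using uea_gen_commutator[of "Loop HH a" "Loop HH b"] by (simp add: abs_uea_zero)

lemma hloop_xminus: "hloop a * xminus b = xminus b * hloop a - 2 * xminus (a + b)"
  using uea_gen_commutator[of "Loop HH a" "Loop XMinus b"]
  by (simp add: abs_uea_single uea_scale_minus_left uea_scale_numeral)

lemma xplus_xminus: "xplus a * xminus b = xminus b * xplus a + hloop (a + b)"
  using uea_gen_commutator[of "Loop XPlus a" "Loop XMinus b"] by (simp add: abs_uea_single)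

lemma xplus_hloop: "xplus a * hloop b = hloop b * xplus a - 2 * xplus (a + b)"
  using uea_gen_commutator[of "Loop XPlus a" "Loop HH b"]
  by (simp add: abs_uea_single uea_scale_minus_left uea_scale_numeral)

lemma deg_loop: "deg * uea_gen (Loop x k) = uea_gen (Loop x k) * deg
    + uea_scale (of_int k) (uea_gen (Loop x k))"
  using uea_gen_commutator[of Deg "Loop x k"] by (simp add: abs_uea_single)

section \<open>Subalgebras and the commutativity of U(0)\<close>

lemma subalgebra_hull: "subalgebra (subalgebra hull S)"
  by (rule hull_in) (auto simp: subalgebra_def)

lemma subalgebra_closed:
  assumes "subalgebra S"
  shows "1 \<in> S" and "0 \<in> S"
    and "a \<in> S \<Longrightarrow> b \<in> S \<Longrightarrow> a + b \<in> S" and "a \<in> S \<Longrightarrow> b \<in> S \<Longrightarrow> a * b \<in> S"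
    and "a \<in> S \<Longrightarrow> uea_scale c a \<in> S" and "a \<in> S \<Longrightarrow> - a \<in> S"
    and "a \<in> S \<Longrightarrow> b \<in> S \<Longrightarrow> a - b \<in> S"
proof -
  show 1: "1 \<in> S" "a \<in> S \<Longrightarrow> b \<in> S \<Longrightarrow> a + b \<in> S" "a \<in> S \<Longrightarrow> b \<in> S \<Longrightarrow> a * b \<in> S"
    "a \<in> S \<Longrightarrow> uea_scale c a \<in> S" for a b c
    using assms by (auto simp: subalgebra_def)
  show "0 \<in> S" using 1(4)[of 1 0] 1(1) by simp
  show 2: "- a \<in> S" if "a \<in> S" for a using 1(4)[OF that, of "-1"] by (simp add: uea_scale_minus_left)
  show "a - b \<in> S" if "a \<in> S" "b \<in> S" using 1(2)[OF that(1) 2[OF that(2)]] by simp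
qed

lemma subalgebra_sum:
  assumes "subalgebra S" "\<And>x. x \<in> A \<Longrightarrow> f x \<in> S"
  shows "sum f A \<in> S"
  using assms(2) by (induction A rule: infinite_finite_induct)
    (auto simp: subalgebra_closed[OF assms(1)])

lemma subalgebra_sum_list:
  assumes "subalgebra S" "\<And>x. x \<in> set xs \<Longrightarrow> f x \<in> S"
  shows "(\<Sum>x\<leftarrow>xs. f x) \<in> S"
  using assms(2) by (induction xs) (auto simp: subalgebra_closed[OF assms(1)])

lemma U_loop_subalgebra: "subalgebra U_loop"
  by (simp add: U_loop_def subalgebra_hull)

lemma U_zero_subalgebra: "subalgebra U_zero"
  by (simp add: U_zero_def subalgebra_hull)

lemmas U_loop_closed = subalgebra_closed[OF U_loop_subalgebra]
lemmas U_zero_closed = subalgebra_closed[OF U_zero_subalgebra]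

lemma U_loop_gen [simp]: "uea_gen (Loop x r) \<in> U_loop"
  unfolding U_loop_def by (rule hull_inc) blast

lemma hloop_in_U_zero: "k \<noteq> 0 \<Longrightarrow> hloop k \<in> U_zero"
  unfolding U_zero_def by (rule hull_inc) blast

lemma U_zero_minimal:
  assumes "subalgebra S" "\<And>k. k \<noteq> 0 \<Longrightarrow> hloop k \<in> S"
  shows "U_zero \<subseteq> S"
  unfolding U_zero_def by (rule hull_minimal) (use assms in auto)

lemma U_zero_subset_U_loop: "U_zero \<subseteq> U_loop"
  by (rule U_zero_minimal) (auto simp: U_loop_subalgebra)

lemma subalgebra_centralizer: "subalgebra {a. \<forall>b\<in>B. a * b = b * a}"
proof -
  have "x * y * b = b * (x * y)" if "x * b = b * x" "y * b = b * y" for x y b :: uea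
    by (metis that mult.assoc)
  thus ?thesis
    unfolding subalgebra_def
    by (auto simp: distrib_left distrib_right uea_scale_mult_left uea_scale_mult_right)
qed

lemma U_zero_hloop_commute: "a \<in> U_zero \<Longrightarrow> a * hloop k = hloop k * a"
proof -
  have "U_zero \<subseteq> {a. \<forall>b\<in>{hloop k}. a * b = b * a}"
    by (rule U_zero_minimal[OF subalgebra_centralizer]) (auto simp: hloop_commute)
  thus "a \<in> U_zero \<Longrightarrow> a * hloop k = hloop k * a" by auto
qed

text \<open>Centralizers are subalgebras, so it suffices to test generators, in one factor after the
  other.\<close>

lemma U_zero_commute: "a \<in> U_zero \<Longrightarrow> b \<in> U_zero \<Longrightarrow> a * b = b * a"
proof -
  have "U_zero \<subseteq> {a. \<forall>b\<in>U_zero. a * b = b * a}"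
    by (rule U_zero_minimal[OF subalgebra_centralizer]) (auto simp: U_zero_hloop_commute)
  thus "a \<in> U_zero \<Longrightarrow> b \<in> U_zero \<Longrightarrow> a * b = b * a" by auto
qed

section \<open>Lifts of the orbit sums\<close>

text \<open>The Leibniz rule for h_l produces one term for each letter, with the exponent of that
  letter raised by l. Exponents are kept in lists because \<open>orb\<close> recurses on the head;
  independence of the order is proved afterwards.\<close>

fun bumps :: "int \<Rightarrow> int list \<Rightarrow> int list list" where
  "bumps l [] = []"
| "bumps l (x # xs) = ((x + l) # xs) # map ((#) x) (bumps l xs)"

text \<open>Once the order of a list is irrelevant, the entry raised by \<open>bumps\<close> can be
  moved to the front, and \<open>picks\<close> serves to state this. It also describes how x^-_k
  turns one of the letters v_+ (x) t^y into v_- (x) t^(k+y).\<close>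

fun picks :: "'a list \<Rightarrow> ('a \<times> 'a list) list" where
  "picks [] = []"
| "picks (x # xs) = (x, xs) # map (\<lambda>(y, ys). (y, x # ys)) (picks xs)"

lemma length_bumps [termination_simp]: "b \<in> set (bumps l xs) \<Longrightarrow> length b = length xs"
  by (induction xs arbitrary: b) auto

lemma mset_picks: "(y, r) \<in> set (picks xs) \<Longrightarrow> mset xs = add_mset y (mset r)"
  by (induction xs arbitrary: y r) auto

lemma length_picks: "(y, r) \<in> set (picks xs) \<Longrightarrow> length xs = Suc (length r)"
  by (metis mset_picks size_add_mset size_mset)

lemma sum_bumps_append:
  "(\<Sum>b\<leftarrow>bumps l (xs @ ys). F b) =
     (\<Sum>b\<leftarrow>bumps l xs. F (b @ ys)) + (\<Sum>b\<leftarrow>bumps l ys. F (xs @ b) :: 'a::comm_monoid_add)"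
  by (induction xs arbitrary: F) (auto simp: o_def add_ac)

lemma sum_bumps_commute:
  "(\<Sum>b\<leftarrow>bumps k xs. \<Sum>c\<leftarrow>bumps l b. F c) =
     (\<Sum>b\<leftarrow>bumps l xs. \<Sum>c\<leftarrow>bumps k b. F c :: 'a::comm_monoid_add)"
  by (induction xs arbitrary: F) (auto simp: o_def add_ac sum_list_addf)

text \<open>The picked entry is either the raised one or a different one.\<close>

lemma sum_bumps_picks_commute:
  "(\<Sum>b\<leftarrow>bumps l xs. \<Sum>(y, r)\<leftarrow>picks b. F y r) =
     (\<Sum>(y, r)\<leftarrow>picks xs. F (y + l) r + (\<Sum>b\<leftarrow>bumps l r. F y b :: 'a::comm_monoid_add))"
proof (induction xs arbitrary: F)
  case (Cons x xs)
  show ?case using Cons.IH[of "\<lambda>y r. F y (x # r)"]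
    by (simp add: o_def add_ac sum_list_addf case_prod_unfold)
qed simp

text \<open>Symmetry of \<open>F\<close> is asked for only on lists as long as \<open>xs\<close>: in
  the inductions on the length in which this is used, it is not yet known for longer lists.\<close>

lemma sum_bumps_eq_sum_picks:
  assumes "\<And>b b'. length b = length xs \<Longrightarrow> mset b = mset b' \<Longrightarrow> F b = F b'"
  shows "(\<Sum>b\<leftarrow>bumps l xs. F b) = (\<Sum>(y, r)\<leftarrow>picks xs. F ((y + l) # r) :: 'a::comm_monoid_add)"
  using assms
proof (induction xs arbitrary: F)
  case (Cons x xs)
  have "(\<Sum>b\<leftarrow>bumps l xs. F (x # b)) = (\<Sum>(y, r)\<leftarrow>picks xs. F (x # (y + l) # r))"
    by (rule Cons.IH) (use Cons.prems in auto)
  also have "\<dots> = (\<Sum>(y, r)\<leftarrow>picks xs. F ((y + l) # x # r))"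
    by (intro arg_cong[of _ _ sum_list] map_cong) (auto intro!: Cons.prems dest: length_picks)
  finally show ?case by (simp add: o_def case_prod_unfold)
qed simp

lemma mset_picks_eq:
  "image_mset (\<lambda>(y, r). (y, mset r)) (mset (picks xs)) =
     image_mset (\<lambda>y. (y, mset xs - {#y#})) (mset xs)"
proof (induction xs)
  case (Cons x xs)
  have "image_mset (\<lambda>(y, r). (y, mset r)) (mset (map (\<lambda>(y, ys). (y, x # ys)) (picks xs))) =
      image_mset (\<lambda>(y, M). (y, add_mset x M)) (image_mset (\<lambda>(y, r). (y, mset r)) (mset (picks xs)))"
    by (simp add: multiset.map_comp o_def case_prod_unfold)
  also have "\<dots> = image_mset (\<lambda>y. (y, add_mset x (mset xs) - {#y#})) (mset xs)"
    unfolding Cons.IH by (auto simp: multiset.map_comp o_def intro!: image_mset_cong)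
  finally show ?case by simp
qed simp

lemma sum_bumps_mset:
  assumes F: "\<And>b b'. length b = length xs \<Longrightarrow> mset b = mset b' \<Longrightarrow> F b = F b'"
    and eq: "mset xs = mset ys"
  shows "(\<Sum>b\<leftarrow>bumps l xs. F b) = (\<Sum>b\<leftarrow>bumps l ys. F b :: 'a::comm_monoid_add)"
proof -
  have len: "length xs = length ys" using eq by (metis size_mset)
  \<comment> \<open>\<open>G\<close> is \<open>F\<close> after an arbitrary choice of order for the
    remaining entries. The sum then runs over the multiset of pairs (entry, rest), which depends
    only on \<open>mset xs\<close>.\<close>
  define G where "G = (\<lambda>(y, M). F ((y + l) # (SOME r. mset r = M)))"
  have G: "F ((y + l) # r) = G (y, mset r)" if "length xs = Suc (length r)" for y r
    unfolding G_def prod.case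
    by (rule F) (use that someI[of "\<lambda>r'. mset r' = mset r" r] in auto)
  have *: "(\<Sum>b\<leftarrow>bumps l zs. F b) = (\<Sum>p\<in>#image_mset (\<lambda>y. (y, mset zs - {#y#})) (mset zs). G p)"
    if len: "length zs = length xs" for zs
  proof -
    have "(\<Sum>b\<leftarrow>bumps l zs. F b) = (\<Sum>(y, r)\<leftarrow>picks zs. F ((y + l) # r))"
      by (rule sum_bumps_eq_sum_picks) (use F that in auto)
    also have "\<dots> = (\<Sum>(y, r)\<leftarrow>picks zs. G (y, mset r))"
      by (intro arg_cong[of _ _ sum_list] map_cong) (auto intro!: G dest: length_picks simp: len[symmetric])
    also have "\<dots> = (\<Sum>p\<in>#image_mset (\<lambda>(y, r). (y, mset r)) (mset (picks zs)). G p)"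
      by (simp add: multiset.map_comp o_def case_prod_unfold flip: sum_mset_sum_list)
    finally show ?thesis by (simp only: mset_picks_eq)
  qed
  from *[of xs] *[of ys] len eq show ?thesis by simp
qed

lemma sum_picks_replicate:
  "(\<Sum>(y, r)\<leftarrow>picks (replicate n x). F y r) = of_nat n * (F x (replicate (n - 1) x) :: 'a::ring_1)"
proof (induction n arbitrary: F)
  case (Suc n)
  show ?case using Suc.IH[of "\<lambda>y r. F y (x # r)"]
    by (cases n) (simp_all add: o_def case_prod_unfold algebra_simps)
qed simp

lemma sum_bumps_replicate:
  assumes "\<And>b b'. length b = n \<Longrightarrow> mset b = mset b' \<Longrightarrow> F b = F b'"
  shows "(\<Sum>b\<leftarrow>bumps l (replicate n x). F b) =
     of_nat n * (F ((x + l) # replicate (n - 1) x) :: 'a::ring_1)"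
  using assms by (subst sum_bumps_eq_sum_picks)
    (simp_all add: sum_picks_replicate[where F = "\<lambda>y r. F ((y + l) # r)"])

text \<open>
  In the \<open>m\<close>-fold tensor power, \<open>orb ks ls\<close> sends the highest weight vector to the sum, over all
  ways to place the letters \<open>v\<^sub>- \<otimes> t\<^sup>k\<close> (\<open>k\<close> in \<open>ks\<close>) and \<open>v\<^sub>+ \<otimes> t\<^sup>l\<close> (\<open>l\<close> in \<open>ls\<close>) at distinct
  positions, of the word with \<open>v\<^sub>+ \<otimes> 1\<close> at the remaining positions. The recursion subtracts from
  the product with \<open>h\<^sub>l\<close> the terms in which the new letter falls on an occupied position.
\<close>

fun orb :: "int list \<Rightarrow> int list \<Rightarrow> uea" where
  "orb ks [] = prod_list (map xminus ks)"
| "orb ks (l # ls) =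
     orb ks ls * hloop l - (\<Sum>b\<leftarrow>bumps l ls. orb ks b) - (\<Sum>b\<leftarrow>bumps l ks. orb b ls)"

lemma prod_list_xminus_mset:
  "mset ks = mset ks' \<Longrightarrow> prod_list (map xminus ks) = prod_list (map xminus ks')"
proof (induction ks arbitrary: ks')
  case (Cons k ks)
  obtain as bs where ks': "ks' = as @ k # bs"
    using Cons.prems by (metis list.set_intros(1) set_mset_mset split_list)
  have comm: "prod_list (map xminus as) * xminus k = xminus k * prod_list (map xminus as)" for as
    by (induction as) (auto simp: mult.assoc, metis mult.assoc xminus_commute)
  have "prod_list (map xminus ks) = prod_list (map xminus (as @ bs))"
    by (rule Cons.IH) (use Cons.prems ks' in simp)
  hence "prod_list (map xminus (k # ks)) =
      xminus k * prod_list (map xminus as) * prod_list (map xminus bs)"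
    by (simp add: mult.assoc)
  thus ?case unfolding comm[symmetric] ks' by (simp add: mult.assoc)
qed simp

lemma orb_mset_left: "mset ks = mset ks' \<Longrightarrow> orb ks ls = orb ks' ls"
proof (induction ls arbitrary: ks ks' rule: length_induct)
  case (1 ls)
  have IH: "orb b u = orb b' u" if "length u < length ls" "mset b = mset b'" for u b b'
    using 1(1) that by blast
  show ?case
  proof (cases ls)
    case Nil
    thus ?thesis using prod_list_xminus_mset[OF 1(2)] by simp
  next
    case (Cons l t)
    have "(\<Sum>b\<leftarrow>bumps l t. orb ks b) = (\<Sum>b\<leftarrow>bumps l t. orb ks' b)"
      by (intro arg_cong[of _ _ sum_list] map_cong refl IH 1(2)) (simp add: length_bumps Cons)
    moreover have "(\<Sum>b\<leftarrow>bumps l ks. orb b t) = (\<Sum>b\<leftarrow>bumps l ks'. orb b t)"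
      by (rule sum_bumps_mset[OF _ 1(2)], rule IH) (simp_all add: Cons)
    moreover have "orb ks t = orb ks' t" by (rule IH[OF _ 1(2)]) (simp add: Cons)
    ultimately show ?thesis by (simp add: Cons)
  qed
qed

lemma sum_list_mult_right: "(\<Sum>x\<leftarrow>xs. f x) * c = (\<Sum>x\<leftarrow>xs. f x * (c :: 'a::semiring_0))"
  by (induction xs) (auto simp: algebra_simps)

lemma sum_list_mult_left: "c * (\<Sum>x\<leftarrow>xs. f x) = (\<Sum>x\<leftarrow>xs. (c :: 'a::semiring_0) * f x)"
  by (induction xs) (auto simp: algebra_simps)

lemma sum_list_swap:
  "(\<Sum>x\<leftarrow>xs. \<Sum>y\<leftarrow>ys. f x y) = (\<Sum>y\<leftarrow>ys. \<Sum>x\<leftarrow>xs. f x y :: 'a::comm_monoid_add)"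
  by (induction xs) (auto simp: sum_list_addf)

lemma orb_swap: "orb ks (a # b # ls) = orb ks (b # a # ls)"
proof -
  \<comment> \<open>The recursion unfolded twice. The term with \<open>a + b\<close> comes from the
    new letter falling on the letter \<open>b\<close>; the other terms are grouped so that
    exchanging a and b permutes them, up to the order of summations and of commuting factors
    h.\<close>
  have *: "orb ks (a # b # ls) =
      orb ks ls * (hloop b * hloop a)
      - ((\<Sum>c\<leftarrow>bumps b ls. orb ks c * hloop a) + (\<Sum>c\<leftarrow>bumps a ls. orb ks c * hloop b))
      - ((\<Sum>c\<leftarrow>bumps b ks. orb c ls * hloop a) + (\<Sum>c\<leftarrow>bumps a ks. orb c ls * hloop b))
      - orb ks ((a + b) # ls)
      + (\<Sum>c\<leftarrow>bumps a ls. \<Sum>d\<leftarrow>bumps b c. orb ks d)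
      + ((\<Sum>c\<leftarrow>bumps a ls. \<Sum>k\<leftarrow>bumps b ks. orb k c) + (\<Sum>k\<leftarrow>bumps a ks. \<Sum>c\<leftarrow>bumps b ls. orb k c))
      + (\<Sum>k\<leftarrow>bumps a ks. \<Sum>k'\<leftarrow>bumps b k. orb k' ls)" for a b
    unfolding orb.simps(2)[of ks a "b # ls"] orb.simps(2)[where l = b] bumps.simps list.map sum_list.Cons
      map_map o_def sum_list_subtractf sum_list_mult_right[symmetric]
    by (simp add: algebra_simps)
  have sw: "(\<Sum>k\<leftarrow>bumps a ks. \<Sum>c\<leftarrow>bumps b ls. orb k c) = (\<Sum>c\<leftarrow>bumps b ls. \<Sum>k\<leftarrow>bumps a ks. orb k c)"
    for a b by (rule sum_list_swap)
  show ?thesis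
    unfolding *[of a b] *[of b a] sum_bumps_commute[where k = b and l = a] sw
    by (simp only: add_ac mult.assoc hloop_commute[of a b])
qed

text \<open>Two lists with different heads a and b are compared through lists that begin with both
  of them, where \<open>orb_swap\<close> applies; for equal heads the recursion reduces to shorter
  lists.\<close>

lemma orb_mset_right: "mset ls = mset ls' \<Longrightarrow> orb ks ls = orb ks ls'"
proof (induction ls arbitrary: ks ls' rule: length_induct)
  case (1 ls)
  have IH: "orb b u = orb b u'" if "length u < length ls" "mset u = mset u'" for b u u'
    using 1(1) that by blast
  have head: "orb b (x # u) = orb b (x # u')"
    if len: "Suc (length u) = length ls" and eq: "mset u = mset u'" for b x u u'
  proof -
    have "(\<Sum>c\<leftarrow>bumps x u. orb b c) = (\<Sum>c\<leftarrow>bumps x u'. orb b c)"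
      by (rule sum_bumps_mset[OF _ eq], rule IH) (use len in simp_all)
    moreover have "(\<Sum>c\<leftarrow>bumps x b. orb c u) = (\<Sum>c\<leftarrow>bumps x b. orb c u')"
      by (intro arg_cong[of _ _ sum_list] map_cong refl IH eq) (use len in simp)
    moreover have "orb b u = orb b u'" by (rule IH[OF _ eq]) (use len in simp)
    ultimately show ?thesis by simp
  qed
  show ?case
  proof (cases ls)
    case Nil
    with 1(2) show ?thesis by simp
  next
    case (Cons a t)
    then obtain b t' where ls': "ls' = b # t'" using 1(2) by (cases ls') auto
    show ?thesis
    proof (cases "a = b")
      case True
      thus ?thesis using head 1(2) unfolding Cons ls' by simp
    next
      case False
      have eq: "add_mset a (mset t) = add_mset b (mset t')" using 1(2) Cons ls' by simp
      with False obtain M where "mset t = add_mset b M" "mset t' = add_mset a M"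
        by (metis add_eq_conv_ex)
      then obtain s where s: "mset t = mset (b # s)" "mset t' = mset (a # s)"
        by (metis ex_mset mset.simps(2))
      have lent: "length t = Suc (length s)" "length t' = Suc (length s)"
        using s by (metis length_Cons size_mset)+
      have "orb ks (a # t) = orb ks (a # b # s)" by (rule head) (use s lent Cons in simp_all)
      also have "\<dots> = orb ks (b # a # s)" by (rule orb_swap)
      also have "\<dots> = orb ks (b # t')" by (rule head) (use s lent Cons in simp_all)
      finally show ?thesis unfolding Cons ls' .
    qed
  qed
qed

lemma orb_cong_mset: "mset ks = mset ks' \<Longrightarrow> mset ls = mset ls' \<Longrightarrow> orb ks ls = orb ks' ls'"
  using orb_mset_left orb_mset_right by metis

section \<open>Commutation of the lifts with h, x^- and d\<close>

lemma hloop_prod_xminus: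
  "hloop c * prod_list (map xminus ks) =
     prod_list (map xminus ks) * hloop c - 2 * (\<Sum>b\<leftarrow>bumps c ks. prod_list (map xminus b))"
proof (induction ks)
  case (Cons k ks)
  have "hloop c * prod_list (map xminus (k # ks)) =
      xminus k * (hloop c * prod_list (map xminus ks))
      - 2 * xminus (k + c) * prod_list (map xminus ks)"
    by (simp add: hloop_xminus mult.assoc[symmetric] left_diff_distrib add.commute)
  thus ?case unfolding Cons.IH
    by (simp add: o_def algebra_simps sum_list_mult_left mult_2)
qed simp

text \<open>The factors h_l commute with h_c, so only the factors x^-_k contribute, each through
  [h_c, x^-_k] = -2 x^-_(k+c).\<close>

lemma hloop_orb:
  "hloop c * orb ks ls = orb ks ls * hloop c - 2 * (\<Sum>b\<leftarrow>bumps c ks. orb b ls)"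
proof (induction ks ls rule: orb.induct)
  case (1 ks)
  show ?case by (simp add: hloop_prod_xminus)
next
  case (2 ks l ls)
  have A: "hloop c * (\<Sum>b\<leftarrow>bumps l ls. orb ks b) = (\<Sum>b\<leftarrow>bumps l ls. orb ks b) * hloop c
      - 2 * (\<Sum>b\<leftarrow>bumps l ls. \<Sum>b'\<leftarrow>bumps c ks. orb b' b)"
    unfolding sum_list_mult_left sum_list_mult_right sum_list_subtractf[symmetric]
    by (intro arg_cong[of _ _ sum_list] map_cong) (auto simp: 2 sum_list_mult_left)
  have B: "hloop c * (\<Sum>b\<leftarrow>bumps l ks. orb b ls) = (\<Sum>b\<leftarrow>bumps l ks. orb b ls) * hloop c
      - 2 * (\<Sum>b\<leftarrow>bumps l ks. \<Sum>b'\<leftarrow>bumps c b. orb b' ls)"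
    unfolding sum_list_mult_left sum_list_mult_right sum_list_subtractf[symmetric]
    by (intro arg_cong[of _ _ sum_list] map_cong) (auto simp: 2 sum_list_mult_left)
  have C: "hloop c * (orb ks ls * hloop l) =
      orb ks ls * hloop l * hloop c - 2 * (\<Sum>b\<leftarrow>bumps c ks. orb b ls * hloop l)"
    unfolding mult.assoc[symmetric] 2
    by (simp add: left_diff_distrib mult.assoc hloop_commute sum_list_mult_right)
  have "(\<Sum>b\<leftarrow>bumps c ks. orb b (l # ls)) = (\<Sum>b\<leftarrow>bumps c ks. orb b ls * hloop l)
      - (\<Sum>b\<leftarrow>bumps l ls. \<Sum>b'\<leftarrow>bumps c ks. orb b' b) - (\<Sum>b\<leftarrow>bumps l ks. \<Sum>b'\<leftarrow>bumps c b. orb b' ls)"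
    by (subst sum_list_swap, subst sum_bumps_commute) (simp add: sum_list_subtractf)
  thus ?case
    by (simp add: right_diff_distrib left_diff_distrib A B C)
qed

text \<open>The new letter v_- (x) t^k goes to a free position or to one holding v_+ (x) t^y, whose
  exponent is added; letters v_- are killed by x^-.\<close>

lemma xminus_orb:
  "xminus k * orb ks ls = orb (k # ks) ls + (\<Sum>(y, r)\<leftarrow>picks ls. orb ((k + y) # ks) r)"
proof (induction ks ls rule: orb.induct)
  case (2 ks l ls)
  have A: "xminus k * (\<Sum>b\<leftarrow>bumps l ls. orb ks b) = (\<Sum>b\<leftarrow>bumps l ls. orb (k # ks) b)
      + (\<Sum>(y, r)\<leftarrow>picks ls. orb ((k + l + y) # ks) r)
      + (\<Sum>(y, r)\<leftarrow>picks ls. \<Sum>b\<leftarrow>bumps l r. orb ((k + y) # ks) b)"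
  proof -
    have "xminus k * (\<Sum>b\<leftarrow>bumps l ls. orb ks b) =
       (\<Sum>b\<leftarrow>bumps l ls. orb (k # ks) b + (\<Sum>(y, r)\<leftarrow>picks b. orb ((k + y) # ks) r))"
      unfolding sum_list_mult_left
      by (intro arg_cong[of _ _ sum_list] map_cong) (auto simp: 2)
    thus ?thesis
      using sum_bumps_picks_commute[where F = "\<lambda>y r. orb ((k + y) # ks) r" and l = l and xs = ls]
      by (simp add: sum_list_addf case_prod_unfold add_ac)
  qed
  have B: "xminus k * (\<Sum>b\<leftarrow>bumps l ks. orb b ls) = (\<Sum>b\<leftarrow>bumps l ks. orb (k # b) ls)
      + (\<Sum>(y, r)\<leftarrow>picks ls. \<Sum>b\<leftarrow>bumps l ks. orb ((k + y) # b) r)"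
  proof -
    have "xminus k * (\<Sum>b\<leftarrow>bumps l ks. orb b ls) =
       (\<Sum>b\<leftarrow>bumps l ks. orb (k # b) ls + (\<Sum>(y, r)\<leftarrow>picks ls. orb ((k + y) # b) r))"
      unfolding sum_list_mult_left
      by (intro arg_cong[of _ _ sum_list] map_cong) (auto simp: 2)
    thus ?thesis
      by (simp add: sum_list_addf case_prod_unfold)
         (subst sum_list_swap, simp)
  qed
  have C: "xminus k * (orb ks ls * hloop l) =
      orb (k # ks) ls * hloop l + (\<Sum>(y, r)\<leftarrow>picks ls. orb ((k + y) # ks) r * hloop l)"
    unfolding mult.assoc[symmetric] 2
    by (simp add: distrib_right sum_list_mult_right case_prod_unfold)
  show ?case
    by (simp add: right_diff_distrib A B C)
      (simp add: o_def case_prod_unfold sum_list_subtractf sum_list_addf algebra_simps)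
qed simp

text \<open>The recursion with h_l on the left, as needed for a left action. The sum over
  \<open>ks\<close> changes its sign, reflecting that h has eigenvalue -1 on v_-.\<close>

lemma orb_Cons_left:
  "orb ks (l # ls) = hloop l * orb ks ls + (\<Sum>b\<leftarrow>bumps l ks. orb b ls) - (\<Sum>b\<leftarrow>bumps l ls. orb ks b)"
  by (simp add: hloop_orb mult_2)

lemma sum_list_bumps: "b \<in> set (bumps l xs) \<Longrightarrow> sum_list b = sum_list xs + l"
  by (induction xs arbitrary: b) auto

text \<open>Eigenvectors of ad d. This lets d pass to the right end of an \<open>orb\<close>, where
  it lies in the left ideal.\<close>

definition has_degree :: "int \<Rightarrow> uea \<Rightarrow> bool" where
  "has_degree s u \<longleftrightarrow> deg * u = u * deg + uea_scale (of_int s) u"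

lemma has_degree_gen: "has_degree k (uea_gen (Loop x k))"
  by (simp add: has_degree_def deg_loop)

lemma has_degree_mult: "has_degree s u \<Longrightarrow> has_degree t v \<Longrightarrow> has_degree (s + t) (u * v)"
  unfolding has_degree_def mult.assoc[symmetric]
  by (simp add: distrib_right distrib_left mult.assoc uea_scale_mult_left uea_scale_mult_right
      uea_scale_add_left)

lemma has_degree_diff: "has_degree s u \<Longrightarrow> has_degree s v \<Longrightarrow> has_degree s (u - v)"
  unfolding has_degree_def by (simp add: right_diff_distrib left_diff_distrib uea_scale_diff)

lemma has_degree_sum_list:
  "(\<And>x. x \<in> set xs \<Longrightarrow> has_degree s (f x)) \<Longrightarrow> has_degree s (\<Sum>x\<leftarrow>xs. f x)"
  by (induction xs) (auto simp: has_degree_def distrib_left distrib_right uea_scale_add)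

lemma has_degree_orb: "has_degree (sum_list ks + sum_list ls) (orb ks ls)"
proof (induction ks ls rule: orb.induct)
  case (1 ks)
  show ?case
    by (induction ks) (auto intro!: has_degree_mult has_degree_gen simp: add.assoc,
        simp add: has_degree_def)
next
  case (2 ks l ls)
  have "has_degree (sum_list ks + sum_list ls + l) (orb ks (l # ls))"
    unfolding orb.simps
  proof (intro has_degree_diff has_degree_mult has_degree_gen has_degree_sum_list)
    fix b assume "b \<in> set (bumps l ls)"
    with 2(2)[OF this] show "has_degree (sum_list ks + sum_list ls + l) (orb ks b)"
      by (simp add: sum_list_bumps add_ac)
  next
    fix b assume "b \<in> set (bumps l ks)"
    with 2(3)[OF this] show "has_degree (sum_list ks + sum_list ls + l) (orb b ls)"
      by (simp add: sum_list_bumps add_ac)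
  qed (use 2 in simp)
  thus ?case by (simp add: add_ac)
qed

section \<open>Newton's identities\<close>

text \<open>The coefficient ring \<open>uea\<close> is not commutative, but the h_k commute with
  each other, and this is all that the calculus of the series Lambda requires.\<close>

lemma fps_mult_commute_coeffs:
  assumes "\<And>i j. fps_nth f i * fps_nth g j = fps_nth g j * fps_nth f i"
  shows "f * g = (g * f :: 'a::ring_1 fps)"
proof (rule fps_ext)
  fix n
  have "fps_nth (g * f) n = (\<Sum>i=0..n. fps_nth g (n - i) * fps_nth f (n - (n - i)))"
    unfolding fps_mult_nth by (rule sum.reindex_bij_witness[of _ "\<lambda>i. n - i" "\<lambda>i. n - i"]) auto
  thus "fps_nth (f * g) n = fps_nth (g * f) n"
    unfolding fps_mult_nth by (simp add: assms)
qed

lemma fps_deriv_power_commute: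
  fixes f :: "'a::ring_1 fps"
  assumes "f * fps_deriv f = fps_deriv f * f"
  shows "fps_deriv (f ^ Suc n) = of_nat (Suc n) * (fps_deriv f * f ^ n)"
proof (induction n)
  case (Suc n)
  have "fps_deriv (f ^ Suc (Suc n)) = f * fps_deriv (f ^ Suc n) + fps_deriv f * f ^ Suc n"
    by (subst power_Suc, subst fps_deriv_mult) simp
  also have "f * fps_deriv (f ^ Suc n) = of_nat (Suc n) * ((f * fps_deriv f) * f ^ n)"
    unfolding Suc.IH by (simp only: mult.assoc mult_of_nat_commute[of _ f, symmetric])
      (metis mult.assoc mult_of_nat_commute)
  also have "\<dots> = of_nat (Suc n) * (fps_deriv f * f ^ Suc n)"
    unfolding assms by (simp add: mult.assoc)
  finally show ?case by (simp add: algebra_simps)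
qed simp

lemma fps_power_nth_less:
  fixes f :: "'a::ring_1 fps"
  assumes "fps_nth f 0 = 0"
  shows "j < k \<Longrightarrow> fps_nth (f ^ k) j = 0"
proof (induction k arbitrary: j)
  case (Suc k)
  have "fps_nth f i * fps_nth (f ^ k) (j - i) = 0" if "i \<le> j" for i
    using that Suc by (cases "i = 0") (auto simp: assms)
  thus ?case by (simp add: fps_mult_nth)
qed simp

text \<open>A first order differential equation replaces the explicit exponential: comparing its
  coefficients yields the recursion for Lambda.\<close>

lemma fps_deriv_exp_series:
  assumes "fps_nth F 0 = 0" "F * fps_deriv F = fps_deriv F * F"
  shows "fps_deriv (exp_series F) = fps_deriv F * exp_series F"
proof (rule fps_ext)
  fix n
  let ?D = "fps_deriv F"
  have *: "of_nat (Suc n) * fps_nth (F ^ Suc k) (Suc n) = of_nat (Suc k) * fps_nth (?D * F ^ k) n" for k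
  proof -
    have "of_nat (Suc n) * fps_nth (F ^ Suc k) (Suc n) = fps_nth (fps_deriv (F ^ Suc k)) n"
      by (simp del: power_Suc of_nat_Suc)
    thus ?thesis
      unfolding fps_deriv_power_commute[OF assms(2)]
      by (simp del: of_nat_Suc add: fps_of_nat[symmetric])
  qed
  have "fps_nth (fps_deriv (exp_series F)) n =
      (\<Sum>k\<le>Suc n. uea_scale (1 / fact k) (of_nat (Suc n) * fps_nth (F ^ k) (Suc n)))"
    by (simp add: exp_series_def sum_distrib_left uea_scale_mult_right del: of_nat_Suc sum.atMost_Suc)
  \<comment> \<open>The term k = 0 drops out, because \<open>F ^ 0 = 1\<close> has no coefficient at
    \<open>Suc n\<close>.\<close>
  also have "\<dots> = (\<Sum>k\<le>n. uea_scale (1 / fact (Suc k)) (of_nat (Suc k) * fps_nth (?D * F ^ k) n))"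
    by (subst sum.atMost_Suc_shift) (simp only: * , simp)
  also have "\<dots> = (\<Sum>k\<le>n. uea_scale (1 / fact k) (fps_nth (?D * F ^ k) n))"
    by (simp only: uea_scale_of_nat[symmetric] uea_scale_scale) (simp del: of_nat_Suc)
  also have "\<dots> = (\<Sum>k\<le>n. \<Sum>i=0..n. fps_nth ?D i * uea_scale (1 / fact k) (fps_nth (F ^ k) (n - i)))"
    by (simp only: fps_mult_nth uea_scale_sum uea_scale_mult_right)
  also have "\<dots> = (\<Sum>i=0..n. fps_nth ?D i * (\<Sum>k\<le>n. uea_scale (1 / fact k) (fps_nth (F ^ k) (n - i))))"
    by (subst sum.swap) (simp only: sum_distrib_left)
  \<comment> \<open>The definition of \<open>exp_series\<close> truncates at n - i instead of n; the
    powers in between have no coefficient at n - i, since \<open>F\<close> has no constant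
    term.\<close>
  also have "\<dots> = (\<Sum>i=0..n. fps_nth ?D i * fps_nth (exp_series F) (n - i))"
    unfolding exp_series_def fps_nth_Abs_fps
    by (intro sum.cong arg_cong2[of _ _ _ _ "(*)"] refl sum.mono_neutral_right)
      (auto simp: fps_power_nth_less[OF assms(1)])
  finally show "fps_nth (fps_deriv (exp_series F)) n = fps_nth (?D * exp_series F) n"
    by (simp only: fps_mult_nth)
qed

lemma Lambda_series_0 [simp]: "fps_nth (Lambda_series \<epsilon>) 0 = 1"
  by (simp add: Lambda_series_def exp_series_def)

text \<open>Newton's identities, with the h in the role of power sums and Lambda in that of signed
  elementary symmetric functions.\<close>

lemma Lambda_series_Suc:
  "of_nat (Suc n) * fps_nth (Lambda_series \<epsilon>) (Suc n) =
     - (\<Sum>i\<le>n. hloop (\<epsilon> * int (Suc i)) * fps_nth (Lambda_series \<epsilon>) (n - i))"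
proof -
  define F where "F = Abs_fps (\<lambda>k. if k = 0 then 0
      else uea_scale (- 1 / of_nat k) (hloop (\<epsilon> * int k)))"
  have F': "fps_nth (fps_deriv F) i = - hloop (\<epsilon> * int (Suc i))" for i
    by (simp add: F_def uea_scale_of_nat[symmetric] uea_scale_minus_left del: of_nat_Suc)
  have "F * fps_deriv F = fps_deriv F * F"
    by (rule fps_mult_commute_coeffs)
      (simp only: F', simp add: F_def uea_scale_mult_left uea_scale_mult_right hloop_commute)
  hence "fps_deriv (exp_series F) = fps_deriv F * exp_series F"
    by (rule fps_deriv_exp_series[rotated]) (simp add: F_def)
  hence "of_nat (Suc n) * fps_nth (exp_series F) (Suc n) = fps_nth (fps_deriv F * exp_series F) n"
    by (metis Suc_eq_plus1 fps_deriv_nth)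
  also have "\<dots> = - (\<Sum>i\<le>n. hloop (\<epsilon> * int (Suc i)) * fps_nth (exp_series F) (n - i))"
    unfolding fps_mult_nth F' by (simp add: sum_negf atLeast0AtMost)
  finally show ?thesis unfolding Lambda_series_def F_def .
qed

lemma Lambda_series_in_U_zero:
  assumes "\<epsilon> \<noteq> 0"
  shows "fps_nth (Lambda_series \<epsilon>) n \<in> U_zero"
proof (induction n rule: less_induct)
  case (less n)
  show ?case
  proof (cases n)
    case 0
    thus ?thesis by (simp add: U_zero_closed)
  next
    case (Suc k)
    have "uea_scale (1 / of_nat (Suc k)) (of_nat (Suc k) * fps_nth (Lambda_series \<epsilon>) (Suc k)) \<in> U_zero"
      unfolding Lambda_series_Suc
      by (intro U_zero_closed subalgebra_sum[OF U_zero_subalgebra] hloop_in_U_zero less.IH)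
        (use assms Suc in auto)
    thus ?thesis unfolding Suc uea_scale_of_nat[symmetric]
      by (simp del: of_nat_Suc)
  qed
qed

lemma Lambda_eq_series:
  "Lambda (int n) = fps_nth (Lambda_series 1) n" "Lambda (- int n) = fps_nth (Lambda_series (-1)) n"
  unfolding Lambda_def by (simp, cases "n = 0") auto

lemma Lambda_0 [simp]: "Lambda 0 = 1"
  by (simp add: Lambda_def)

lemma Lambda_in_U_zero: "Lambda k \<in> U_zero"
  by (simp add: Lambda_def Lambda_series_in_U_zero)

text \<open>On the highest weight vector 1 / n! cancels the orderings of the n equal letters. For
  \<open>ks = []\<close> this is the coefficient of \<open>Lambda_series\<close>, sign
  included.\<close>

definition orb_unit :: "int \<Rightarrow> int list \<Rightarrow> nat \<Rightarrow> uea" where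
  "orb_unit \<epsilon> ks n = uea_scale ((-1) ^ n / fact n) (orb ks (replicate n \<epsilon>))"

lemma orb_unit_0 [simp]: "orb_unit \<epsilon> ks 0 = prod_list (map xminus ks)"
  by (simp add: orb_unit_def)

text \<open>Iterated recursion: besides the product with h_l there is a correction in which the
  letter l absorbs one of the n equal letters, so that l grows by \<epsilon> and n drops by 1. The
  normalization turns the alternating signs into a plain sum.\<close>

lemma orb_Nil_Cons_replicate:
  "uea_scale ((-1) ^ n / fact n) (orb [] (l # replicate n \<epsilon>)) =
     (\<Sum>i\<le>n. orb_unit \<epsilon> [] (n - i) * hloop (l + \<epsilon> * int i))"
proof (induction n arbitrary: l)
  case (Suc n)
  have "(\<Sum>b\<leftarrow>bumps l (replicate (Suc n) \<epsilon>). orb [] b) =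
      of_nat (Suc n) * orb [] ((\<epsilon> + l) # replicate n \<epsilon>)"
    by (subst sum_bumps_replicate) (auto intro: orb_mset_right simp del: replicate_Suc of_nat_Suc)
  hence "orb [] (l # replicate (Suc n) \<epsilon>) = orb [] (replicate (Suc n) \<epsilon>) * hloop l
      - uea_scale (of_nat (Suc n)) (orb [] ((\<epsilon> + l) # replicate n \<epsilon>))"
    by (simp add: uea_scale_of_nat del: replicate_Suc of_nat_Suc)
  hence "uea_scale ((-1) ^ Suc n / fact (Suc n)) (orb [] (l # replicate (Suc n) \<epsilon>)) =
      orb_unit \<epsilon> [] (Suc n) * hloop l
      - uea_scale ((-1) ^ Suc n / fact (Suc n) * of_nat (Suc n)) (orb [] ((\<epsilon> + l) # replicate n \<epsilon>))"
    by (simp only: uea_scale_diff uea_scale_scale orb_unit_def uea_scale_mult_left)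
  also have "(-1) ^ Suc n / fact (Suc n) * of_nat (Suc n) = - ((-1) ^ n / fact n :: complex)"
    by (simp add: field_simps del: of_nat_Suc)
  also have "orb_unit \<epsilon> [] (Suc n) * hloop l
      - uea_scale (- ((-1) ^ n / fact n)) (orb [] ((\<epsilon> + l) # replicate n \<epsilon>)) =
      orb_unit \<epsilon> [] (Suc n) * hloop l + (\<Sum>i\<le>n. orb_unit \<epsilon> [] (n - i) * hloop (\<epsilon> + l + \<epsilon> * int i))"
    unfolding uea_scale_minus_left Suc.IH by simp
  also have "\<dots> = (\<Sum>i\<le>Suc n. orb_unit \<epsilon> [] (Suc n - i) * hloop (l + \<epsilon> * int i))"
    by (subst sum.atMost_Suc_shift) (simp add: algebra_simps)
  finally show ?case .
qed (simp)

text \<open>For l = \<epsilon> the previous expansion becomes the recursion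
  \<open>Lambda_series_Suc\<close>.\<close>

lemma orb_unit_Nil:
  assumes "\<epsilon> \<noteq> 0"
  shows "orb_unit \<epsilon> [] n = fps_nth (Lambda_series \<epsilon>) n"
proof (induction n rule: less_induct)
  case (less n)
  show ?case
  proof (cases n)
    case (Suc k)
    have c: "(-1) ^ Suc k / fact (Suc k) = - (1 / of_nat (Suc k)) * ((-1) ^ k / fact k :: complex)"
      by (simp add: field_simps del: of_nat_Suc)
    have "orb_unit \<epsilon> [] (Suc k) = uea_scale (- (1 / of_nat (Suc k)))
        (uea_scale ((-1) ^ k / fact k) (orb [] (\<epsilon> # replicate k \<epsilon>)))"
      unfolding orb_unit_def c replicate_Suc by (simp only: uea_scale_scale)
    also have "\<dots> = uea_scale (- (1 / of_nat (Suc k)))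
        (\<Sum>i\<le>k. orb_unit \<epsilon> [] (k - i) * hloop (\<epsilon> + \<epsilon> * int i))"
      by (simp only: orb_Nil_Cons_replicate)
    also have "(\<Sum>i\<le>k. orb_unit \<epsilon> [] (k - i) * hloop (\<epsilon> + \<epsilon> * int i)) =
        (\<Sum>i\<le>k. hloop (\<epsilon> * int (Suc i)) * fps_nth (Lambda_series \<epsilon>) (k - i))"
      by (intro sum.cong refl)
        (use assms Suc in \<open>simp add: less.IH U_zero_hloop_commute Lambda_series_in_U_zero algebra_simps\<close>)
    also have "uea_scale (- (1 / of_nat (Suc k))) \<dots> =
        uea_scale (1 / of_nat (Suc k)) (of_nat (Suc k) * fps_nth (Lambda_series \<epsilon>) (Suc k))"
      by (simp only: Lambda_series_Suc uea_scale_minus uea_scale_minus_left)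
    finally show ?thesis unfolding Suc uea_scale_of_nat[symmetric] by (simp del: of_nat_Suc)
  qed simp
qed

text \<open>By \<open>xminus_orb\<close> the new letter v_- may absorb one of the n letters v_+ (x)
  t, which raises k and lowers n by 1; this is iterated.\<close>

lemma orb_unit_Cons:
  "orb_unit 1 (k # ks) n = (\<Sum>j\<le>n. xminus (k + int j) * orb_unit 1 ks (n - j))"
proof (induction n arbitrary: k)
  case (Suc n)
  have "xminus k * orb ks (replicate (Suc n) 1) = orb (k # ks) (replicate (Suc n) 1)
      + uea_scale (of_nat (Suc n)) (orb ((k + 1) # ks) (replicate n 1))"
    by (simp only: xminus_orb uea_scale_of_nat sum_picks_replicate[where F = "\<lambda>y r. orb ((k + y) # ks) r"]) simp
  hence "xminus k * orb_unit 1 ks (Suc n) = orb_unit 1 (k # ks) (Suc n)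
      + uea_scale ((-1) ^ Suc n / fact (Suc n) * of_nat (Suc n)) (orb ((k + 1) # ks) (replicate n 1))"
    by (simp only: orb_unit_def uea_scale_mult_right uea_scale_add uea_scale_scale)
  also have "(-1) ^ Suc n / fact (Suc n) * of_nat (Suc n) = - ((-1) ^ n / fact n :: complex)"
    by (simp add: field_simps del: of_nat_Suc)
  finally have "orb_unit 1 (k # ks) (Suc n) =
      xminus k * orb_unit 1 ks (Suc n) + orb_unit 1 ((k + 1) # ks) n"
    by (simp add: uea_scale_minus_left orb_unit_def)
  thus ?case unfolding Suc.IH
    by (subst sum.atMost_Suc_shift) (simp add: algebra_simps)
qed simp

lemma X0_minus_series_nth:
  "fps_nth X0_minus_series i = (if i = 0 then 0 else xminus (int i - 1))"
  by (simp add: X0_minus_series_def)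

lemma X0_minus_Lambda_nth_less:
  "s < r \<Longrightarrow> fps_nth (X0_minus_series ^ r * Lambda_series 1) s = 0"
proof (induction r arbitrary: s)
  case (Suc r)
  have "fps_nth X0_minus_series i * fps_nth (X0_minus_series ^ r * Lambda_series 1) (s - i) = 0"
    if "i \<le> s" for i
    using Suc.prems that by (cases "i = 0") (auto simp: X0_minus_series_nth Suc.IH)
  thus ?case by (simp add: mult.assoc fps_mult_nth[of X0_minus_series])
qed simp

text \<open>For k = 0 the sum in \<open>orb_unit_Cons\<close> is the convolution with X_0^-(u). The
  offset r arises because x^-_k stands at u^(k+1).\<close>

lemma X0_minus_Lambda_nth:
  "fps_nth (X0_minus_series ^ r * Lambda_series 1) (n + r) = orb_unit 1 (replicate r 0) n"
proof (induction r arbitrary: n)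
  case (Suc r)
  let ?G = "X0_minus_series ^ r * Lambda_series 1"
  have "fps_nth (X0_minus_series ^ Suc r * Lambda_series 1) (n + Suc r) =
      (\<Sum>i\<le>Suc (n + r). fps_nth X0_minus_series i * fps_nth ?G (Suc (n + r) - i))"
    by (simp only: power_Suc mult.assoc fps_mult_nth[of X0_minus_series] atLeast0AtMost add_Suc_right)
  also have "\<dots> = (\<Sum>i\<le>n + r. xminus (int i) * fps_nth ?G (n + r - i))"
    by (subst sum.atMost_Suc_shift) (simp add: X0_minus_series_nth)
  also have "\<dots> = (\<Sum>i\<le>n. xminus (int i) * fps_nth ?G (n + r - i))"
  proof (intro sum.mono_neutral_right ballI)
    fix i assume "i \<in> {..n + r} - {..n}"
    hence "n + r - i < r" by auto
    thus "xminus (int i) * fps_nth ?G (n + r - i) = 0" by (simp add: X0_minus_Lambda_nth_less)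
  qed auto
  also have "\<dots> = (\<Sum>i\<le>n. xminus (0 + int i) * orb_unit 1 (replicate r 0) (n - i))"
    by (intro sum.cong refl) (simp add: Suc.IH[symmetric])
  finally show ?case by (simp only: orb_unit_Cons replicate_Suc)
qed (simp add: orb_unit_Nil)

section \<open>Relations in the Weyl module\<close>

text \<open>
  The left ideal defining the Weyl module is not stable under right multiplication by
  \<open>U(0)\<close>, because it contains \<open>d\<close>; the following part of it is.
\<close>

definition weyl_core :: "nat \<Rightarrow> uea set" where
  "weyl_core m = {u. \<forall>f\<in>U_zero. u * f \<in> weyl_ideal m}"

lemma weyl_core_subset: "u \<in> weyl_core m \<Longrightarrow> u \<in> weyl_ideal m"
  unfolding weyl_core_def using U_zero_closed(1) by force

lemma weyl_core_zero [simp]: "0 \<in> weyl_core m"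
  by (simp add: weyl_core_def weyl_ideal_zero)

lemma weyl_core_add: "u \<in> weyl_core m \<Longrightarrow> v \<in> weyl_core m \<Longrightarrow> u + v \<in> weyl_core m"
  by (simp add: weyl_core_def weyl_ideal_add distrib_right)

lemma weyl_core_mult_left: "u \<in> weyl_core m \<Longrightarrow> a * u \<in> weyl_core m"
  by (simp add: weyl_core_def weyl_ideal_mult_left mult.assoc)

lemma weyl_core_scale: "u \<in> weyl_core m \<Longrightarrow> uea_scale c u \<in> weyl_core m"
  using weyl_core_mult_left[of u m "uea_scale c 1"] by (simp add: uea_scale_mult_left)

lemma weyl_core_minus: "u \<in> weyl_core m \<Longrightarrow> - u \<in> weyl_core m"
  using weyl_core_mult_left[of u m "- 1"] by simp

lemma weyl_core_diff: "u \<in> weyl_core m \<Longrightarrow> v \<in> weyl_core m \<Longrightarrow> u - v \<in> weyl_core m"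
  using weyl_core_add[of u m "- v"] by (simp add: weyl_core_minus)

lemma weyl_core_sum: "(\<And>x. x \<in> A \<Longrightarrow> f x \<in> weyl_core m) \<Longrightarrow> sum f A \<in> weyl_core m"
  by (induction A rule: infinite_finite_induct) (auto simp: weyl_core_add)

lemma weyl_core_sum_list:
  "(\<And>x. x \<in> set xs \<Longrightarrow> f x \<in> weyl_core m) \<Longrightarrow> (\<Sum>x\<leftarrow>xs. f x) \<in> weyl_core m"
  by (induction xs) (auto simp: weyl_core_add)

lemma weyl_core_add_cancel: "u + v \<in> weyl_core m \<Longrightarrow> v \<in> weyl_core m \<Longrightarrow> u \<in> weyl_core m"
  using weyl_core_diff[of "u + v" m v] by simp

lemma weyl_core_scale_iff: "c \<noteq> 0 \<Longrightarrow> uea_scale c u \<in> weyl_core m \<longleftrightarrow> u \<in> weyl_core m"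
  using weyl_core_scale[of u m c] weyl_core_scale[of "uea_scale c u" m "1 / c"] by auto

lemma weyl_core_of_nat_iff: "n > 0 \<Longrightarrow> of_nat n * u \<in> weyl_core m \<longleftrightarrow> u \<in> weyl_core m"
  using weyl_core_scale_iff[of "of_nat n" u m] by (simp add: uea_scale_of_nat)

lemma weyl_core_mult_right: "u \<in> weyl_core m \<Longrightarrow> f \<in> U_zero \<Longrightarrow> u * f \<in> weyl_core m"
  by (simp add: weyl_core_def mult.assoc U_zero_closed)

lemma weyl_relations_in_ideal: "u \<in> weyl_relations m \<Longrightarrow> u \<in> weyl_ideal m"
  unfolding weyl_ideal_def by (rule hull_inc)

text \<open>Here u f = f u, and the latter lies in the left ideal.\<close>

lemma weyl_core_U_zero_commute:
  assumes "u \<in> weyl_ideal m" "\<And>f. f \<in> U_zero \<Longrightarrow> f * u = u * f"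
  shows "u \<in> weyl_core m"
  using assms by (auto simp: weyl_core_def weyl_ideal_mult_left simp flip: assms(2))

lemma weyl_core_hloop_0: "hloop 0 - of_nat m \<in> weyl_core m"
  by (rule weyl_core_U_zero_commute)
    (auto intro!: weyl_relations_in_ideal simp: weyl_relations_def algebra_simps
      U_zero_hloop_commute mult_of_nat_commute)

text \<open>The generators of \<open>U_zero\<close> do not include h_0, for which the relation h_0 =
  m is used instead.\<close>

lemma weyl_core_hloop_right:
  assumes "u \<in> weyl_core m" shows "u * hloop k \<in> weyl_core m"
proof (cases "k = 0")
  case True
  have "u * (hloop 0 - of_nat m) + of_nat m * u \<in> weyl_core m"
    by (intro weyl_core_add weyl_core_mult_left assms weyl_core_hloop_0)
  thus ?thesis using True by (simp add: right_diff_distrib mult_of_nat_commute)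
next
  case False
  thus ?thesis using assms by (intro weyl_core_mult_right hloop_in_U_zero)
qed

text \<open>Since [x^+_i, h_k] = -2 x^+_(i+k), the left ideal \<open>J\<close> generated by all x^+
  together is stable under right multiplication by the h_k, hence by U(0).\<close>

lemma weyl_core_xplus: "xplus k \<in> weyl_core m"
proof -
  define J where "J = left_ideal hull (range xplus)"
  have J: "left_ideal J" unfolding J_def by (rule left_ideal_hull)
  have "U_zero \<subseteq> {f. \<forall>v\<in>J. v * f \<in> J}"
  proof (rule U_zero_minimal)
    show "subalgebra {f. \<forall>v\<in>J. v * f \<in> J}"
      using J by (auto simp: subalgebra_def left_ideal_def distrib_left uea_scale_mult_right
          simp flip: mult.assoc) (metis uea_scale_mult_left mult_1)
    fix k
    have "J \<subseteq> {v. v * hloop k \<in> J}"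
      unfolding J_def
    proof (rule hull_minimal)
      have "xplus i * hloop k \<in> J" for i
      proof -
        have "xplus i \<in> J" for i unfolding J_def by (rule hull_inc) simp
        hence "hloop k * xplus i + (- 2) * xplus (i + k) \<in> J"
          using J unfolding left_ideal_def by blast
        thus ?thesis by (simp add: xplus_hloop)
      qed
      thus "range xplus \<subseteq> {v. v * hloop k \<in> left_ideal hull range xplus}"
        unfolding J_def by auto
      show "left_ideal {v. v * hloop k \<in> left_ideal hull range xplus}"
        using J unfolding J_def by (auto simp: left_ideal_def distrib_right mult.assoc)
    qed
    thus "hloop k \<in> {f. \<forall>v\<in>J. v * f \<in> J}" by auto
  qed
  moreover have "J \<subseteq> weyl_ideal m"
    unfolding J_def by (rule hull_minimal)
      (auto intro!: weyl_relations_in_ideal simp: weyl_relations_def weyl_ideal_left_ideal)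
  moreover have "xplus k \<in> J" unfolding J_def by (rule hull_inc) simp
  ultimately show ?thesis by (auto simp: weyl_core_def)
qed

lemma weyl_core_Lambda: "\<bar>k\<bar> > int m \<Longrightarrow> Lambda k \<in> weyl_core m"
  by (rule weyl_core_U_zero_commute)
    (auto intro!: weyl_relations_in_ideal simp: weyl_relations_def U_zero_commute Lambda_in_U_zero)

lemma weyl_core_Lambda_mult:
  assumes "k \<le> m"
  shows "Lambda (int m) * Lambda (- int k) - Lambda (int m - int k) \<in> weyl_core m"
proof (cases "k = 0")
  case False
  hence "1 \<le> int k \<and> int k \<le> int m" using assms by simp
  hence "Lambda (int m) * Lambda (- int k) - Lambda (int m - int k) \<in> weyl_relations m"
    unfolding weyl_relations_def by blast
  moreover have "Lambda (int m) * Lambda (- int k) - Lambda (int m - int k) \<in> U_zero"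
    by (intro U_zero_closed Lambda_in_U_zero)
  ultimately show ?thesis
    by (metis U_zero_commute weyl_core_U_zero_commute weyl_relations_in_ideal)
qed simp

lemma weyl_core_xminus_Lambda:
  "(\<Sum>j\<le>m. xminus (s - int j) * Lambda (int j)) \<in> weyl_core m"
proof -
  have "(\<Sum>j\<le>m. xminus (s - int j) * Lambda (int j)) * f \<in> weyl_relations m" if "f \<in> U_zero" for f
  proof -
    have "(\<Sum>j\<le>m. xminus (s - int j) * Lambda (int j)) * f =
        (\<Sum>j\<le>m. xminus (s + 1 - 1 - int j) * Lambda (int j) * f)"
      by (simp add: sum_distrib_right)
    thus ?thesis using that unfolding weyl_relations_def by blast
  qed
  thus ?thesis by (auto simp: weyl_core_def intro: weyl_relations_in_ideal)
qed

lemma weyl_core_X0_minus: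
  assumes "r \<ge> 1" "s > m"
  shows "fps_nth (X0_minus_series ^ r * Lambda_series 1) s \<in> weyl_core m"
proof -
  have "fps_nth (X0_minus_series ^ r * Lambda_series 1) s * f \<in> weyl_relations m"
    if "f \<in> U_zero" for f
    using assms that unfolding weyl_relations_def by blast
  thus ?thesis by (auto simp: weyl_core_def intro: weyl_relations_in_ideal)
qed

lemma Lambda_newton:
  "of_nat n * Lambda (int n) = - (\<Sum>j<n. hloop (int n - int j) * Lambda (int j))"
  "of_nat n * Lambda (- int n) = - (\<Sum>j<n. hloop (int j - int n) * Lambda (- int j))"
proof -
  have *: "of_nat n * fps_nth (Lambda_series \<epsilon>) n =
      - (\<Sum>j<n. hloop (\<epsilon> * (int n - int j)) * fps_nth (Lambda_series \<epsilon>) j)" for \<epsilon>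
  proof (cases n)
    case (Suc k)
    have "(\<Sum>i\<le>k. hloop (\<epsilon> * int (Suc i)) * fps_nth (Lambda_series \<epsilon>) (k - i)) =
        (\<Sum>j<Suc k. hloop (\<epsilon> * (int (Suc k) - int j)) * fps_nth (Lambda_series \<epsilon>) j)"
      by (rule sum.reindex_bij_witness[of _ "\<lambda>j. k - j" "\<lambda>i. k - i"]) (auto simp:)
    thus ?thesis unfolding Suc Lambda_series_Suc by simp
  qed simp
  show "of_nat n * Lambda (int n) = - (\<Sum>j<n. hloop (int n - int j) * Lambda (int j))"
    using *[of 1] by (simp add: Lambda_eq_series)
  show "of_nat n * Lambda (- int n) = - (\<Sum>j<n. hloop (int j - int n) * Lambda (- int j))"
    using *[of "-1"] by (simp add: Lambda_eq_series)
qed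

text \<open>On tensors this says that power sums with arbitrary integer index satisfy the recurrence
  whose characteristic polynomial has the roots t_i. For s > m it is Newton's identity together with
  Lambda_n = 0 for n > m; for s < 0 it is the mirror image of this, carried over by Lambda_m
  Lambda_(-k) = Lambda_(m-k); for the values between, the two halves are glued by h_0 = m.\<close>

lemma weyl_core_hloop_Lambda:
  "(\<Sum>j\<le>m. hloop (s - int j) * Lambda (int j)) \<in> weyl_core m"
proof -
  have upper: "(\<Sum>j\<le>m. hloop (int n - int j) * Lambda (int j)) \<in> weyl_core m"
    "(\<Sum>j\<le>m. hloop (int j - int n) * Lambda (- int j)) \<in> weyl_core m" if "n > m" for n
  proof -
    have split: "{..<n} = {..m} \<union> {m<..<n}" "{..m} \<inter> {m<..<n} = {}"
      using that by auto
    have "of_nat n * Lambda (int n) \<in> weyl_core m" "of_nat n * Lambda (- int n) \<in> weyl_core m"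
      by (intro weyl_core_mult_left weyl_core_Lambda; use that in simp)+
    hence 1: "(\<Sum>j<n. hloop (int n - int j) * Lambda (int j)) \<in> weyl_core m"
      "(\<Sum>j<n. hloop (int j - int n) * Lambda (- int j)) \<in> weyl_core m"
      unfolding Lambda_newton by (auto dest: weyl_core_minus)
    have 2: "(\<Sum>j\<in>{m<..<n}. hloop (int n - int j) * Lambda (int j)) \<in> weyl_core m"
      "(\<Sum>j\<in>{m<..<n}. hloop (int j - int n) * Lambda (- int j)) \<in> weyl_core m"
      by (intro weyl_core_sum weyl_core_mult_left weyl_core_Lambda; simp)+
    show "(\<Sum>j\<le>m. hloop (int n - int j) * Lambda (int j)) \<in> weyl_core m"
      by (rule weyl_core_add_cancel[OF _ 2(1)], subst sum.union_disjoint[symmetric])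
        (use 1(1) split in simp_all)
    show "(\<Sum>j\<le>m. hloop (int j - int n) * Lambda (- int j)) \<in> weyl_core m"
      by (rule weyl_core_add_cancel[OF _ 2(2)], subst sum.union_disjoint[symmetric])
        (use 1(2) split in simp_all)
  qed
  \<comment> \<open>Modulo the core, Lambda_j with j = m - i is replaced by Lambda_m
    Lambda_(-i).\<close>
  have flip: "(\<Sum>j\<in>{n..m}. hloop (s - int j) * Lambda (int j))
      - Lambda (int m) * (\<Sum>i\<le>m - n. hloop (s - int m + int i) * Lambda (- int i)) \<in> weyl_core m"
    if "n \<le> m" for n s
  proof -
    have "Lambda (int m) * (\<Sum>i\<le>m - n. hloop (s - int m + int i) * Lambda (- int i)) =
       (\<Sum>i\<le>m - n. hloop (s - int m + int i) * (Lambda (int m) * Lambda (- int i)))"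
      unfolding sum_distrib_left
      by (metis (no_types, lifting) U_zero_hloop_commute[OF Lambda_in_U_zero] mult.assoc)
    moreover have "(\<Sum>j\<in>{n..m}. hloop (s - int j) * Lambda (int j)) =
       (\<Sum>i\<le>m - n. hloop (s - int m + int i) * Lambda (int m - int i))"
      by (rule sum.reindex_bij_witness[of _ "\<lambda>i. m - i" "\<lambda>j. m - j"]) (use that in auto)
    moreover have "(\<Sum>i\<le>m - n. hloop (s - int m + int i) * Lambda (int m - int i))
        - (\<Sum>i\<le>m - n. hloop (s - int m + int i) * (Lambda (int m) * Lambda (- int i))) =
      - (\<Sum>i\<le>m - n. hloop (s - int m + int i) *
          (Lambda (int m) * Lambda (- int i) - Lambda (int m - int i)))"
      by (simp add: right_diff_distrib sum_subtractf)
    ultimately show ?thesis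
      by (auto intro!: weyl_core_minus weyl_core_sum weyl_core_mult_left weyl_core_Lambda_mult)
  qed
  consider n where "s = int n" "n > m" | n where "s = int n" "n \<le> m" | n where "s = - int n" "n > 0"
    by (metis int_cases2 linorder_not_le neg_0_equal_iff_equal of_nat_0 of_nat_eq_0_iff zero_less_iff_neq_zero)
  thus ?thesis
  proof cases
    case 1
    thus ?thesis using upper(1) by simp
  next
    case (3 n)
    have "(\<Sum>i\<le>m. hloop (s - int m + int i) * Lambda (- int i)) \<in> weyl_core m"
      using upper(2)[of "m + n"] 3 by (simp add: algebra_simps)
    hence "Lambda (int m) * (\<Sum>i\<le>m. hloop (s - int m + int i) * Lambda (- int i)) \<in> weyl_core m"
      by (rule weyl_core_mult_left)
    with flip[of 0 s] show ?thesis
      by (auto simp: atLeast0AtMost dest: weyl_core_add)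
  next
    case (2 n)
    \<comment> \<open>The terms with j < n add up to - n Lambda_n by Newton's identity. The others
      become Lambda_m \<open>T\<close>, and Newton's identity for negative indices gives
      \<open>T\<close> = (h_0 - (m - n)) Lambda_(n-m). By h_0 = m and Lambda_m Lambda_(n-m) =
      Lambda_n this contributes n Lambda_n, and everything cancels.\<close>
    define T where "T = (\<Sum>i\<le>m - n. hloop (s - int m + int i) * Lambda (- int i))"
    have T: "T = hloop 0 * Lambda (int n - int m) - of_nat (m - n) * Lambda (int n - int m)"
    proof -
      have "of_nat (m - n) * Lambda (- int (m - n)) =
          - (\<Sum>j<m - n. hloop (s - int m + int j) * Lambda (- int j))"
        unfolding Lambda_newton(2) using 2 by (simp add: algebra_simps)
      moreover have "T = (\<Sum>j<m - n. hloop (s - int m + int j) * Lambda (- int j))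
          + hloop 0 * Lambda (- int (m - n))"
        unfolding T_def using 2 by (simp add: lessThan_Suc_atMost[symmetric] algebra_simps)
      ultimately show ?thesis using 2(2) by simp
    qed
    have h0: "u * hloop 0 - of_nat m * u \<in> weyl_core m" for u
      using weyl_core_mult_left[OF weyl_core_hloop_0, of u m]
      by (simp add: right_diff_distrib mult_of_nat_commute)
    have c1: "hloop 0 * Lambda k - of_nat m * Lambda k \<in> weyl_core m" for k
      using h0[of "Lambda k"] by (simp add: U_zero_hloop_commute Lambda_in_U_zero)
    have c2: "Lambda (int m) * Lambda (int n - int m) - Lambda (int n) \<in> weyl_core m"
      using weyl_core_Lambda_mult[of "m - n" m] 2 by simp
    have m: "of_nat m = (of_nat n + of_nat (m - n) :: uea)"
      using 2 by (simp flip: of_nat_add)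
    have "{..m} = {..<n} \<union> {n..m}" "{..<n} \<inter> {n..m} = {}" using 2 by auto
    hence "(\<Sum>j\<le>m. hloop (s - int j) * Lambda (int j)) =
        (\<Sum>j<n. hloop (s - int j) * Lambda (int j)) + (\<Sum>j\<in>{n..m}. hloop (s - int j) * Lambda (int j))"
      by (simp add: sum.union_disjoint)
    also have "(\<Sum>j<n. hloop (s - int j) * Lambda (int j)) = - (of_nat n * Lambda (int n))"
      unfolding Lambda_newton(1) 2(1) by simp
    also have "- (of_nat n * Lambda (int n)) + (\<Sum>j\<in>{n..m}. hloop (s - int j) * Lambda (int j)) =
        ((\<Sum>j\<in>{n..m}. hloop (s - int j) * Lambda (int j)) - Lambda (int m) * T)
        + Lambda (int m) * (hloop 0 * Lambda (int n - int m) - of_nat m * Lambda (int n - int m))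
        + of_nat n * (Lambda (int m) * Lambda (int n - int m) - Lambda (int n))"
      unfolding T m
      by (simp add: algebra_simps mult_of_nat_commute)
    also have "\<dots> \<in> weyl_core m"
      by (intro weyl_core_add weyl_core_mult_left c1 c2 flip[OF 2(2), of s, folded T_def])
    finally show ?thesis .
  qed
qed

lemma sum_sum_list_swap:
  "(\<Sum>x\<in>A. \<Sum>y\<leftarrow>ys. f x y) = (\<Sum>y\<leftarrow>ys. \<Sum>x\<in>A. f x y :: 'a::comm_monoid_add)"
  by (induction ys) (auto simp: sum.distrib)

section \<open>Linear recurrences for the lifts and vanishing beyond m letters\<close>

lemma orb_bumps_picks:
  "(\<Sum>b\<leftarrow>bumps l ls. orb ks b) = (\<Sum>(y, r)\<leftarrow>picks ls. orb ks ((y + l) # r))"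
  "(\<Sum>b\<leftarrow>bumps l ks. orb b ls) = (\<Sum>(y, r)\<leftarrow>picks ks. orb ((y + l) # r) ls)"
  by (rule sum_bumps_eq_sum_picks, erule orb_mset_right, rule sum_bumps_eq_sum_picks, erule orb_mset_left)

text \<open>For \<open>ls = []\<close> this is a defining relation multiplied from the left, as the
  x^- commute and the new one can be put next to Lambda_j. The recursion of \<open>orb\<close>
  carries it to longer \<open>ls\<close>, because Lambda_j commutes with h_l.\<close>

lemma orb_recurrence_left:
  "(\<Sum>j\<le>m. orb ((s - int j) # ks) ls * Lambda (int j)) \<in> weyl_core m"
proof (induction ls arbitrary: s ks rule: length_induct)
  case (1 ls)
  show ?case
  proof (cases ls)
    case Nil
    have "orb ((s - int j) # ks) [] = prod_list (map xminus ks) * xminus (s - int j)" for j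
      using prod_list_xminus_mset[of "(s - int j) # ks" "ks @ [s - int j]"] by simp
    hence "(\<Sum>j\<le>m. orb ((s - int j) # ks) [] * Lambda (int j)) =
        prod_list (map xminus ks) * (\<Sum>j\<le>m. xminus (s - int j) * Lambda (int j))"
      by (simp only: sum_distrib_left mult.assoc)
    thus ?thesis unfolding Nil by (simp only: weyl_core_mult_left weyl_core_xminus_Lambda)
  next
    case (Cons l t)
    have IH: "(\<Sum>j\<le>m. orb ((s - int j) # ks) u * Lambda (int j)) \<in> weyl_core m"
      if "length u = length t" for s ks u
      using 1(1) that Cons by simp
    have "(\<Sum>j\<le>m. orb ((s - int j) # ks) (l # t) * Lambda (int j)) =
        (\<Sum>j\<le>m. orb ((s - int j) # ks) t * Lambda (int j)) * hloop l
        - (\<Sum>b\<leftarrow>bumps l t. \<Sum>j\<le>m. orb ((s - int j) # ks) b * Lambda (int j))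
        - ((\<Sum>j\<le>m. orb ((s + l - int j) # ks) t * Lambda (int j))
          + (\<Sum>b\<leftarrow>bumps l ks. \<Sum>j\<le>m. orb ((s - int j) # b) t * Lambda (int j)))"
      unfolding sum_sum_list_swap[symmetric] sum_distrib_right sum_subtractf[symmetric]
        sum.distrib[symmetric]
      by (intro sum.cong refl)
        (simp add: o_def sum_list_mult_right U_zero_hloop_commute
          Lambda_in_U_zero algebra_simps)
    also have "\<dots> \<in> weyl_core m"
      by (intro weyl_core_diff weyl_core_add weyl_core_hloop_right weyl_core_sum_list IH)
        (auto simp: length_bumps)
    finally show ?thesis unfolding Cons .
  qed
qed

text \<open>The product with h is governed by \<open>weyl_core_hloop_Lambda\<close>. In the
  corrections the new letter falls on an occupied position; the raised entry, moved to the front,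
  again runs through a recurrence, for a shorter \<open>ls\<close> or, on a letter v_-, by
  \<open>orb_recurrence_left\<close>.\<close>

lemma orb_recurrence_right:
  "(\<Sum>j\<le>m. orb ks ((s - int j) # ls) * Lambda (int j)) \<in> weyl_core m"
proof (induction ls arbitrary: s ks rule: length_induct)
  case (1 ls)
  note IH = 1(1)
  have "(\<Sum>j\<le>m. orb ks ((s - int j) # ls) * Lambda (int j)) =
      orb ks ls * (\<Sum>j\<le>m. hloop (s - int j) * Lambda (int j))
      - (\<Sum>(y, r)\<leftarrow>picks ls. \<Sum>j\<le>m. orb ks ((y + s - int j) # r) * Lambda (int j))
      - (\<Sum>(y, r)\<leftarrow>picks ks. \<Sum>j\<le>m. orb ((y + s - int j) # r) ls * Lambda (int j))"
    unfolding case_prod_unfold sum_sum_list_swap[symmetric] sum_distrib_left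
      sum_subtractf[symmetric]
    by (intro sum.cong refl, subst orb.simps(2))
      (simp only: orb_bumps_picks case_prod_unfold sum_list_mult_right left_diff_distrib
        mult.assoc add_diff_eq)
  also have "\<dots> \<in> weyl_core m"
  proof (intro weyl_core_diff weyl_core_mult_left weyl_core_hloop_Lambda weyl_core_sum_list, goal_cases)
    case (1 p)
    obtain y r where p: "p = (y, r)" by (cases p)
    have "length r < length ls" using 1 length_picks[of y r ls] p by simp
    thus ?case using IH unfolding p prod.case by blast
  next
    case (2 p)
    show ?case by (cases p) (simp add: orb_recurrence_left)
  qed
  finally show ?case .
qed

lemma orb_zeros_ones_in_core:
  assumes "r + n > m" shows "orb (replicate r 0) (replicate n 1) \<in> weyl_core m"
proof -
  have "orb_unit 1 (replicate r 0) n \<in> weyl_core m"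
  proof (cases "r = 0")
    case True
    thus ?thesis using assms by (simp add: orb_unit_Nil weyl_core_Lambda flip: Lambda_eq_series)
  next
    case False
    thus ?thesis using assms weyl_core_X0_minus[of r m "n + r"] by (simp add: X0_minus_Lambda_nth)
  qed
  thus ?thesis unfolding orb_unit_def by (subst (asm) weyl_core_scale_iff) auto
qed

text \<open>
  Left multiplication by \<open>h\<^sub>c\<close> moves the exponents of the letters \<open>v\<^sub>-\<close>, so that these become
  arbitrary one after the other.
\<close>

lemma orb_ones_in_core:
  assumes "length ks + b + n > m" shows "orb (ks @ replicate b 0) (replicate n 1) \<in> weyl_core m"
  using assms
proof (induction "length ks" arbitrary: ks b)
  case 0
  thus ?case by (simp add: orb_zeros_ones_in_core)
next
  case (Suc p)
  obtain c t where ks: "ks = c # t" using Suc.hyps(2) by (cases ks) auto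
  \<comment> \<open>One exponent fewer is prescribed and one zero more is available. Commuting with
    h_c raises some entry by c: entries of \<open>t\<close> give known elements, and the zeros all
    give the desired one.\<close>
  have IH: "orb (t' @ replicate (Suc b) 0) (replicate n 1) \<in> weyl_core m" if "length t' = length t" for t'
    by (rule Suc.hyps(1)) (use Suc.prems Suc.hyps(2) that ks in auto)
  let ?o = "\<lambda>k. orb k (replicate n 1)"
  have "2 * (\<Sum>x\<leftarrow>bumps c (t @ replicate (Suc b) 0). ?o x) =
      ?o (t @ replicate (Suc b) 0) * hloop c - hloop c * ?o (t @ replicate (Suc b) 0)"
    by (simp only: hloop_orb) simp
  also have "\<dots> \<in> weyl_core m"
    by (intro weyl_core_diff weyl_core_hloop_right weyl_core_mult_left IH refl)
  finally have "(\<Sum>x\<leftarrow>bumps c (t @ replicate (Suc b) 0). ?o x) \<in> weyl_core m"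
    using weyl_core_of_nat_iff[of 2] by simp
  hence "(\<Sum>x\<leftarrow>bumps c t. ?o (x @ replicate (Suc b) 0))
      + (\<Sum>x\<leftarrow>bumps c (replicate (Suc b) 0). ?o (t @ x)) \<in> weyl_core m"
    by (simp only: sum_bumps_append)
  moreover have "(\<Sum>x\<leftarrow>bumps c t. ?o (x @ replicate (Suc b) 0)) \<in> weyl_core m"
    by (intro weyl_core_sum_list IH) (simp add: length_bumps)
  ultimately have "(\<Sum>x\<leftarrow>bumps c (replicate (Suc b) 0). ?o (t @ x)) \<in> weyl_core m"
    by (metis add.commute weyl_core_add_cancel)
  also have "(\<Sum>x\<leftarrow>bumps c (replicate (Suc b) 0). ?o (t @ x)) =
      of_nat (Suc b) * ?o (t @ (0 + c) # replicate (Suc b - 1) 0)"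
    by (rule sum_bumps_replicate, rule orb_mset_left) simp
  finally have "?o (t @ c # replicate b 0) \<in> weyl_core m"
    by (subst (asm) weyl_core_of_nat_iff) auto
  thus ?case unfolding ks by (subst orb_mset_left[of _ "t @ c # replicate b 0"]) auto
qed

lemma weyl_core_Lambda_cancel:
  assumes "u * Lambda (int m) \<in> weyl_core m" shows "u \<in> weyl_core m"
proof -
  have "u * Lambda (int m) * Lambda (- int m)
      - u * (Lambda (int m) * Lambda (- int m) - Lambda (int m - int m)) \<in> weyl_core m"
    by (intro weyl_core_diff weyl_core_mult_left weyl_core_mult_right assms Lambda_in_U_zero
        weyl_core_Lambda_mult) simp
  thus ?thesis by (simp add: right_diff_distrib mult.assoc)
qed

text \<open>
  The exponents of the letters \<open>v\<^sub>+\<close> become arbitrary one after the other, starting with all of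
  them equal to 1. Expanding a product with \<open>h\<^sub>l\<close> raises an exponent at the expense of a letter
  \<open>v\<^sub>+ \<otimes> t\<close>, which gives all positive exponents; the remaining ones follow by running the
  linear recurrence, whose last coefficient \<open>\<Lambda>\<^sub>m\<close> is invertible, backwards.
\<close>

lemma orb_append_ones_in_core:
  assumes "length ks + length ls + b > m" shows "orb ks (ls @ replicate b 1) \<in> weyl_core m"
  using assms
proof (induction "length ls" arbitrary: ks ls b)
  case 0
  thus ?case using orb_ones_in_core[of m ks 0 b] by simp
next
  case (Suc p)
  obtain l t where ls: "ls = l # t" using Suc.hyps(2) by (cases ls) auto
  have IH: "orb ks' (t' @ replicate b 1) \<in> weyl_core m"
    if "length t' = length t" "length ks' = length ks" "length ks + length t + b > m" for t' ks' b
    by (rule Suc.hyps(1)) (use Suc.hyps(2) that ls in auto)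
  have pos: "orb ks ((1 + int i) # t @ replicate b 1) \<in> weyl_core m"
    if "length ks + length t + Suc b > m" for i b
    using that
  proof (induction i arbitrary: b)
    case 0
    have "orb ks (t @ replicate (Suc b) 1) \<in> weyl_core m" by (rule IH) (use 0 in auto)
    thus ?case by (subst orb_mset_right[of _ "t @ replicate (Suc b) 1"]) auto
  next
    case (Suc i)
    let ?l = "1 + int i"
    \<comment> \<open>A one absorbs the new letter and becomes 2 + i. The step for \<open>b\<close>
      thus needs the hypothesis for \<open>Suc b\<close>, so \<open>b\<close> must vary in the
      induction.\<close>
    have "(\<Sum>x\<leftarrow>bumps ?l (replicate (Suc b) 1). orb ks (t @ x)) =
        of_nat (Suc b) * orb ks (t @ (1 + ?l) # replicate (Suc b - 1) 1)"
      by (rule sum_bumps_replicate, rule orb_mset_right) simp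
    also have "orb ks (t @ (1 + ?l) # replicate (Suc b - 1) 1) =
        orb ks ((1 + int (Suc i)) # t @ replicate b 1)"
      by (rule orb_mset_right) auto
    finally have "of_nat (Suc b) * orb ks ((1 + int (Suc i)) # t @ replicate b 1) =
        orb ks (t @ replicate (Suc b) 1) * hloop ?l
        - (\<Sum>x\<leftarrow>bumps ?l t. orb ks (x @ replicate (Suc b) 1))
        - (\<Sum>x\<leftarrow>bumps ?l ks. orb x (t @ replicate (Suc b) 1))
        - orb ks (?l # t @ replicate (Suc b) 1)"
      unfolding orb.simps(2) sum_bumps_append by simp
    also have "\<dots> \<in> weyl_core m"
      by (intro weyl_core_diff weyl_core_hloop_right weyl_core_sum_list IH Suc.IH)
        (use Suc.prems in \<open>auto simp: length_bumps\<close>)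
    finally show ?case by (subst (asm) weyl_core_of_nat_iff) auto
  qed
  have len: "length ks + length t + Suc b > m" using Suc.prems ls by simp
  have all: "orb ks ((1 - int i) # t @ replicate b 1) \<in> weyl_core m" for i
  proof (induction i rule: less_induct)
    case (less i)
    \<comment> \<open>For j < m the exponent exceeds 1 - i, so \<open>?g j\<close> is known from
      \<open>pos\<close> or from the induction; \<open>?g m\<close> is the element in question,
      multiplied in the recurrence by the invertible Lambda_m.\<close>
    let ?g = "\<lambda>j. orb ks ((1 - int i + int m - int j) # t @ replicate b 1)"
    have "?g j \<in> weyl_core m" if "j < m" for j
    proof (cases "i \<le> m - j")
      case True
      hence "1 - int i + int m - int j = 1 + int (m - j - i)" using that by simp
      thus ?thesis using pos[OF len] by metis
    next
      case False
      hence "1 - int i + int m - int j = 1 - int (i - (m - j))" using that by simp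
      moreover have "i - (m - j) < i" using that False by simp
      ultimately show ?thesis using less.IH by metis
    qed
    hence "(\<Sum>j<m. ?g j * Lambda (int j)) \<in> weyl_core m"
      by (intro weyl_core_sum weyl_core_mult_right Lambda_in_U_zero) auto
    moreover have "?g m * Lambda (int m) + (\<Sum>j<m. ?g j * Lambda (int j)) \<in> weyl_core m"
      using orb_recurrence_right[where s = "1 - int i + int m" and ls = "t @ replicate b 1" and ks = ks and m = m]
      by (simp only: lessThan_Suc_atMost[symmetric] sum.lessThan_Suc add.commute)
    ultimately have "?g m * Lambda (int m) \<in> weyl_core m" by (rule weyl_core_add_cancel[rotated])
    thus ?case by (auto dest: weyl_core_Lambda_cancel)
  qed
  show ?case
  proof (cases "l \<ge> 1")
    case True
    thus ?thesis using pos[OF len, of "nat (l - 1)"] ls by simp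
  next
    case False
    thus ?thesis using all[of "nat (1 - l)"] ls by simp
  qed
qed

lemma orb_in_core: "length ks + length ls > m \<Longrightarrow> orb ks ls \<in> weyl_core m"
  using orb_append_ones_in_core[of m ks ls 0] by simp

section \<open>Symmetrized words\<close>

lemma uea_act_linear:
  "uea_act (a + b) x = uea_act a x + uea_act b x"
  "uea_act (a - b) x = uea_act a x - uea_act b x"
  "uea_act (uea_scale c a) x = smult c (uea_act a x)"
  "uea_act 0 x = 0"
  "uea_act (- a) x = - uea_act a x"
proof -
  show "uea_act (a + b) x = uea_act a x + uea_act b x" for a b
    by transfer (rule tensor_act_linear)
  show *: "uea_act (a - b) x = uea_act a x - uea_act b x" for a b
    by transfer (rule tensor_act_linear)
  show "uea_act (uea_scale c a) x = smult c (uea_act a x)"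
    by transfer (rule tensor_act_linear)
  show z: "uea_act 0 x = 0"
    by transfer (rule tensor_act_linear)
  show "uea_act (- a) x = - uea_act a x"
    using *[of 0 a] z by simp
qed

lemma uea_act_linear_right:
  "uea_act a (x + y) = uea_act a x + uea_act a y"
  "uea_act a (smult c x) = smult c (uea_act a x)"
  "uea_act a 0 = 0"
proof -
  show "uea_act a (x + y) = uea_act a x + uea_act a y"
    by transfer (rule tensor_act_linear_right)
  show "uea_act a (smult c x) = smult c (uea_act a x)"
    by transfer (rule tensor_act_linear_right)
  show "uea_act a 0 = 0"
    by transfer (rule tensor_act_zero_right)
qed

lemma uea_act_sum: "uea_act (sum f A) x = (\<Sum>a\<in>A. uea_act (f a) x)"
  by (induction A rule: infinite_finite_induct) (auto simp: uea_act_linear)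

lemma uea_act_sum_list: "uea_act (\<Sum>a\<leftarrow>as. f a) x = (\<Sum>a\<leftarrow>as. uea_act (f a) x)"
  by (induction as) (auto simp: uea_act_linear)

lemma uea_act_of_nat: "uea_act (of_nat n) x = smult (of_nat n) x"
  using uea_act_linear(3)[of "of_nat n" 1 x] by (simp add: uea_scale_of_nat uea_act_one)

text \<open>Each of x^+, x^-, h sends a basis vector of V to a multiple of a basis vector, so that
  the action on a word becomes a sum of list updates. Where the coefficient is 0, the value of
  \<open>V_target\<close> is a dummy.\<close>

fun V_coeff :: "sl2 \<Rightarrow> vbasis \<Rightarrow> complex" where
  "V_coeff XPlus v = (if v = VMinus then 1 else 0)"
| "V_coeff XMinus v = (if v = VPlus then 1 else 0)"
| "V_coeff HH v = (if v = VPlus then 1 else -1)"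

fun V_target :: "sl2 \<Rightarrow> vbasis \<Rightarrow> vbasis" where
  "V_target XPlus v = VPlus"
| "V_target XMinus v = VMinus"
| "V_target HH v = v"

definition loop_letter :: "sl2 \<Rightarrow> int \<Rightarrow> lv \<Rightarrow> lv" where
  "loop_letter x r p = (V_target x (fst p), r + snd p)"

lemma LV_act_loop:
  "LV_act (Loop x r) p = Poly_Mapping.single (loop_letter x r p) (V_coeff x (fst p))"
  by (cases p; cases x; cases "fst p") (auto simp: loop_letter_def)

lemma word_act_loop:
  "word_act (Loop x r) vs = (\<Sum>i<length vs.
     Poly_Mapping.single (FWord (vs[i := loop_letter x r (vs ! i)])) (V_coeff x (fst (vs ! i))))"
  unfolding word_act_def
  by (intro sum.cong refl)
    (simp add: LV_act_loop tensor_incl_def mult_single plus_fword_def upd_conv_take_nth_drop)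

text \<open>Words with equal letters occur with multiplicity and nothing is divided out;
  \<open>orb_sum\<close> and \<open>weyl_lift\<close> supply the factorials.\<close>

definition symz :: "lv list \<Rightarrow> lv tensor" where
  "symz L = (\<Sum>\<sigma> | \<sigma> permutes {..<length L}. Poly_Mapping.single (FWord (permute_list \<sigma> L)) 1)"

lemma symz_mset:
  assumes "mset L = mset L'" shows "symz L = symz L'"
proof -
  obtain p where p: "p permutes {..<length L'}" "permute_list p L' = L"
    using assms by (rule mset_eq_permutation)
  have len: "length L = length L'" using assms by (metis size_mset)
  have "symz L' = (\<Sum>\<sigma> | \<sigma> permutes {..<length L'}.
      Poly_Mapping.single (FWord (permute_list (p \<circ> \<sigma>) L')) 1)"
    unfolding symz_def by (rule setum_permutations_compose_left[OF p(1)])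
  also have "\<dots> = symz L"
    unfolding symz_def len by (intro sum.cong refl) (simp add: permute_list_compose p(2))
  finally show ?thesis ..
qed

lemma permute_tensor_symz:
  assumes "\<tau> permutes {..<length L}" shows "permute_tensor \<tau> (symz L) = symz L"
proof -
  have "permute_tensor \<tau> (symz L) = (\<Sum>\<sigma> | \<sigma> permutes {..<length L}.
      Poly_Mapping.single (FWord (permute_list (\<sigma> \<circ> \<tau>) L)) 1)"
    unfolding symz_def permute_tensor_def linext_sum
    by (intro sum.cong refl) (simp add: permute_list_compose assms)
  also have "\<dots> = symz L"
    unfolding symz_def by (rule sum_permutations_compose_right[OF assms, symmetric])
  finally show ?thesis .
qed

lemma tensor_power_closed:
  "x \<in> tensor_power m \<Longrightarrow> y \<in> tensor_power m \<Longrightarrow> x + y \<in> tensor_power m"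
  "0 \<in> tensor_power m"
  "x \<in> tensor_power m \<Longrightarrow> smult c x \<in> tensor_power m"
  using keys_add[of x y] by (auto simp: tensor_power_def in_keys_iff lookup_smult)

lemma tensor_power_sum:
  "(\<And>a. a \<in> A \<Longrightarrow> f a \<in> tensor_power m) \<Longrightarrow> sum f A \<in> tensor_power m"
  by (induction A rule: infinite_finite_induct) (auto simp: tensor_power_closed)

lemma symz_in_symmetric_power: "length L = m \<Longrightarrow> symz L \<in> symmetric_power m"
proof -
  assume "length L = m"
  hence "symz L \<in> tensor_power m"
    unfolding symz_def by (intro tensor_power_sum) (simp add: tensor_power_def)
  thus "symz L \<in> symmetric_power m"
    using \<open>length L = m\<close> by (auto simp: symmetric_power_def permute_tensor_symz)
qed

lemma symmetric_power_closed:
  "x \<in> symmetric_power m \<Longrightarrow> y \<in> symmetric_power m \<Longrightarrow> x + y \<in> symmetric_power m"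
  "0 \<in> symmetric_power m"
  "x \<in> symmetric_power m \<Longrightarrow> smult c x \<in> symmetric_power m"
  by (auto simp: symmetric_power_def tensor_power_closed permute_tensor_def linext_add linext_smult)

lemma smult_of_nat: "smult (of_nat n) x = of_nat n * (x :: 'a::monoid_add vec)"
  by (induction n) (auto simp: smult_add_left algebra_simps)

lemma smult_fact: "smult (fact n) x = fact n * (x :: 'a::monoid_add vec)"
  using smult_of_nat[of "fact n" x] by simp

text \<open>A symmetric tensor is its own average over all permutations.\<close>

lemma symmetric_power_eq_symz:
  assumes "x \<in> symmetric_power m"
  shows "x = (\<Sum>w\<in>Poly_Mapping.keys x. smult (Poly_Mapping.lookup x w / fact m) (symz (letters w)))"
proof -
  let ?P = "{\<sigma>. \<sigma> permutes {..<m}}"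
  have len: "length (letters w) = m" if "w \<in> Poly_Mapping.keys x" for w
    using assms that by (auto simp: symmetric_power_def tensor_power_def)
  have "smult (fact m) x = (\<Sum>\<sigma>\<in>?P. x)"
    by (simp add: card_permutations finite_permutations smult_fact)
  also have "\<dots> = (\<Sum>\<sigma>\<in>?P. permute_tensor \<sigma> x)"
    using assms by (intro sum.cong refl) (auto simp: symmetric_power_def)
  also have "\<dots> = (\<Sum>w\<in>Poly_Mapping.keys x. smult (Poly_Mapping.lookup x w)
      (\<Sum>\<sigma>\<in>?P. Poly_Mapping.single (FWord (permute_list \<sigma> (letters w))) 1))"
    unfolding permute_tensor_def linext_def smult_sum by (rule sum.swap)
  also have "\<dots> = (\<Sum>w\<in>Poly_Mapping.keys x. smult (Poly_Mapping.lookup x w) (symz (letters w)))"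
    by (intro sum.cong refl) (simp add: symz_def len)
  finally have "smult (1 / fact m) (smult (fact m) x) = smult (1 / fact m)
      (\<Sum>w\<in>Poly_Mapping.keys x. smult (Poly_Mapping.lookup x w) (symz (letters w)))"
    by (rule arg_cong)
  thus ?thesis by (simp add: smult_smult smult_sum)
qed

text \<open>The old entry is recorded beside the changed list, because the coefficient of the action
  depends on it.\<close>

fun edits :: "('a \<Rightarrow> 'a) \<Rightarrow> 'a list \<Rightarrow> ('a \<times> 'a list) list" where
  "edits g [] = []"
| "edits g (x # xs) = (x, g x # xs) # map (\<lambda>(y, ys). (y, x # ys)) (edits g xs)"

lemma sum_edits:
  "(\<Sum>i<length xs. F (xs ! i) (xs[i := g (xs ! i)])) =
     (\<Sum>(y, ys)\<leftarrow>edits g xs. F y ys :: 'a::comm_monoid_add)"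
proof (induction xs arbitrary: F)
  case (Cons x xs)
  show ?case using Cons.IH[of "\<lambda>y ys. F y (x # ys)"]
    by (simp add: sum.lessThan_Suc_shift o_def case_prod_unfold del: sum.lessThan_Suc)
qed simp

lemma sum_edits_append:
  "(\<Sum>(y, zs)\<leftarrow>edits g (xs @ ys). F y zs) =
     (\<Sum>(y, zs)\<leftarrow>edits g xs. F y (zs @ ys)) +
     (\<Sum>(y, zs)\<leftarrow>edits g ys. F y (xs @ zs) :: 'a::comm_monoid_add)"
proof (induction xs arbitrary: F)
  case (Cons x xs)
  show ?case using Cons.IH[of "\<lambda>y ys. F y (x # ys)"]
    by (simp add: o_def case_prod_unfold add_ac)
qed simp

lemma sum_edits_map:
  "(\<Sum>(y, zs)\<leftarrow>edits (loop_letter HH c) (map (Pair v) ks). F (fst y) zs) =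
     (\<Sum>b\<leftarrow>bumps c ks. F v (map (Pair v) b) :: 'a::comm_monoid_add)"
proof (induction ks arbitrary: F)
  case (Cons k ks)
  show ?case using Cons.IH[of "\<lambda>y ys. F y ((v, k) # ys)"]
    by (simp add: o_def case_prod_unfold loop_letter_def add.commute)
qed simp

lemma sum_edits_replicate:
  assumes "\<And>zs zs'. length zs = n \<Longrightarrow> mset zs = mset zs' \<Longrightarrow> F zs = F zs'"
  shows "(\<Sum>(y, zs)\<leftarrow>edits g (replicate n x). smult (\<kappa> y) (F zs)) =
     smult (of_nat n * \<kappa> x) (F (g x # replicate (n - 1) x))"
  using assms
proof (induction n arbitrary: F)
  case (Suc n)
  have IH: "(\<Sum>(y, zs)\<leftarrow>edits g (replicate n x). smult (\<kappa> y) (F (x # zs))) =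
     smult (of_nat n * \<kappa> x) (F (x # g x # replicate (n - 1) x))"
    by (rule Suc.IH) (auto intro: Suc.prems)
  have "n > 0 \<Longrightarrow> F (x # g x # replicate (n - 1) x) = F (g x # replicate n x)"
    by (rule Suc.prems) (auto simp: gr0_conv_Suc)
  thus ?case using IH
    by (cases "n = 0") (simp_all add: o_def case_prod_unfold distrib_right smult_add_left)
qed simp

text \<open>Changing position i of the word permuted by \<sigma> amounts to changing position
  \<sigma> i before permuting, and the sum over positions may be reindexed by \<sigma>.\<close>

lemma gen_act_symz:
  "gen_act (Loop x r) (symz L) =
     (\<Sum>(y, L')\<leftarrow>edits (loop_letter x r) L. smult (V_coeff x (fst y)) (symz L'))"
proof -
  let ?P = "{\<sigma>. \<sigma> permutes {..<length L}}"
  have 1: "gen_act (Loop x r) (Poly_Mapping.single (FWord (permute_list \<sigma> L)) 1) =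
      (\<Sum>i<length L. smult (V_coeff x (fst (L ! i)))
        (Poly_Mapping.single (FWord (permute_list \<sigma> (L[i := loop_letter x r (L ! i)]))) 1))"
    if "\<sigma> \<in> ?P" for \<sigma>
  proof -
    from that have \<sigma>: "\<sigma> permutes {..<length L}" by simp
    have upd: "(permute_list \<sigma> L)[i := y] = permute_list \<sigma> (L[\<sigma> i := y])" if "i < length L" for i y
    proof (rule nth_equalityI)
      fix j assume "j < length ((permute_list \<sigma> L)[i := y])"
      hence j: "j < length L" by simp
      hence "\<sigma> j < length L" "\<sigma> i < length L" using permutes_in_image[OF \<sigma>] that by auto
      thus "(permute_list \<sigma> L)[i := y] ! j = permute_list \<sigma> (L[\<sigma> i := y]) ! j"
        using j that \<sigma> by (simp add: nth_list_update permute_list_nth inj_eq[OF permutes_inj[OF \<sigma>]])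
    qed simp
    have "gen_act (Loop x r) (Poly_Mapping.single (FWord (permute_list \<sigma> L)) 1) =
        (\<Sum>i<length L. smult (V_coeff x (fst (L ! \<sigma> i))) (Poly_Mapping.single
          (FWord (permute_list \<sigma> (L[\<sigma> i := loop_letter x r (L ! \<sigma> i)]))) 1))"
      unfolding gen_act_single word_act_loop
      by (auto intro!: sum.cong simp: permute_list_nth[OF \<sigma>] upd)
    also have "\<dots> = (\<Sum>i<length L. smult (V_coeff x (fst (L ! i)))
        (Poly_Mapping.single (FWord (permute_list \<sigma> (L[i := loop_letter x r (L ! i)]))) 1))"
      by (rule sum.permute[OF \<sigma>, symmetric, unfolded o_def])
    finally show ?thesis .
  qed
  have "gen_act (Loop x r) (symz L) =
      (\<Sum>\<sigma>\<in>?P. \<Sum>i<length L. smult (V_coeff x (fst (L ! i)))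
        (Poly_Mapping.single (FWord (permute_list \<sigma> (L[i := loop_letter x r (L ! i)]))) 1))"
    unfolding symz_def gen_act_def linext_sum
    by (intro sum.cong refl) (simp only: 1 flip: gen_act_def)
  also have "\<dots> = (\<Sum>i<length L. smult (V_coeff x (fst (L ! i))) (symz (L[i := loop_letter x r (L ! i)])))"
    by (subst sum.swap) (simp add: symz_def smult_sum)
  finally show ?thesis
    by (simp only: sum_edits[where F = "\<lambda>y L'. smult (V_coeff x (fst y)) (symz L')"])
qed

text \<open>
  The letters in \<open>L\<close> are placed at distinct positions, and \<open>v\<^sub>+ \<otimes> 1\<close> at the remaining
  positions; each such word occurs \<open>(m - length L)!\<close> times in the symmetrization.
\<close>

definition orb_sum :: "nat \<Rightarrow> lv list \<Rightarrow> lv tensor" where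
  "orb_sum m L = (if length L \<le> m
     then smult (1 / fact (m - length L)) (symz (L @ replicate (m - length L) (VPlus, 0))) else 0)"

definition lv_word :: "int list \<Rightarrow> int list \<Rightarrow> lv list" where
  "lv_word ks ls = map (Pair VMinus) ks @ map (Pair VPlus) ls"

definition vacuum :: "nat \<Rightarrow> lv tensor" where
  "vacuum m = Poly_Mapping.single (FWord (replicate m (VPlus, 0))) 1"

lemma length_lv_word [simp]: "length (lv_word ks ls) = length ks + length ls"
  by (simp add: lv_word_def)

lemma orb_sum_Nil: "orb_sum m [] = vacuum m"
proof -
  have "permute_list \<sigma> (replicate m (VPlus, 0 :: int)) = replicate m (VPlus, 0)"
    if "\<sigma> permutes {..<m}" for \<sigma>
  proof (rule nth_equalityI)
    fix i assume "i < length (permute_list \<sigma> (replicate m (VPlus, 0 :: int)))"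
    hence "i < m" by simp
    moreover from this have "\<sigma> i < m" using permutes_in_image[OF that, of i] by simp
    ultimately show "permute_list \<sigma> (replicate m (VPlus, 0 :: int)) ! i = replicate m (VPlus, 0) ! i"
      using that by (simp add: permute_list_nth)
  qed simp
  hence "symz (replicate m (VPlus, 0)) = (\<Sum>\<sigma> | \<sigma> permutes {..<m}. vacuum m)"
    unfolding symz_def vacuum_def by (intro sum.cong) auto
  also have "\<dots> = smult (fact m) (vacuum m)"
    by (simp add: card_permutations finite_permutations smult_fact)
  finally show ?thesis by (simp add: orb_sum_def smult_smult)
qed

text \<open>The \<open>z\<close> letters v_+ (x) 1 contribute equally, and z / z! = 1 / (z - 1)! is
  the normalization for one more placed letter. For \<open>z = 0\<close> the sum is empty, in
  agreement with the default value 0 of \<open>orb_sum\<close> beyond m letters.\<close>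

lemma gen_act_orb_sum_vacuum_part:
  assumes z: "z = m - n" and n: "length A = n" "n \<le> m"
  shows "smult (1 / fact z) (\<Sum>(y, zs)\<leftarrow>edits g (replicate z (VPlus, 0)).
      smult (\<kappa> y) (symz (A @ zs))) =
    smult (\<kappa> (VPlus, 0)) (orb_sum m (g (VPlus, 0) # A))"
proof -
  have *: "(\<Sum>(y, zs)\<leftarrow>edits g (replicate z (VPlus, 0)). smult (\<kappa> y) (symz (A @ zs))) =
      smult (of_nat z * \<kappa> (VPlus, 0)) (symz (A @ g (VPlus, 0) # replicate (z - 1) (VPlus, 0)))"
    by (rule sum_edits_replicate) (auto intro: symz_mset)
  show ?thesis
  proof (cases z)
    case 0
    thus ?thesis using z n by (simp add: orb_sum_def)
  next
    case (Suc k)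
    have "symz (A @ g (VPlus, 0) # replicate k (VPlus, 0)) =
        symz ((g (VPlus, 0) # A) @ replicate k (VPlus, 0))"
      by (rule symz_mset) simp
    moreover have "m - length (g (VPlus, 0) # A) = k" "length (g (VPlus, 0) # A) \<le> m"
      using Suc z n by auto
    moreover have "1 / fact (Suc k) * (of_nat (Suc k) * \<kappa> (VPlus, 0)) = \<kappa> (VPlus, 0) * (1 / fact k)"
      by (simp add: field_simps del: of_nat_Suc)
    ultimately show ?thesis unfolding * unfolding Suc orb_sum_def
      by (simp only: smult_smult if_True diff_Suc_1)
  qed
qed

lemma sum_list_smult: "smult c (\<Sum>x\<leftarrow>xs. f x) = (\<Sum>x\<leftarrow>xs. smult c (f x))"
  by (induction xs) (auto simp: smult_add)

lemma orb_sum_mset: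
  assumes "mset L = mset L'" shows "orb_sum m L = orb_sum m L'"
proof -
  have "length L = length L'" using assms by (metis size_mset)
  thus ?thesis unfolding orb_sum_def using assms by (auto intro!: arg_cong[of _ _ "smult _"] symz_mset)
qed

text \<open>The three terms come from h_c hitting a letter v_+ (x) 1, a letter v_-, and a placed
  letter v_+. They match \<open>orb_Cons_left\<close>.\<close>

lemma gen_act_hloop_orb_sum:
  "gen_act (Loop HH c) (orb_sum m (lv_word ks ls)) =
     orb_sum m (lv_word ks (c # ls)) - (\<Sum>b\<leftarrow>bumps c ks. orb_sum m (lv_word b ls))
     + (\<Sum>b\<leftarrow>bumps c ls. orb_sum m (lv_word ks b))"
proof (cases "length ks + length ls \<le> m")
  case False
  have "(\<Sum>b\<leftarrow>bumps c ks. orb_sum m (lv_word b ls)) = (\<Sum>b\<leftarrow>bumps c ks. 0)"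
    using False by (intro arg_cong[of _ _ sum_list] map_cong) (auto simp: orb_sum_def length_bumps)
  moreover have "(\<Sum>b\<leftarrow>bumps c ls. orb_sum m (lv_word ks b)) = (\<Sum>b\<leftarrow>bumps c ls. 0)"
    using False by (intro arg_cong[of _ _ sum_list] map_cong) (auto simp: orb_sum_def length_bumps)
  ultimately show ?thesis using False by (simp add: orb_sum_def gen_act_linear)
next
  case True
  define n where "n = length ks + length ls"
  define z where "z = m - n"
  let ?Z = "replicate z (VPlus, 0)"
  let ?g = "loop_letter HH c"
  have sum: "orb_sum m (lv_word b b') = smult (1 / fact z) (symz (lv_word b b' @ ?Z))"
    if "length b + length b' = n" for b b'
    using that True by (simp add: orb_sum_def z_def n_def)
  have "gen_act (Loop HH c) (orb_sum m (lv_word ks ls)) = smult (1 / fact z)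
      (\<Sum>(y, L')\<leftarrow>edits ?g (map (Pair VMinus) ks @ map (Pair VPlus) ls @ ?Z).
        smult (V_coeff HH (fst y)) (symz L'))"
    by (subst sum) (simp_all add: n_def gen_act_linear gen_act_symz lv_word_def)
  also have "\<dots> = smult (1 / fact z) (\<Sum>(y, L')\<leftarrow>edits ?g (map (Pair VMinus) ks).
        smult (V_coeff HH (fst y)) (symz (L' @ map (Pair VPlus) ls @ ?Z)))
      + smult (1 / fact z) (\<Sum>(y, L')\<leftarrow>edits ?g (map (Pair VPlus) ls).
        smult (V_coeff HH (fst y)) (symz (map (Pair VMinus) ks @ L' @ ?Z)))
      + smult (1 / fact z) (\<Sum>(y, L')\<leftarrow>edits ?g ?Z.
        smult (V_coeff HH (fst y)) (symz (lv_word ks ls @ L')))"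
    unfolding sum_edits_append[where F = "\<lambda>y L'. smult (V_coeff HH (fst y)) (symz L')"]
      sum_edits_append[where F = "\<lambda>y L'. smult (V_coeff HH (fst y)) (symz (map (Pair VMinus) ks @ L'))"]
    by (simp add: smult_add lv_word_def add_ac)
  also have "smult (1 / fact z) (\<Sum>(y, L')\<leftarrow>edits ?g (map (Pair VMinus) ks).
        smult (V_coeff HH (fst y)) (symz (L' @ map (Pair VPlus) ls @ ?Z))) =
      (\<Sum>b\<leftarrow>bumps c ks. - orb_sum m (lv_word b ls))"
    unfolding sum_edits_map[where F = "\<lambda>y L'. smult (V_coeff HH y) (symz (L' @ map (Pair VPlus) ls @ ?Z))"]
      sum_list_smult
    by (intro arg_cong[of _ _ sum_list] map_cong refl)
      (subst sum, simp_all add: n_def length_bumps lv_word_def smult_smult poly_mapping_eq_iff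
        fun_eq_iff lookup_smult)
  also have "smult (1 / fact z) (\<Sum>(y, L')\<leftarrow>edits ?g (map (Pair VPlus) ls).
        smult (V_coeff HH (fst y)) (symz (map (Pair VMinus) ks @ L' @ ?Z))) =
      (\<Sum>b\<leftarrow>bumps c ls. orb_sum m (lv_word ks b))"
    unfolding sum_edits_map[where F = "\<lambda>y L'. smult (V_coeff HH y) (symz (map (Pair VMinus) ks @ L' @ ?Z))"]
      sum_list_smult
    by (intro arg_cong[of _ _ sum_list] map_cong refl)
      (subst sum, simp_all add: n_def length_bumps lv_word_def)
  also have "smult (1 / fact z) (\<Sum>(y, L')\<leftarrow>edits ?g ?Z.
        smult (V_coeff HH (fst y)) (symz (lv_word ks ls @ L'))) =
      smult (V_coeff HH (fst (VPlus, 0 :: int))) (orb_sum m (?g (VPlus, 0) # lv_word ks ls))"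
    by (rule gen_act_orb_sum_vacuum_part[OF z_def]) (use True in \<open>auto simp: n_def\<close>)
  also have "orb_sum m (?g (VPlus, 0) # lv_word ks ls) = orb_sum m (lv_word ks (c # ls))"
    by (rule orb_sum_mset) (simp add: lv_word_def loop_letter_def)
  finally show ?thesis by (simp add: uminus_sum_list_map o_def)
qed

text \<open>Letters v_+ can be left out, because \<open>orb\<close> starts from products of x^- and
  adds the letters v_+ by means of h.\<close>

lemma gen_act_xminus_orb_sum:
  "gen_act (Loop XMinus c) (orb_sum m (lv_word ks [])) = orb_sum m (lv_word (c # ks) [])"
proof (cases "length ks \<le> m")
  case False
  thus ?thesis by (simp add: orb_sum_def gen_act_linear)
next
  case True
  define z where "z = m - length ks"
  let ?Z = "replicate z (VPlus, 0)"
  let ?g = "loop_letter XMinus c"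
  have "gen_act (Loop XMinus c) (orb_sum m (lv_word ks [])) = smult (1 / fact z)
      (\<Sum>(y, L')\<leftarrow>edits ?g (lv_word ks [] @ ?Z). smult (V_coeff XMinus (fst y)) (symz L'))"
    using True by (simp add: orb_sum_def z_def gen_act_linear gen_act_symz)
  also have "\<dots> = smult (1 / fact z) (\<Sum>(y, L')\<leftarrow>edits ?g (lv_word ks []).
        smult (V_coeff XMinus (fst y)) (symz (L' @ ?Z)))
      + smult (1 / fact z) (\<Sum>(y, L')\<leftarrow>edits ?g ?Z.
        smult (V_coeff XMinus (fst y)) (symz (lv_word ks [] @ L')))"
    unfolding sum_edits_append[where F = "\<lambda>y L'. smult (V_coeff XMinus (fst y)) (symz L')"]
    by (simp add: smult_add)
  also have "(\<Sum>(y, L')\<leftarrow>edits ?g (lv_word ks []).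
        smult (V_coeff XMinus (fst y)) (symz (L' @ ?Z))) = 0"
  proof -
    have minus: "fst y = VMinus" if "(y, L') \<in> set (edits ?g (lv_word ks []))" for y L'
      using that by (induction ks arbitrary: L') (auto simp: lv_word_def)
    have "map (\<lambda>(y, L'). smult (V_coeff XMinus (fst y)) (symz (L' @ ?Z))) (edits ?g (lv_word ks []))
        = map (\<lambda>_. 0) (edits ?g (lv_word ks []))"
      by (intro map_cong refl) (auto dest: minus)
    thus ?thesis by (simp only: sum_list_0)
  qed
  also have "smult (1 / fact z) (\<Sum>(y, L')\<leftarrow>edits ?g ?Z.
        smult (V_coeff XMinus (fst y)) (symz (lv_word ks [] @ L'))) =
      smult (V_coeff XMinus (fst (VPlus, 0 :: int))) (orb_sum m (?g (VPlus, 0) # lv_word ks []))"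
    by (rule gen_act_orb_sum_vacuum_part[OF z_def]) (use True in auto)
  finally show ?thesis by (simp add: lv_word_def loop_letter_def)
qed

text \<open>The defining recursion multiplies on the right and says nothing about a left action
  directly; \<open>orb_Cons_left\<close> does.\<close>

lemma uea_act_orb: "uea_act (orb ks ls) (vacuum m) = orb_sum m (lv_word ks ls)"
proof (induction ks ls rule: orb.induct)
  case (1 ks)
  show ?case
  proof (induction ks)
    case Nil
    show ?case by (simp add: uea_act_one lv_word_def orb_sum_Nil)
  next
    case (Cons k ks)
    thus ?case by (simp add: uea_act_mult uea_act_gen gen_act_xminus_orb_sum)
  qed
next
  case (2 ks l ls)
  have "(\<Sum>b\<leftarrow>bumps l ks. uea_act (orb b ls) (vacuum m)) = (\<Sum>b\<leftarrow>bumps l ks. orb_sum m (lv_word b ls))"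
    "(\<Sum>b\<leftarrow>bumps l ls. uea_act (orb ks b) (vacuum m)) = (\<Sum>b\<leftarrow>bumps l ls. orb_sum m (lv_word ks b))"
    by (intro arg_cong[of _ _ sum_list] map_cong refl 2; assumption)+
  thus ?case
    unfolding orb_Cons_left
    by (simp add: uea_act_linear uea_act_sum_list uea_act_mult uea_act_gen 2(1) gen_act_hloop_orb_sum)
qed

section \<open>The right action on tensors\<close>

lemma tensor_ract_linear:
  "tensor_ract (x + y) p = tensor_ract x p + tensor_ract y p"
  "tensor_ract (smult c x) p = smult c (tensor_ract x p)"
  "tensor_ract 0 p = 0"
  by (simp_all add: tensor_ract_def bilinext_def linext_add linext_smult)

lemma tensor_ract_linear_right:
  "tensor_ract x (p + q) = tensor_ract x p + tensor_ract x q"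
  "tensor_ract x (smult c p) = smult c (tensor_ract x p)"
  by (simp_all add: tensor_ract_def bilinext_def linext_add linext_smult)
    (simp_all add: linext_def smult_add sum.distrib smult_sum smult_smult mult.left_commute)

lemma tensor_ract_right_simps:
  "tensor_ract x 0 = 0"
  "tensor_ract x (- p) = - tensor_ract x p"
  "tensor_ract x (p - q) = tensor_ract x p - tensor_ract x q"
proof -
  show *: "tensor_ract x 0 = 0" using tensor_ract_linear_right(2)[of x 0 0] by simp
  show "tensor_ract x (- p) = - tensor_ract x p"
    using tensor_ract_linear_right(1)[of x p "- p"] * by (simp add: eq_neg_iff_add_eq_0 add.commute)
  show "tensor_ract x (p - q) = tensor_ract x p - tensor_ract x q"
    using tensor_ract_linear_right(1)[of x "p - q" q] by (simp add: eq_diff_eq)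
qed

lemma tensor_ract_sum_left: "tensor_ract (sum f A) p = (\<Sum>a\<in>A. tensor_ract (f a) p)"
  by (induction A rule: infinite_finite_induct) (auto simp: tensor_ract_linear)

lemma tensor_ract_sum: "tensor_ract x (sum f A) = (\<Sum>a\<in>A. tensor_ract x (f a))"
  by (induction A rule: infinite_finite_induct)
    (auto simp: tensor_ract_linear_right tensor_ract_right_simps)

lemma tensor_ract_single:
  "tensor_ract (Poly_Mapping.single w c) (Poly_Mapping.single \<alpha> d) =
     Poly_Mapping.single (shift_word w \<alpha>) (c * d)"
  by (simp add: tensor_ract_def bilinext_def)

lemma length_shift_word [simp]: "length (letters (shift_word w \<alpha>)) = length (letters w)"
  by (simp add: shift_word_def)

lemma shift_word_nth:
  "i < length (letters w) \<Longrightarrow> letters (shift_word w \<alpha>) ! i =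
     (fst (letters w ! i), snd (letters w ! i) + Poly_Mapping.lookup \<alpha> i)"
  by (simp add: shift_word_def)

lemma fword_eqI:
  "length (letters v) = length (letters w) \<Longrightarrow>
     (\<And>i. i < length (letters v) \<Longrightarrow> letters v ! i = letters w ! i) \<Longrightarrow> v = w"
  by (metis fword.expand nth_equalityI)

lemma shift_word_add: "shift_word (shift_word w \<alpha>) \<beta> = shift_word w (\<alpha> + \<beta>)"
  by (rule fword_eqI) (simp_all add: shift_word_nth lookup_add)

lemma shift_word_zero [simp]: "shift_word w 0 = w"
  by (rule fword_eqI) (simp_all add: shift_word_nth)

lemma tensor_ract_scalar: "tensor_ract x (Poly_Mapping.single 0 c) = smult c x"
  by (induction x rule: vec_induct)
    (simp_all add: tensor_ract_single tensor_ract_linear smult_add mult.commute)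

lemma tensor_ract_one [simp]: "tensor_ract x 1 = x"
  using tensor_ract_scalar[of x 1] by simp

lemma tensor_ract_mult: "tensor_ract (tensor_ract x p) q = tensor_ract x (p * q)"
proof (induction x rule: vec_induct)
  case (single w c)
  show ?case
  proof (induction p rule: vec_induct)
    case (single \<alpha> d)
    show ?case
    proof (induction q rule: vec_induct)
      case (single \<beta> e)
      show ?case by (simp add: tensor_ract_single mult_single shift_word_add mult.assoc)
    qed (simp add: tensor_ract_linear_right distrib_left)
  qed (simp add: tensor_ract_linear tensor_ract_linear_right distrib_right)
qed (simp add: tensor_ract_linear)

text \<open>Exponents add up, and the coefficient depends on the V-component only. For d this would
  fail, its eigenvalue being the exponent.\<close>

lemma word_act_shift:
  "word_act (Loop x r) (letters (shift_word w \<alpha>)) =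
     tensor_ract (word_act (Loop x r) (letters w)) (Poly_Mapping.single \<alpha> 1)"
proof -
  have "FWord ((letters (shift_word w \<alpha>))[i := loop_letter x r (letters (shift_word w \<alpha>) ! i)]) =
      shift_word (FWord ((letters w)[i := loop_letter x r (letters w ! i)])) \<alpha>"
    if "i < length (letters w)" for i
    using that by (intro fword_eqI)
      (auto simp: nth_list_update shift_word_nth loop_letter_def)
  thus ?thesis
    unfolding word_act_loop tensor_ract_sum_left
    by (intro sum.cong) (auto simp: tensor_ract_single shift_word_nth)
qed

lemma gen_act_ract:
  "gen_act (Loop x r) (tensor_ract y p) = tensor_ract (gen_act (Loop x r) y) p"
proof (induction y rule: vec_induct)
  case (single w c)
  show ?case
  proof (induction p rule: vec_induct)
    case (single \<alpha> d)
    have "Poly_Mapping.single \<alpha> d = smult d (Poly_Mapping.single \<alpha> 1)" by simp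
    thus ?case
      by (simp only: gen_act_linear tensor_ract_single gen_act_single word_act_shift tensor_ract_linear
          tensor_ract_linear_right smult_smult mult.commute mult_1)
  qed (simp add: tensor_ract_linear_right gen_act_linear)
qed (simp add: tensor_ract_linear gen_act_linear)

lemma uea_act_ract:
  assumes "u \<in> U_loop" shows "uea_act u (tensor_ract y p) = tensor_ract (uea_act u y) p"
proof -
  have "U_loop \<subseteq> {u. \<forall>y p. uea_act u (tensor_ract y p) = tensor_ract (uea_act u y) p}"
    unfolding U_loop_def
    by (rule hull_minimal)
      (auto simp: subalgebra_def uea_act_gen gen_act_ract uea_act_one uea_act_linear uea_act_mult
        tensor_ract_linear)
  with assms show ?thesis by blast
qed

section \<open>The action of U(0) on the highest weight vector\<close>

definition power_sum :: "nat \<Rightarrow> int \<Rightarrow> laurent" where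
  "power_sum m k = (\<Sum>j<m. tpow j k)"

lemma vacuum_tpow:
  assumes "j < m"
  shows "tensor_ract (vacuum m) (tpow j k) =
    Poly_Mapping.single (FWord ((replicate m (VPlus, 0))[j := (VPlus, k)])) 1"
proof -
  have "shift_word (FWord (replicate m (VPlus, 0))) (Poly_Mapping.single j k) =
      FWord ((replicate m (VPlus, 0))[j := (VPlus, k)])"
    by (rule fword_eqI) (auto simp: shift_word_nth nth_list_update lookup_single when_def)
  thus ?thesis by (simp add: vacuum_def tpow_def tensor_ract_single)
qed

lemma hloop_vacuum: "uea_act (hloop k) (vacuum m) = tensor_ract (vacuum m) (power_sum m k)"
proof -
  have "uea_act (hloop k) (vacuum m) = (\<Sum>i<m.
      Poly_Mapping.single (FWord ((replicate m (VPlus, 0))[i := (VPlus, k)])) 1)"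
    by (simp add: uea_act_gen vacuum_def gen_act_single word_act_loop loop_letter_def)
  thus ?thesis by (simp add: power_sum_def tensor_ract_sum vacuum_tpow)
qed

lemma tpow_mult: "tpow j a * tpow j b = tpow j (a + b)"
  by (simp add: tpow_def mult_single single_add)

lemma tpow_0 [simp]: "tpow j 0 = 1"
  by (simp add: tpow_def)

text \<open>For \<epsilon> = 1 or -1 this is the value of Lambda_(\<epsilon> n): the signed
  elementary symmetric function of the t_j or of their inverses.\<close>

definition signed_esym :: "nat \<Rightarrow> int \<Rightarrow> nat \<Rightarrow> laurent" where
  "signed_esym m \<epsilon> n = (-1) ^ n * (\<Sum>A\<in>{A. A \<subseteq> {..<m} \<and> card A = n}. \<Prod>j\<in>A. tpow j \<epsilon>)"

lemma signed_esym_eq_nth: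
  "signed_esym m \<epsilon> n = fps_nth (\<Prod>j<m. 1 - fps_const (tpow j \<epsilon>) * fps_X) n"
proof -
  have 1: "(\<Prod>j\<in>A. fps_const (tpow j \<epsilon>) * fps_X) =
      fps_const (\<Prod>j\<in>A. tpow j \<epsilon>) * fps_X ^ card A" if "finite A" for A
    using that by (induction rule: finite_induct) (auto simp: algebra_simps simp flip: fps_const_mult)
  have "(\<Prod>j<m. 1 - fps_const (tpow j \<epsilon>) * fps_X) =
      (\<Sum>A\<in>Pow {..<m}. (-1) ^ card A * (\<Prod>j\<in>A. fps_const (tpow j \<epsilon>) * fps_X) * (\<Prod>j\<in>{..<m} - A. 1))"
    by (rule prod_diff_conv_sum) auto
  also have "\<dots> = (\<Sum>A\<in>Pow {..<m}. fps_const ((-1) ^ card A * (\<Prod>j\<in>A. tpow j \<epsilon>)) * fps_X ^ card A)"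
    by (intro sum.cong refl)
      (auto simp: 1 finite_subset simp flip: fps_const_mult fps_const_power fps_const_neg mult.assoc)
  finally have "fps_nth (\<Prod>j<m. 1 - fps_const (tpow j \<epsilon>) * fps_X) n =
      (\<Sum>A\<in>Pow {..<m}. if card A = n then (-1) ^ card A * (\<Prod>j\<in>A. tpow j \<epsilon>) else 0)"
    by (simp add: fps_sum_nth fps_X_power_iff if_distrib eq_commute cong: if_cong)
  also have "\<dots> = (\<Sum>A\<in>{A \<in> Pow {..<m}. card A = n}. (-1) ^ n * (\<Prod>j\<in>A. tpow j \<epsilon>))"
    by (subst sum.inter_filter) (auto intro!: sum.cong)
  finally show ?thesis by (simp add: signed_esym_def sum_distrib_left)
qed

lemma signed_esym_0 [simp]: "signed_esym m \<epsilon> 0 = 1"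
proof -
  have "{A. A \<subseteq> {..<m} \<and> card A = 0} = {{}}"
    by (auto simp: card_eq_0_iff dest: finite_subset)
  thus ?thesis by (simp add: signed_esym_def)
qed

text \<open>The logarithmic derivative of the product of the 1 - t_j^\<epsilon> u, by induction on
  the number of variables.\<close>

lemma signed_esym_newton:
  "of_nat (Suc n) * signed_esym m \<epsilon> (Suc n) =
     - (\<Sum>i\<le>n. power_sum m (\<epsilon> * int (Suc i)) * signed_esym m \<epsilon> (n - i))"
proof -
  define E where "E m = (\<Prod>j<m. 1 - fps_const (tpow j \<epsilon>) * fps_X)" for m
  define P where "P m = Abs_fps (\<lambda>i. power_sum m (\<epsilon> * int (Suc i)))" for m
  have "fps_deriv (E m) = - (P m * E m)" for m
  proof (induction m)
    case 0
    have "P 0 = 0" by (simp add: P_def power_sum_def fps_eq_iff)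
    thus ?case by (simp add: E_def)
  next
    case (Suc m)
    let ?t = "fps_const (tpow m \<epsilon>)"
    \<comment> \<open>With t = \<open>tpow m \<epsilon>\<close>, \<open>G\<close> is the geometric
      series t / (1 - t u) and \<open>Q\<close> its denominator.\<close>
    define G where "G = Abs_fps (\<lambda>i. tpow m (\<epsilon> * int (Suc i)))"
    define Y where "Y = ?t * fps_X * G"
    define Q where "Q = 1 - ?t * fps_X"
    have "G = ?t + Y"
      by (rule fps_ext, rename_tac n, case_tac n)
        (simp_all add: G_def Y_def mult.assoc tpow_mult algebra_simps)
    hence "G - Y = ?t" by (metis add_diff_cancel_right')
    hence GQ: "G * Q = ?t" by (simp add: Y_def Q_def right_diff_distrib mult_ac)
    have "fps_deriv (E (Suc m)) = E m * (- ?t) + fps_deriv (E m) * Q"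
      by (simp add: E_def Q_def)
    also have "\<dots> = - ((P m + G) * (E m * Q))"
      unfolding Suc.IH GQ[symmetric] by (simp add: algebra_simps)
    also have "P m + G = P (Suc m)"
      by (simp add: P_def G_def power_sum_def fps_eq_iff)
    also have "E m * Q = E (Suc m)" by (simp add: E_def Q_def)
    finally show ?case .
  qed
  hence "fps_nth (fps_deriv (E m)) n = - fps_nth (P m * E m) n" by simp
  thus ?thesis
    by (simp add: signed_esym_eq_nth E_def[symmetric] fps_mult_nth P_def atLeast0AtMost
        del: of_nat_Suc)
qed

lemma smult_cancel: "smult c x = smult c y \<Longrightarrow> c \<noteq> 0 \<Longrightarrow> x = y"
  by (metis (no_types, lifting) divide_self_if mult.commute mult_1 smult_one smult_smult times_divide_eq_right)

text \<open>Both sides obey Newton's identities: h_k acts on the highest weight vector as a power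
  sum, and the loop algebra commutes with the right action.\<close>

lemma Lambda_series_vacuum:
  "uea_act (fps_nth (Lambda_series \<epsilon>) n) (vacuum m) = tensor_ract (vacuum m) (signed_esym m \<epsilon> n)"
proof (induction n rule: less_induct)
  case (less n)
  show ?case
  proof (cases n)
    case 0
    thus ?thesis by (simp add: uea_act_one)
  next
    case (Suc k)
    have "smult (of_nat (Suc k)) (uea_act (fps_nth (Lambda_series \<epsilon>) (Suc k)) (vacuum m)) =
        uea_act (of_nat (Suc k) * fps_nth (Lambda_series \<epsilon>) (Suc k)) (vacuum m)"
      by (simp only: uea_act_linear flip: uea_scale_of_nat)
    also have "\<dots> = - (\<Sum>i\<le>k. uea_act (hloop (\<epsilon> * int (Suc i)))
        (tensor_ract (vacuum m) (signed_esym m \<epsilon> (k - i))))"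
      unfolding Lambda_series_Suc uea_act_linear uea_act_sum uea_act_mult
      using Suc by (simp add: less.IH)
    also have "\<dots> = tensor_ract (vacuum m) (- (\<Sum>i\<le>k. power_sum m (\<epsilon> * int (Suc i)) * signed_esym m \<epsilon> (k - i)))"
      by (simp only: uea_act_ract U_loop_gen hloop_vacuum tensor_ract_mult tensor_ract_sum tensor_ract_right_simps)
    also have "\<dots> = smult (of_nat (Suc k)) (tensor_ract (vacuum m) (signed_esym m \<epsilon> (Suc k)))"
      by (simp only: signed_esym_newton[symmetric] tensor_ract_linear_right flip: smult_of_nat)
    finally show ?thesis unfolding Suc by (rule smult_cancel) (simp del: of_nat_Suc)
  qed
qed

lemma Lambda_vacuum:
  "uea_act (Lambda (int n)) (vacuum m) = tensor_ract (vacuum m) (signed_esym m 1 n)"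
  "uea_act (Lambda (- int n)) (vacuum m) = tensor_ract (vacuum m) (signed_esym m (-1) n)"
  by (simp_all only: Lambda_eq_series Lambda_series_vacuum)

lemma signed_esym_eq_0: "n > m \<Longrightarrow> signed_esym m \<epsilon> n = 0"
proof -
  assume "n > m"
  moreover have "card A \<le> m" if "A \<subseteq> {..<m}" for A
    using card_mono[OF _ that] by simp
  ultimately have "{A. A \<subseteq> {..<m} \<and> card A = n} = {}"
    using not_le by blast
  thus ?thesis by (simp only: signed_esym_def sum.empty mult_zero_right)
qed

lemma signed_esym_top: "signed_esym m \<epsilon> m = (-1) ^ m * (\<Prod>j<m. tpow j \<epsilon>)"
proof -
  have "{A. A \<subseteq> {..<m} \<and> card A = m} = {{..<m}}"
  proof (intro equalityI subsetI)
    fix A assume "A \<in> {A. A \<subseteq> {..<m} \<and> card A = m}"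
    thus "A \<in> {{..<m}}" using card_subset_eq[OF finite_lessThan, of A m] by simp
  qed auto
  thus ?thesis by (simp add: signed_esym_def)
qed

text \<open>Multiplying the product of all variables by the inverses over a subset leaves the
  product over its complement.\<close>

lemma signed_esym_top_mult:
  assumes "k \<le> m"
  shows "signed_esym m \<epsilon> m * signed_esym m (- \<epsilon>) k = signed_esym m \<epsilon> (m - k)"
proof -
  have 1: "(\<Prod>j<m. tpow j \<epsilon>) * (\<Prod>j\<in>A. tpow j (- \<epsilon>)) = (\<Prod>j\<in>{..<m} - A. tpow j \<epsilon>)"
    if "A \<subseteq> {..<m}" for A
  proof -
    have "(\<Prod>j<m. tpow j \<epsilon>) = (\<Prod>j\<in>{..<m} - A. tpow j \<epsilon>) * (\<Prod>j\<in>A. tpow j \<epsilon>)"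
      by (rule prod.subset_diff[OF that]) simp
    moreover have "(\<Prod>j\<in>A. tpow j \<epsilon>) * (\<Prod>j\<in>A. tpow j (- \<epsilon>)) = 1"
      by (simp add: prod.distrib[symmetric] tpow_mult)
    ultimately show ?thesis by (simp add: mult.assoc)
  qed
  have "(\<Sum>A\<in>{A. A \<subseteq> {..<m} \<and> card A = k}. \<Prod>j\<in>{..<m} - A. tpow j \<epsilon>) =
      (\<Sum>A\<in>{A. A \<subseteq> {..<m} \<and> card A = m - k}. \<Prod>j\<in>A. tpow j \<epsilon>)"
    by (rule sum.reindex_bij_witness[of _ "\<lambda>A. {..<m} - A" "\<lambda>A. {..<m} - A"])
      (use assms in \<open>auto simp: card_Diff_subset finite_subset double_diff\<close>)
  moreover have "(-1) ^ m * (-1) ^ k = ((-1) ^ (m - k) :: laurent)"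
  proof -
    have "(-1) ^ m = ((-1) ^ (m - k) * (-1) ^ k :: laurent)"
      using assms by (simp flip: power_add)
    thus ?thesis by (simp add: mult.assoc flip: power_mult_distrib)
  qed
  ultimately have "(-1) ^ m * (-1) ^ k *
      ((\<Prod>j<m. tpow j \<epsilon>) * (\<Sum>A\<in>{A. A \<subseteq> {..<m} \<and> card A = k}. \<Prod>j\<in>A. tpow j (- \<epsilon>))) =
      signed_esym m \<epsilon> (m - k)"
    by (simp add: sum_distrib_left 1 signed_esym_def)
  thus ?thesis by (simp add: signed_esym_top) (simp add: signed_esym_def mult_ac)
qed

text \<open>The arbitrary factor f in the relations thereby passes to the right action, and only the
  part to its left has to kill the highest weight vector.\<close>

lemma vacuum_U_zero_ract:
  assumes "f \<in> U_zero" obtains p where "uea_act f (vacuum m) = tensor_ract (vacuum m) p"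
proof -
  have "U_zero \<subseteq> {f \<in> U_loop. \<exists>p. uea_act f (vacuum m) = tensor_ract (vacuum m) p}"
  proof (rule U_zero_minimal)
    show "subalgebra {f \<in> U_loop. \<exists>p. uea_act f (vacuum m) = tensor_ract (vacuum m) p}"
      unfolding subalgebra_def
    proof (intro conjI allI ballI)
      show "1 \<in> {f \<in> U_loop. \<exists>p. uea_act f (vacuum m) = tensor_ract (vacuum m) p}"
        by (auto simp: uea_act_one U_loop_closed intro!: exI[of _ 1])
    next
      fix a b
      assume *: "a \<in> {f \<in> U_loop. \<exists>p. uea_act f (vacuum m) = tensor_ract (vacuum m) p}"
        "b \<in> {f \<in> U_loop. \<exists>p. uea_act f (vacuum m) = tensor_ract (vacuum m) p}"
      then obtain p q where "uea_act a (vacuum m) = tensor_ract (vacuum m) p"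
        "uea_act b (vacuum m) = tensor_ract (vacuum m) q" "a \<in> U_loop" "b \<in> U_loop" by auto
      hence "uea_act (a + b) (vacuum m) = tensor_ract (vacuum m) (p + q)"
        "uea_act (a * b) (vacuum m) = tensor_ract (vacuum m) (p * q)" "a \<in> U_loop" "b \<in> U_loop"
        by (simp_all add: uea_act_linear tensor_ract_linear_right uea_act_mult uea_act_ract tensor_ract_mult)
      thus "a + b \<in> {f \<in> U_loop. \<exists>p. uea_act f (vacuum m) = tensor_ract (vacuum m) p}"
        "a * b \<in> {f \<in> U_loop. \<exists>p. uea_act f (vacuum m) = tensor_ract (vacuum m) p}"
        using U_loop_closed by blast+
    next
      fix c a assume "a \<in> {f \<in> U_loop. \<exists>p. uea_act f (vacuum m) = tensor_ract (vacuum m) p}"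
      thus "uea_scale c a \<in> {f \<in> U_loop. \<exists>p. uea_act f (vacuum m) = tensor_ract (vacuum m) p}"
        by (auto simp: U_loop_closed uea_act_linear tensor_ract_linear_right[symmetric])
    qed
  qed (use hloop_vacuum in auto)
  thus ?thesis using assms that by blast
qed

lemma orb_in_U_loop: "orb ks ls \<in> U_loop"
proof (induction ks ls rule: orb.induct)
  case (1 ks)
  show ?case by (induction ks) (simp_all add: U_loop_closed)
next
  case (2 ks l ls)
  thus ?case
    by (simp add: U_loop_closed subalgebra_sum_list[OF U_loop_subalgebra])
qed

lemma orb_vacuum_eq_0:
  assumes "length ks + length ls > m" "f \<in> U_zero"
  shows "uea_act (orb ks ls * f) (vacuum m) = 0"
proof -
  obtain p where "uea_act f (vacuum m) = tensor_ract (vacuum m) p"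
    using vacuum_U_zero_ract[OF assms(2)] by metis
  hence "uea_act (orb ks ls * f) (vacuum m) = tensor_ract (orb_sum m (lv_word ks ls)) p"
    by (simp add: uea_act_mult uea_act_ract orb_in_U_loop uea_act_orb)
  also have "orb_sum m (lv_word ks ls) = 0"
    using assms(1) by (simp add: orb_sum_def)
  finally show ?thesis by (simp add: tensor_ract_linear)
qed

lemma orb_unit_vacuum_eq_0:
  assumes "length ks + n > m" "f \<in> U_zero"
  shows "uea_act (orb_unit \<epsilon> ks n * f) (vacuum m) = 0"
  using orb_vacuum_eq_0[of m ks "replicate n \<epsilon>" f] assms
  by (simp add: orb_unit_def uea_scale_mult_left uea_act_linear)

lemma weyl_relations_vacuum:
  assumes "u \<in> weyl_relations m" shows "uea_act u (vacuum m) = 0"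
proof -
  consider k where "u = xplus k" | "u = hloop 0 - of_nat m" | "u = deg"
    | k where "\<bar>k\<bar> > int m" "u = Lambda k"
    | k where "1 \<le> k" "k \<le> int m" "u = Lambda (int m) * Lambda (- k) - Lambda (int m - k)"
    | s f where "f \<in> U_zero" "u = (\<Sum>j\<le>m. xminus (s - 1 - int j) * Lambda (int j) * f)"
    | r s f where "r \<ge> 1" "s > m" "f \<in> U_zero" "u = fps_nth (X0_minus_series ^ r * Lambda_series 1) s * f"
    using assms unfolding weyl_relations_def by blast
  thus ?thesis
  proof cases
    case (1 k)
    thus ?thesis by (simp add: uea_act_gen vacuum_def gen_act_single word_act_loop)
  next
    case 2
    have "smult (of_nat m) (vacuum m) = tensor_ract (vacuum m) (of_nat m)"
      using tensor_ract_linear_right(2)[of "vacuum m" "of_nat m" 1] by (simp add: smult_of_nat)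
    with 2 show ?thesis by (simp add: uea_act_linear hloop_vacuum power_sum_def uea_act_of_nat)
  next
    case 3
    have "LV_act Deg (replicate m (VPlus, 0) ! i) = 0" if "i < m" for i
      using that by simp
    thus ?thesis using 3
      by (simp add: uea_act_gen vacuum_def gen_act_single word_act_def tensor_incl_def)
  next
    case (4 k)
    define n where "n = nat \<bar>k\<bar>"
    have "k = int n \<or> k = - int n" "n > m" using 4(1) by (auto simp: n_def)
    thus ?thesis using 4(2) by (auto simp: Lambda_vacuum signed_esym_eq_0 tensor_ract_right_simps)
  next
    case (5 k)
    define n where "n = nat k"
    have k: "k = int n" "n \<le> m" "int m - k = int (m - n)" using 5 by (auto simp: n_def)
    have "uea_act (Lambda (int m) * Lambda (- int n)) (vacuum m) = uea_act (Lambda (int (m - n))) (vacuum m)"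
      using U_zero_subset_U_loop Lambda_in_U_zero signed_esym_top_mult[OF k(2), of 1]
      by (simp add: uea_act_mult Lambda_vacuum uea_act_ract subset_iff tensor_ract_mult)
    thus ?thesis unfolding 5(3) k(3) by (simp add: uea_act_linear k(1))
  next
    case (6 s f)
    \<comment> \<open>Summed backwards, the relation is a multiple of a lift with one letter v_- and
      m letters v_+ (x) t, thus with m + 1 letters.\<close>
    have "orb_unit 1 [s - 1 - int m] m = (\<Sum>j\<le>m. xminus (s - 1 - int m + int j) * Lambda (int (m - j)))"
      by (simp only: orb_unit_Cons orb_unit_Nil Lambda_eq_series one_neq_zero not_False_eq_True)
    also have "\<dots> = (\<Sum>j\<le>m. xminus (s - 1 - int j) * Lambda (int j))"
      by (rule sum.reindex_bij_witness[of _ "\<lambda>j. m - j" "\<lambda>j. m - j"]) (auto simp: algebra_simps)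
    finally have "u = orb_unit 1 [s - 1 - int m] m * f"
      unfolding 6 by (simp add: sum_distrib_right)
    thus ?thesis using 6(1) by (simp add: orb_unit_vacuum_eq_0)
  next
    case (7 r s f)
    show ?thesis
    proof (cases "s < r")
      case True
      thus ?thesis using 7 by (simp add: X0_minus_Lambda_nth_less uea_act_linear)
    next
      case False
      \<comment> \<open>There are r letters v_- and s - r letters v_+, hence s > m in all.\<close>
      hence "u = orb_unit 1 (replicate r 0) (s - r) * f"
        using 7 X0_minus_Lambda_nth[of r "s - r"] by simp
      thus ?thesis using 7 False by (simp add: orb_unit_vacuum_eq_0)
    qed
  qed
qed

lemma weyl_ideal_vacuum:
  assumes "u \<in> weyl_ideal m" shows "uea_act u (vacuum m) = 0"
proof -
  have "weyl_ideal m \<subseteq> {u. uea_act u (vacuum m) = 0}"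
    unfolding weyl_ideal_def
    by (rule hull_minimal)
      (auto simp: left_ideal_def uea_act_linear uea_act_mult uea_act_linear_right weyl_relations_vacuum)
  with assms show ?thesis by auto
qed

section \<open>The inverse map\<close>

definition exponents :: "vbasis \<Rightarrow> lv list \<Rightarrow> int list" where
  "exponents v L = map snd (filter (\<lambda>p. fst p = v) L)"

lemma exponents_lv_word [simp]:
  "exponents VMinus (lv_word ks ls) = ks" "exponents VPlus (lv_word ks ls) = ls"
  by (simp_all add: exponents_def lv_word_def filter_map o_def)

lemma mset_lv_word_exponents: "mset (lv_word (exponents VMinus L) (exponents VPlus L)) = mset L"
proof (induction L)
  case (Cons p L)
  thus ?case by (cases p; cases "fst p") (auto simp: lv_word_def exponents_def)
qed (simp add: lv_word_def exponents_def)

text \<open>As \<open>linext\<close> takes its values in a space of vectors, the linear extension is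
  formed with representatives in the tensor algebra; \<open>abs_uea\<close> makes their choice
  irrelevant. The factor 1 / m! offsets the m! summands of \<open>symz\<close>.\<close>

definition weyl_lift :: "nat \<Rightarrow> lv tensor \<Rightarrow> uea" where
  "weyl_lift m x = abs_uea (linext (\<lambda>w. rep_uea (uea_scale (1 / fact m)
     (orb (exponents VMinus (letters w)) (exponents VPlus (letters w))))) x)"

lemma weyl_lift_add: "weyl_lift m (x + y) = weyl_lift m x + weyl_lift m y"
  by (simp add: weyl_lift_def linext_add plus_uea.abs_eq)

lemma weyl_lift_smult: "weyl_lift m (smult c x) = uea_scale c (weyl_lift m x)"
  by (simp add: weyl_lift_def linext_smult uea_scale.abs_eq)

lemma weyl_lift_zero [simp]: "weyl_lift m 0 = 0"
  by (simp add: weyl_lift_def zero_uea.abs_eq)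

lemma weyl_lift_sum: "weyl_lift m (sum f A) = (\<Sum>a\<in>A. weyl_lift m (f a))"
  by (induction A rule: infinite_finite_induct) (auto simp: weyl_lift_add)

lemma weyl_lift_single: "weyl_lift m (Poly_Mapping.single w 1) = uea_scale (1 / fact m)
    (orb (exponents VMinus (letters w)) (exponents VPlus (letters w)))"
  by (simp add: weyl_lift_def Quotient3_abs_rep[OF Quotient3_uea])

lemma weyl_lift_symz:
  assumes "length L = m"
  shows "weyl_lift m (symz L) = orb (exponents VMinus L) (exponents VPlus L)"
proof -
  let ?o = "orb (exponents VMinus L) (exponents VPlus L)"
  have "orb (exponents VMinus (permute_list \<sigma> L)) (exponents VPlus (permute_list \<sigma> L)) = ?o"
    if "\<sigma> permutes {..<length L}" for \<sigma>
    by (rule orb_cong_mset) (simp_all add: exponents_def that)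
  hence "weyl_lift m (symz L) = (\<Sum>\<sigma> | \<sigma> permutes {..<length L}. uea_scale (1 / fact m) ?o)"
    unfolding symz_def weyl_lift_sum weyl_lift_single by (intro sum.cong) simp_all
  also have "\<dots> = uea_scale (of_nat (fact m)) (uea_scale (1 / fact m) ?o)"
    using assms by (simp only: uea_scale_of_nat) (simp add: card_permutations finite_permutations)
  finally show ?thesis by simp
qed

lemma weyl_lift_orb:
  assumes "length ks + length ls = m"
  shows "weyl_lift m (uea_act (orb ks ls) (vacuum m)) = orb ks ls"
  using assms by (simp add: uea_act_orb orb_sum_def weyl_lift_symz)

text \<open>The elements that can be recovered, modulo the ideal, from their effect on the highest
  weight vector. If such an element kills that vector, it lies in the ideal.\<close>

definition liftable :: "nat \<Rightarrow> uea set" where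
  "liftable m = {u. u - weyl_lift m (uea_act u (vacuum m)) \<in> weyl_ideal m}"

lemma weyl_ideal_scale: "u \<in> weyl_ideal m \<Longrightarrow> uea_scale c u \<in> weyl_ideal m"
  using weyl_ideal_mult_left[of u m "uea_scale c 1"] by (simp add: uea_scale_mult_left)

lemma liftable_add: "u \<in> liftable m \<Longrightarrow> v \<in> liftable m \<Longrightarrow> u + v \<in> liftable m"
  using weyl_ideal_add[of "u - weyl_lift m (uea_act u (vacuum m))" m "v - weyl_lift m (uea_act v (vacuum m))"]
  by (simp add: liftable_def uea_act_linear weyl_lift_add algebra_simps)

lemma liftable_scale: "u \<in> liftable m \<Longrightarrow> uea_scale c u \<in> liftable m"
  using weyl_ideal_scale[of "u - weyl_lift m (uea_act u (vacuum m))" m c]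
  by (simp add: liftable_def uea_act_linear weyl_lift_smult uea_scale_diff)

lemma liftable_ideal: "u \<in> weyl_ideal m \<Longrightarrow> u \<in> liftable m"
  by (simp add: liftable_def weyl_ideal_vacuum)

lemma sum_bumps_0: "(\<Sum>b\<leftarrow>bumps 0 xs. F b) = of_nat (length xs) * (F xs :: 'a::ring_1)"
  by (induction xs arbitrary: F) (auto simp: o_def algebra_simps)

text \<open>With n letters, adding the letter v_+ (x) t^0 gives \<open>orb ks ls\<close> times h_0 -
  n, that is m - n times \<open>orb ks ls\<close> modulo the ideal. The induction is on the
  truncated difference m - n, whose value 0 covers both n = m and the vanishing case n > m.\<close>

lemma orb_liftable: "orb ks ls \<in> liftable m"
proof (induction "m - (length ks + length ls)" arbitrary: ls)
  case 0
  show ?case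
  proof (cases "length ks + length ls = m")
    case True
    thus ?thesis by (simp add: liftable_def weyl_lift_orb weyl_ideal_zero)
  next
    case False
    thus ?thesis using 0 by (intro liftable_ideal weyl_core_subset orb_in_core) simp
  qed
next
  case (Suc p)
  let ?n = "length ks + length ls"
  have "orb ks (0 # ls) \<in> liftable m" by (rule Suc.hyps(1)) (use Suc.hyps(2) in simp)
  moreover have "orb ks ls * (hloop 0 - of_nat m) \<in> weyl_ideal m"
    by (intro weyl_ideal_mult_left weyl_core_subset weyl_core_hloop_0)
  ultimately have *: "orb ks (0 # ls) + uea_scale (- 1) (orb ks ls * (hloop 0 - of_nat m)) \<in> liftable m"
    by (blast intro: liftable_add liftable_scale liftable_ideal)
  have "orb ks (0 # ls) = orb ks ls * hloop 0 - of_nat ?n * orb ks ls"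
    by (simp add: sum_bumps_0 algebra_simps)
  hence "orb ks (0 # ls) + uea_scale (- 1) (orb ks ls * (hloop 0 - of_nat m)) =
      of_nat m * orb ks ls - of_nat ?n * orb ks ls"
    by (simp only: uea_scale_minus_left uea_scale_one right_diff_distrib mult_of_nat_commute)
      (simp add: mult_of_nat_commute)
  also have "\<dots> = of_nat (Suc p) * orb ks ls"
    using Suc.hyps(2) by (simp only: of_nat_diff left_diff_distrib[symmetric] flip: of_nat_diff)
  finally have "uea_scale (1 / of_nat (Suc p)) (uea_scale (of_nat (Suc p)) (orb ks ls)) \<in> liftable m"
    using * by (simp only: liftable_scale uea_scale_of_nat)
  thus ?case by (simp del: of_nat_Suc)
qed

section \<open>The lifts span the Weyl module\<close>

inductive_set orb_span :: "uea set" where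
  orb: "orb ks ls \<in> orb_span"
| add: "u \<in> orb_span \<Longrightarrow> v \<in> orb_span \<Longrightarrow> u + v \<in> orb_span"
| scale: "u \<in> orb_span \<Longrightarrow> uea_scale c u \<in> orb_span"

lemma orb_span_zero: "0 \<in> orb_span"
  using orb_span.scale[OF orb_span.orb, of 0] by simp

lemma orb_span_diff: "u \<in> orb_span \<Longrightarrow> v \<in> orb_span \<Longrightarrow> u - v \<in> orb_span"
  using orb_span.add[OF _ orb_span.scale[of v "-1"], of u] by (simp add: uea_scale_minus_left)

lemma orb_span_sum_list: "(\<And>x. x \<in> set xs \<Longrightarrow> f x \<in> orb_span) \<Longrightarrow> (\<Sum>x\<leftarrow>xs. f x) \<in> orb_span"
  by (induction xs) (auto intro: orb_span_zero orb_span.add)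

lemma orb_span_liftable: "u \<in> orb_span \<Longrightarrow> u \<in> liftable m"
  by (induction rule: orb_span.induct) (auto intro: orb_liftable liftable_add liftable_scale)

lemma orb_span_U_loop: "u \<in> orb_span \<Longrightarrow> u \<in> U_loop"
  by (induction rule: orb_span.induct) (auto intro: orb_in_U_loop U_loop_closed)

lemma orb_span_hloop_right: "u \<in> orb_span \<Longrightarrow> u * hloop l \<in> orb_span"
proof (induction rule: orb_span.induct)
  case (orb ks ls)
  have "orb ks ls * hloop l = orb ks (l # ls) + (\<Sum>b\<leftarrow>bumps l ls. orb ks b) + (\<Sum>b\<leftarrow>bumps l ks. orb b ls)"
    by simp
  also have "\<dots> \<in> orb_span" by (intro orb_span.add orb_span.orb orb_span_sum_list)
  finally show ?case .
qed (simp_all add: distrib_right uea_scale_mult_left orb_span.intros)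

lemma orb_span_hloop_left: "u \<in> orb_span \<Longrightarrow> hloop l * u \<in> orb_span"
proof (induction rule: orb_span.induct)
  case (orb ks ls)
  have "hloop l * orb ks ls = orb ks (l # ls) - (\<Sum>b\<leftarrow>bumps l ks. orb b ls) + (\<Sum>b\<leftarrow>bumps l ls. orb ks b)"
    unfolding orb_Cons_left by simp
  also have "\<dots> \<in> orb_span" by (intro orb_span.add orb_span.orb orb_span_sum_list orb_span_diff)
  finally show ?case .
qed (simp_all add: distrib_left uea_scale_mult_right orb_span.intros)

lemma orb_span_xminus_left: "u \<in> orb_span \<Longrightarrow> xminus k * u \<in> orb_span"
proof (induction rule: orb_span.induct)
  case (orb ks ls)
  show ?case unfolding xminus_orb case_prod_unfold
    by (intro orb_span.add orb_span.orb orb_span_sum_list)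
qed (simp_all add: distrib_left uea_scale_mult_right orb_span.intros)

text \<open>\<open>weyl_core\<close> takes the place of the ideal here, because moving x^+ through
  \<open>orb\<close> involves right multiplication by h_l.\<close>

definition spanned :: "nat \<Rightarrow> uea set" where
  "spanned m = {u. \<exists>v\<in>orb_span. u - v \<in> weyl_core m}"

lemma orb_span_spanned: "u \<in> orb_span \<Longrightarrow> u \<in> spanned m"
  unfolding spanned_def by (auto intro!: bexI[of _ u])

lemma spanned_add: "u \<in> spanned m \<Longrightarrow> v \<in> spanned m \<Longrightarrow> u + v \<in> spanned m"
proof -
  assume "u \<in> spanned m" "v \<in> spanned m"
  then obtain u' v' where "u' \<in> orb_span" "v' \<in> orb_span" "u - u' \<in> weyl_core m" "v - v' \<in> weyl_core m"
    unfolding spanned_def by blast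
  hence "u' + v' \<in> orb_span" "u + v - (u' + v') \<in> weyl_core m"
    using weyl_core_add[of "u - u'" m "v - v'"] by (auto intro: orb_span.add simp: algebra_simps)
  thus ?thesis unfolding spanned_def by blast
qed

lemma spanned_scale: "u \<in> spanned m \<Longrightarrow> uea_scale c u \<in> spanned m"
proof -
  assume "u \<in> spanned m"
  then obtain u' where "u' \<in> orb_span" "u - u' \<in> weyl_core m" unfolding spanned_def by blast
  hence "uea_scale c u' \<in> orb_span" "uea_scale c u - uea_scale c u' \<in> weyl_core m"
    using weyl_core_scale[of "u - u'" m c] by (auto intro: orb_span.scale simp: uea_scale_diff)
  thus ?thesis unfolding spanned_def by blast
qed

lemma spanned_diff: "u \<in> spanned m \<Longrightarrow> v \<in> spanned m \<Longrightarrow> u - v \<in> spanned m"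
  using spanned_add[OF _ spanned_scale[of v m "-1"], of u] by (simp add: uea_scale_minus_left)

lemma spanned_sum_list: "(\<And>x. x \<in> set xs \<Longrightarrow> f x \<in> spanned m) \<Longrightarrow> (\<Sum>x\<leftarrow>xs. f x) \<in> spanned m"
  by (induction xs) (auto intro: orb_span_zero orb_span_spanned spanned_add)

lemma spanned_mult:
  assumes "u \<in> spanned m"
  shows "xminus k * u \<in> spanned m" "u * hloop k \<in> spanned m"
proof -
  obtain v where v: "v \<in> orb_span" "u - v \<in> weyl_core m"
    using assms unfolding spanned_def by blast
  have "xminus k * u - xminus k * v \<in> weyl_core m" "u * hloop k - v * hloop k \<in> weyl_core m"
    using weyl_core_mult_left[OF v(2)] weyl_core_hloop_right[OF v(2)]
    by (simp_all add: right_diff_distrib left_diff_distrib)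
  thus "xminus k * u \<in> spanned m" "u * hloop k \<in> spanned m"
    unfolding spanned_def using orb_span_xminus_left[OF v(1)] orb_span_hloop_right[OF v(1)] by blast+
qed

text \<open>x^+ is moved to the right end, where it lies in the core; passing x^-_k leaves behind
  h_(c+k), which preserves the span from the left.\<close>

lemma xplus_orb_spanned: "xplus c * orb ks ls \<in> spanned m"
proof (induction ks ls rule: orb.induct)
  case (1 ks)
  show ?case
  proof (induction ks)
    case Nil
    show ?case using weyl_core_xplus[of c m] orb_span_zero
      by (auto simp: spanned_def intro!: bexI[of _ 0])
  next
    case (Cons k ks)
    have "xplus c * orb (k # ks) [] = xminus k * (xplus c * orb ks []) + hloop (c + k) * orb ks []"
      by (simp add: xplus_xminus distrib_right flip: mult.assoc)
    also have "\<dots> \<in> spanned m"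
      by (intro spanned_add spanned_mult(1) Cons orb_span_spanned[OF orb_span_hloop_left] orb_span.orb)
    finally show ?case .
  qed
next
  case (2 ks l ls)
  have "xplus c * orb ks (l # ls) = (xplus c * orb ks ls) * hloop l
      - (\<Sum>b\<leftarrow>bumps l ls. xplus c * orb ks b) - (\<Sum>b\<leftarrow>bumps l ks. xplus c * orb b ls)"
    by (simp add: right_diff_distrib sum_list_mult_left mult.assoc)
  also have "\<dots> \<in> spanned m"
    by (intro spanned_diff spanned_mult spanned_sum_list 2)
  finally show ?case .
qed

lemma orb_span_xplus_left: "u \<in> orb_span \<Longrightarrow> xplus k * u \<in> spanned m"
  by (induction rule: orb_span.induct)
    (auto simp: distrib_left uea_scale_mult_right intro: xplus_orb_spanned spanned_add spanned_scale)

text \<open>Moving d to the right leaves the degree as a scalar and a multiple of d, which lies in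
  the left ideal.\<close>

lemma orb_span_deg_left: "u \<in> orb_span \<Longrightarrow> \<exists>v\<in>orb_span. deg * u - v \<in> weyl_ideal m"
proof (induction rule: orb_span.induct)
  case (orb ks ls)
  have "deg \<in> weyl_ideal m" by (rule weyl_relations_in_ideal) (simp add: weyl_relations_def)
  hence "orb ks ls * deg \<in> weyl_ideal m" by (rule weyl_ideal_mult_left)
  moreover have "deg * orb ks ls - uea_scale (of_int (sum_list ks + sum_list ls)) (orb ks ls) = orb ks ls * deg"
    using has_degree_orb[of ks ls] unfolding has_degree_def by simp
  ultimately show ?case by (metis orb_span.orb orb_span.scale)
next
  case (add u v)
  then obtain u' v' where "u' \<in> orb_span" "v' \<in> orb_span"
    "deg * u - u' \<in> weyl_ideal m" "deg * v - v' \<in> weyl_ideal m" by blast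
  hence "u' + v' \<in> orb_span" "deg * (u + v) - (u' + v') \<in> weyl_ideal m"
    using weyl_ideal_add[of "deg * u - u'" m "deg * v - v'"]
    by (auto intro: orb_span.add simp: algebra_simps)
  thus ?case by blast
next
  case (scale u c)
  then obtain u' where "u' \<in> orb_span" "deg * u - u' \<in> weyl_ideal m" by blast
  hence "uea_scale c u' \<in> orb_span" "deg * uea_scale c u - uea_scale c u' \<in> weyl_ideal m"
    using weyl_ideal_scale[of "deg * u - u'" m c]
    by (auto intro: orb_span.scale simp: uea_scale_diff uea_scale_mult_right)
  thus ?case by blast
qed

text \<open>As \<open>orb_span\<close> is contained in \<open>U_loop\<close>, this also gives every
  coset a representative in U, as the right action demands.\<close>

lemma orb_span_representative: "\<exists>v\<in>orb_span. u - v \<in> weyl_ideal m"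
proof (induction u rule: uea_induct)
  case one
  show ?case using orb_span.orb[of "[]" "[]"] weyl_ideal_zero[of m] by (auto intro!: bexI[of _ 1])
next
  case (gen b u)
  then obtain v where v: "v \<in> orb_span" "u - v \<in> weyl_ideal m" by blast
  have "\<exists>v'\<in>orb_span. uea_gen b * v - v' \<in> weyl_ideal m"
  proof (cases b)
    case Deg
    thus ?thesis using orb_span_deg_left[OF v(1)] by simp
  next
    case (Loop x r)
    have "uea_gen b * v \<in> spanned m"
      unfolding Loop using v(1)
      by (cases x) (auto intro: orb_span_spanned orb_span_xplus_left orb_span_xminus_left orb_span_hloop_left)
    thus ?thesis unfolding spanned_def using weyl_core_subset by blast
  qed
  then obtain v' where v': "v' \<in> orb_span" "uea_gen b * v - v' \<in> weyl_ideal m" by blast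
  have "uea_gen b * (u - v) + (uea_gen b * v - v') \<in> weyl_ideal m"
    by (intro weyl_ideal_add weyl_ideal_mult_left v v')
  thus ?case using v'(1) by (auto simp: right_diff_distrib)
next
  case (add u v)
  then obtain u' v' where "u' \<in> orb_span" "v' \<in> orb_span"
    "u - u' \<in> weyl_ideal m" "v - v' \<in> weyl_ideal m" by blast
  hence "u' + v' \<in> orb_span" "(u + v) - (u' + v') \<in> weyl_ideal m"
    using weyl_ideal_add[of "u - u'" m "v - v'"] by (auto intro: orb_span.add simp: algebra_simps)
  thus ?case by blast
next
  case (scale c u)
  then obtain u' where "u' \<in> orb_span" "u - u' \<in> weyl_ideal m" by blast
  hence "uea_scale c u' \<in> orb_span" "uea_scale c u - uea_scale c u' \<in> weyl_ideal m"
    using weyl_ideal_scale[of "u - u'" m c] by (auto intro: orb_span.scale simp: uea_scale_diff)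
  thus ?case by blast
qed

text \<open>Modulo the ideal every element is a combination of lifts and therefore liftable; if it
  kills the highest weight vector, its lift is 0. From here on, equality of cosets is decided in the
  tensor power.\<close>

lemma weyl_ideal_iff: "u \<in> weyl_ideal m \<longleftrightarrow> uea_act u (vacuum m) = 0"
proof
  assume *: "uea_act u (vacuum m) = 0"
  obtain v where v: "v \<in> orb_span" "u - v \<in> weyl_ideal m" using orb_span_representative by blast
  have "v + (u - v) \<in> liftable m"
    by (intro liftable_add orb_span_liftable liftable_ideal v)
  thus "u \<in> weyl_ideal m" using * by (simp add: liftable_def)
qed (rule weyl_ideal_vacuum)

lemma orb_sum_symmetric: "orb_sum m L \<in> symmetric_power m"
  by (auto simp: orb_sum_def intro!: symmetric_power_closed symz_in_symmetric_power)

lemma uea_act_vacuum_symmetric: "uea_act u (vacuum m) \<in> symmetric_power m"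
proof -
  obtain v where v: "v \<in> orb_span" "u - v \<in> weyl_ideal m" using orb_span_representative by blast
  have "uea_act v (vacuum m) \<in> symmetric_power m"
    using v(1) by (induction rule: orb_span.induct)
      (auto simp: uea_act_orb uea_act_linear intro: orb_sum_symmetric symmetric_power_closed)
  moreover have "uea_act u (vacuum m) = uea_act v (vacuum m)"
    using v(2) by (simp add: weyl_ideal_iff uea_act_linear)
  ultimately show ?thesis by simp
qed

text \<open>The preimage is explicit, so that a tensor without letters v_- is seen to come from
  lifts \<open>orb [] ls\<close>.\<close>

lemma symmetric_power_vacuum:
  assumes "x \<in> symmetric_power m"
  shows "x = uea_act (\<Sum>w\<in>Poly_Mapping.keys x. uea_scale (Poly_Mapping.lookup x w / fact m)
    (orb (exponents VMinus (letters w)) (exponents VPlus (letters w)))) (vacuum m)"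
proof -
  have "uea_act (orb (exponents VMinus (letters w)) (exponents VPlus (letters w))) (vacuum m) =
      symz (letters w)" if "w \<in> Poly_Mapping.keys x" for w
  proof -
    let ?L = "lv_word (exponents VMinus (letters w)) (exponents VPlus (letters w))"
    have len: "length ?L = m"
      using assms that mset_lv_word_exponents[of "letters w"]
      by (metis (mono_tags, lifting) mem_Collect_eq size_mset symmetric_power_def tensor_power_def)
    hence "orb_sum m ?L = symz ?L" by (simp add: orb_sum_def)
    thus ?thesis using symz_mset[OF mset_lv_word_exponents] by (simp add: uea_act_orb)
  qed
  hence "uea_act (\<Sum>w\<in>Poly_Mapping.keys x. uea_scale (Poly_Mapping.lookup x w / fact m)
    (orb (exponents VMinus (letters w)) (exponents VPlus (letters w)))) (vacuum m) =
    (\<Sum>w\<in>Poly_Mapping.keys x. smult (Poly_Mapping.lookup x w / fact m) (symz (letters w)))"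
    unfolding uea_act_sum uea_act_linear by (intro sum.cong refl) simp
  thus ?thesis using symmetric_power_eq_symz[OF assms] by simp
qed

section \<open>The right action on the Weyl module\<close>

lemma laurent_ring_closed:
  "Poly_Mapping.single 0 c \<in> laurent_ring m"
  "p \<in> laurent_ring m \<Longrightarrow> q \<in> laurent_ring m \<Longrightarrow> p + q \<in> laurent_ring m"
  "p \<in> laurent_ring m \<Longrightarrow> q \<in> laurent_ring m \<Longrightarrow> p * q \<in> laurent_ring m"
  "j < m \<Longrightarrow> tpow j k \<in> laurent_ring m"
proof -
  show "Poly_Mapping.single 0 c \<in> laurent_ring m" by (simp add: laurent_ring_def)
  show "p \<in> laurent_ring m \<Longrightarrow> q \<in> laurent_ring m \<Longrightarrow> p + q \<in> laurent_ring m"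
    using keys_add[of p q] by (auto simp: laurent_ring_def)
  show "j < m \<Longrightarrow> tpow j k \<in> laurent_ring m" by (auto simp: laurent_ring_def tpow_def)
  assume pq: "p \<in> laurent_ring m" "q \<in> laurent_ring m"
  show "p * q \<in> laurent_ring m"
    unfolding laurent_ring_def
  proof (intro CollectI ballI)
    fix \<alpha> assume "\<alpha> \<in> Poly_Mapping.keys (p * q)"
    then obtain a b where "\<alpha> = a + b" "a \<in> Poly_Mapping.keys p" "b \<in> Poly_Mapping.keys q"
      using keys_mult[of p q] by blast
    thus "Poly_Mapping.keys \<alpha> \<subseteq> {..<m}"
      using pq keys_add[of a b] unfolding laurent_ring_def by fastforce
  qed
qed

lemma laurent_ring_one: "1 \<in> laurent_ring m"
  using laurent_ring_closed(1)[of 1] by simp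

lemma laurent_ring_prod: "(\<And>x. x \<in> A \<Longrightarrow> f x \<in> laurent_ring m) \<Longrightarrow> prod f A \<in> laurent_ring m"
  by (induction A rule: infinite_finite_induct) (auto simp: laurent_ring_closed laurent_ring_one)

lemma laurent_ring_sum: "(\<And>x. x \<in> A \<Longrightarrow> f x \<in> laurent_ring m) \<Longrightarrow> sum f A \<in> laurent_ring m"
  using laurent_ring_closed(1)[of 0 m]
  by (induction A rule: infinite_finite_induct) (auto simp: laurent_ring_closed)

lemma laurent_ring_power: "p \<in> laurent_ring m \<Longrightarrow> p ^ n \<in> laurent_ring m"
  by (induction n) (auto simp: laurent_ring_closed laurent_ring_one)

lemma signed_esym_in_laurent_ring: "signed_esym m \<epsilon> n \<in> laurent_ring m"
proof -
  have "- 1 \<in> laurent_ring m"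
    using laurent_ring_closed(1)[of "- 1" m] by (simp add: single_uminus)
  thus ?thesis unfolding signed_esym_def
    by (intro laurent_ring_closed laurent_ring_power laurent_ring_sum laurent_ring_prod) auto
qed

text \<open>All f paired with the same p have the same effect on the highest weight vector, so the
  choice of f cannot matter in the right action.\<close>

lemma Lambda_expr_sound:
  assumes "Lambda_expr m f p"
  shows "f \<in> U_zero \<and> p \<in> laurent_ring m \<and> uea_act f (vacuum m) = tensor_ract (vacuum m) p"
  using assms
proof induction
  case (1 c)
  show ?case
    by (simp add: U_zero_closed laurent_ring_closed uea_act_linear uea_act_one tensor_ract_scalar)
next
  case (2 r)
  have "(-1) ^ r * elem_sym m r = signed_esym m 1 r"
    by (simp add: elem_sym_def signed_esym_def)
  thus ?case by (simp add: Lambda_in_U_zero Lambda_vacuum signed_esym_in_laurent_ring)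
next
  case 3
  show ?case unfolding signed_esym_top[symmetric]
    by (simp add: Lambda_in_U_zero Lambda_vacuum signed_esym_in_laurent_ring)
next
  case (4 f p g q)
  thus ?case by (simp add: U_zero_closed laurent_ring_closed uea_act_linear tensor_ract_linear_right)
next
  case (5 f p g q)
  hence "f \<in> U_loop" using U_zero_subset_U_loop by blast
  with 5 show ?case
    by (simp add: U_zero_closed laurent_ring_closed uea_act_mult uea_act_ract tensor_ract_mult)
qed

text \<open>The witness \<open>g\<close> need not be \<open>f\<close>; what counts is that the
  Laurent polynomial by which \<open>f\<close> acts is a value of an expression in Lambda_1, ...,
  Lambda_m, Lambda_(-m).\<close>

definition expressible :: "nat \<Rightarrow> uea set" where
  "expressible m = {f \<in> U_loop. \<exists>g p. Lambda_expr m g p \<and>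
     uea_act f (vacuum m) = tensor_ract (vacuum m) p}"

lemma expressible_subalgebra: "subalgebra (expressible m)"
  unfolding subalgebra_def
proof (intro conjI ballI allI)
  have "uea_act 1 (vacuum m) = tensor_ract (vacuum m) (Poly_Mapping.single 0 1)"
    by (simp add: uea_act_one)
  thus "1 \<in> expressible m"
    unfolding expressible_def using Lambda_expr.intros(1)[of m 1] U_loop_closed(1) by blast
next
  fix a b assume "a \<in> expressible m" "b \<in> expressible m"
  then obtain g p g' q where ab: "a \<in> U_loop" "b \<in> U_loop" "Lambda_expr m g p" "Lambda_expr m g' q"
    "uea_act a (vacuum m) = tensor_ract (vacuum m) p" "uea_act b (vacuum m) = tensor_ract (vacuum m) q"
    unfolding expressible_def by blast
  hence "uea_act (a + b) (vacuum m) = tensor_ract (vacuum m) (p + q)"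
    "uea_act (a * b) (vacuum m) = tensor_ract (vacuum m) (p * q)"
    by (simp_all add: uea_act_linear tensor_ract_linear_right uea_act_mult uea_act_ract tensor_ract_mult)
  thus "a + b \<in> expressible m" "a * b \<in> expressible m"
    unfolding expressible_def
    using ab Lambda_expr.intros(4,5)[OF ab(3,4)] U_loop_closed(3,4)[OF ab(1,2)] by blast+
next
  fix c a assume "a \<in> expressible m"
  then obtain g p where a: "a \<in> U_loop" "Lambda_expr m g p"
    "uea_act a (vacuum m) = tensor_ract (vacuum m) p"
    unfolding expressible_def by blast
  hence "uea_act (uea_scale c a) (vacuum m) = tensor_ract (vacuum m) (Poly_Mapping.single 0 c * p)"
    by (simp add: uea_act_linear tensor_ract_linear_right flip: smult_conv_mult)
  thus "uea_scale c a \<in> expressible m"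
    unfolding expressible_def
    using a Lambda_expr.intros(5)[OF Lambda_expr.intros(1)[of m c] a(2)] U_loop_closed(5)[OF a(1)]
    by blast
qed

lemmas expressible_closed = subalgebra_closed[OF expressible_subalgebra]

lemma Lambda_in_U_loop: "Lambda k \<in> U_loop"
  using Lambda_in_U_zero U_zero_subset_U_loop by blast

lemma Lambda_expr_signed_esym: "n \<le> m \<Longrightarrow> \<exists>g. Lambda_expr m g (signed_esym m 1 n)"
proof (cases "n = 0")
  case True
  thus ?thesis using Lambda_expr.intros(1)[of m 1] by auto
next
  case False
  assume "n \<le> m"
  with False show ?thesis using Lambda_expr.intros(2)[of n m]
    by (auto simp: elem_sym_def signed_esym_def)
qed

text \<open>Expressions contain no Lambda_(-n) for 0 < n < m; it acts like Lambda_(-m) Lambda_(m-n).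
  For |k| > m the action is 0.\<close>

lemma Lambda_expressible: "Lambda k \<in> expressible m"
proof -
  define n where "n = nat \<bar>k\<bar>"
  have zero: "\<exists>g. Lambda_expr m g 0" using Lambda_expr.intros(1)[of m 0] by auto
  have "\<exists>g. Lambda_expr m g (signed_esym m 1 n)"
    using zero Lambda_expr_signed_esym[of n m] by (cases "n \<le> m") (auto simp: signed_esym_eq_0)
  moreover have "\<exists>g. Lambda_expr m g (signed_esym m (-1) n)"
  proof (cases "n \<le> m")
    case True
    have "signed_esym m (-1) m * signed_esym m 1 (m - n) = signed_esym m (-1) (m - (m - n))"
      using signed_esym_top_mult[of "m - n" m "-1"] by simp
    hence "signed_esym m (-1) n = signed_esym m (-1) m * signed_esym m 1 (m - n)"
      using True by simp
    moreover have "Lambda_expr m (Lambda (- int m)) (signed_esym m (-1) m)"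
      unfolding signed_esym_top by (rule Lambda_expr.intros)
    ultimately show ?thesis
      using Lambda_expr_signed_esym[of "m - n" m] by (metis Lambda_expr.intros(5) diff_le_self)
  qed (use zero in \<open>simp add: signed_esym_eq_0\<close>)
  moreover have "k = int n \<or> k = - int n" by (auto simp: n_def)
  ultimately show ?thesis
    using Lambda_vacuum[of n m] Lambda_in_U_loop[of k] unfolding expressible_def by auto
qed

text \<open>Newton's identities are solved for h_n, which occurs in the term j = 0; h_0 acts by the
  scalar m.\<close>

lemma hloop_expressible: "hloop k \<in> expressible m"
proof -
  have pos: "hloop (int n) \<in> expressible m \<and> hloop (- int n) \<in> expressible m" if "n > 0" for n
    using that
  proof (induction n rule: less_induct)
    case (less n)
    have IH: "hloop (int n - int j) \<in> expressible m" "hloop (int j - int n) \<in> expressible m"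
      if "j \<in> {1..<n}" for j
      using less.IH[of "n - j"] that by auto
    have split: "{..<n} = insert 0 {1..<n}" using less.prems by auto
    have "hloop (int n) = - uea_scale (of_nat n) (Lambda (int n))
        - (\<Sum>j\<in>{1..<n}. hloop (int n - int j) * Lambda (int j))"
      unfolding uea_scale_of_nat Lambda_newton split by simp
    moreover have "hloop (- int n) = - uea_scale (of_nat n) (Lambda (- int n))
        - (\<Sum>j\<in>{1..<n}. hloop (int j - int n) * Lambda (- int j))"
      unfolding uea_scale_of_nat Lambda_newton split by simp
    ultimately show ?case
      by (auto intro!: expressible_closed subalgebra_sum[OF expressible_subalgebra] IH
          Lambda_expressible simp del: One_nat_def)
  qed
  have "hloop 0 - of_nat m \<in> weyl_ideal m"
    by (intro weyl_core_subset weyl_core_hloop_0)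
  hence "uea_act (hloop 0) (vacuum m) = tensor_ract (vacuum m) (Poly_Mapping.single 0 (of_nat m))"
    unfolding tensor_ract_scalar by (simp add: weyl_ideal_iff uea_act_linear uea_act_of_nat)
  hence "hloop 0 \<in> expressible m"
    unfolding expressible_def using Lambda_expr.intros(1) U_loop_gen by blast
  with pos[of "nat \<bar>k\<bar>"] show ?thesis by (cases "k = 0"; cases "k > 0") auto
qed

lemma orb_Nil_expressible: "orb [] ls \<in> expressible m"
proof (induction ls rule: length_induct)
  case (1 ls)
  show ?case
  proof (cases ls)
    case (Cons l t)
    hence "orb [] t \<in> expressible m" "\<And>b. b \<in> set (bumps l t) \<Longrightarrow> orb [] b \<in> expressible m"
      using 1 by (auto simp: length_bumps)
    thus ?thesis unfolding Cons
      by (auto intro!: expressible_closed subalgebra_sum_list[OF expressible_subalgebra] hloop_expressible)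
  qed (simp add: expressible_closed)
qed

lemma vacuum_ract:
  "tensor_ract (vacuum m) p = (\<Sum>\<alpha>\<in>Poly_Mapping.keys p. Poly_Mapping.single
     (shift_word (FWord (replicate m (VPlus, 0))) \<alpha>) (Poly_Mapping.lookup p \<alpha>))"
  by (simp add: vacuum_def tensor_ract_def bilinext_def linext_def)

text \<open>Distinct monomials in the first m variables send the highest weight vector to distinct
  words.\<close>

lemma vacuum_ract_eq_0:
  assumes "p \<in> laurent_ring m" "tensor_ract (vacuum m) p = 0"
  shows "p = 0"
proof (rule ccontr)
  let ?s = "shift_word (FWord (replicate m (VPlus, 0)))"
  assume "p \<noteq> 0"
  then obtain \<alpha> where \<alpha>: "\<alpha> \<in> Poly_Mapping.keys p" by fastforce
  have inj: "?s \<beta> = ?s \<alpha> \<longleftrightarrow> \<beta> = \<alpha>" if "\<beta> \<in> Poly_Mapping.keys p" for \<beta>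
  proof
    assume eq: "?s \<beta> = ?s \<alpha>"
    show "\<beta> = \<alpha>"
    proof (rule poly_mapping_eqI)
      fix i
      show "Poly_Mapping.lookup \<beta> i = Poly_Mapping.lookup \<alpha> i"
      proof (cases "i < m")
        case True
        have "letters (?s \<beta>) ! i = letters (?s \<alpha>) ! i" using eq by simp
        thus ?thesis using True by (simp add: shift_word_nth)
      next
        case False
        hence "i \<notin> Poly_Mapping.keys \<beta>" "i \<notin> Poly_Mapping.keys \<alpha>"
          using assms(1) \<alpha> that unfolding laurent_ring_def by blast+
        thus ?thesis by (simp add: in_keys_iff)
      qed
    qed
  qed simp
  have "Poly_Mapping.lookup (tensor_ract (vacuum m) p) (?s \<alpha>) =
      (\<Sum>\<beta>\<in>Poly_Mapping.keys p. if \<beta> = \<alpha> then Poly_Mapping.lookup p \<alpha> else 0)"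
    unfolding vacuum_ract lookup_sum
    by (intro sum.cong refl) (auto simp: lookup_single when_def inj)
  also have "\<dots> = Poly_Mapping.lookup p \<alpha>" using \<alpha> by simp
  finally show False using assms(2) \<alpha> by (simp add: in_keys_iff)
qed

text \<open>\<open>permute_list\<close> reads position \<sigma> i at i, whereas
  \<open>permute_vars\<close> sends the variable j to \<sigma> j; hence the inverse.\<close>

lemma permute_tensor_vacuum_ract:
  assumes \<sigma>: "\<sigma> permutes {..<m}"
  shows "permute_tensor \<sigma> (tensor_ract (vacuum m) p) = tensor_ract (vacuum m) (permute_vars (inv \<sigma>) p)"
proof (induction p rule: vec_induct)
  case (single \<alpha> c)
  let ?s = "shift_word (FWord (replicate m (VPlus, 0)))"
  have "FWord (permute_list \<sigma> (letters (?s \<alpha>))) = ?s (Poly_Mapping.map_key \<sigma> \<alpha>)"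
  proof (rule fword_eqI)
    fix i assume "i < length (letters (FWord (permute_list \<sigma> (letters (?s \<alpha>)))))"
    hence i: "i < m" by simp
    moreover from this have "\<sigma> i < m" using permutes_in_image[OF \<sigma>, of i] by simp
    ultimately show "letters (FWord (permute_list \<sigma> (letters (?s \<alpha>)))) ! i =
        letters (?s (Poly_Mapping.map_key \<sigma> \<alpha>)) ! i"
      using \<sigma> by (simp add: permute_list_nth shift_word_nth map_key.rep_eq permutes_inj)
  qed simp
  thus ?case
    by (simp add: permute_tensor_def permute_vars_def vacuum_def tensor_ract_single
        permutes_inv_inv[OF \<sigma>])
qed (simp_all add: permute_tensor_def permute_vars_def linext_add tensor_ract_linear_right)

lemma vacuum_ract_symmetric:
  assumes "p \<in> sym_laurent m" shows "tensor_ract (vacuum m) p \<in> symmetric_power m"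
  unfolding symmetric_power_def
proof (intro CollectI conjI allI impI)
  show "tensor_ract (vacuum m) p \<in> tensor_power m"
    unfolding vacuum_ract by (rule tensor_power_sum) (auto simp: tensor_power_def)
  fix \<sigma> assume \<sigma>: "\<sigma> permutes {..<m}"
  hence "permute_vars (inv \<sigma>) p = p"
    using assms permutes_inv[OF \<sigma>] by (auto simp: sym_laurent_def)
  thus "permute_tensor \<sigma> (tensor_ract (vacuum m) p) = tensor_ract (vacuum m) p"
    by (simp add: permute_tensor_vacuum_ract \<sigma>)
qed

text \<open>A Laurent form of the fundamental theorem on symmetric functions. Applied to the highest
  weight vector, p gives a symmetric tensor with letters v_+ only; its preimage is a combination of
  \<open>orb [] ls\<close>, thus a polynomial in the h_l, and so expressible. The resulting q has
  the same effect as p, hence equals p.\<close>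

lemma Lambda_expr_complete:
  assumes "p \<in> sym_laurent m" shows "\<exists>f. Lambda_expr m f p"
proof -
  define x where "x = tensor_ract (vacuum m) p"
  define u where "u = (\<Sum>w\<in>Poly_Mapping.keys x. uea_scale (Poly_Mapping.lookup x w / fact m)
    (orb (exponents VMinus (letters w)) (exponents VPlus (letters w))))"
  have keys: "Poly_Mapping.keys x \<subseteq> range (shift_word (FWord (replicate m (VPlus, 0))))"
    unfolding x_def vacuum_ract
    by (rule order_trans[OF keys_sum]) (auto split: if_splits)
  have "exponents VMinus (letters w) = []" if w: "w \<in> Poly_Mapping.keys x" for w
  proof -
    obtain \<alpha> where "w = shift_word (FWord (replicate m (VPlus, 0))) \<alpha>"
      using keys w by blast
    thus ?thesis by (auto simp: exponents_def filter_empty_conv in_set_conv_nth shift_word_nth)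
  qed
  hence "u \<in> expressible m"
    unfolding u_def
    by (auto intro!: expressible_closed subalgebra_sum[OF expressible_subalgebra] orb_Nil_expressible)
  moreover have "x = uea_act u (vacuum m)"
    unfolding u_def by (rule symmetric_power_vacuum) (simp add: x_def vacuum_ract_symmetric assms)
  ultimately obtain g q where gq: "Lambda_expr m g q" "x = tensor_ract (vacuum m) q"
    unfolding expressible_def by auto
  have "p - q = 0"
  proof (rule vacuum_ract_eq_0)
    have "- q = Poly_Mapping.single 0 (- 1) * q" by (simp add: single_uminus)
    hence "- q \<in> laurent_ring m"
      using Lambda_expr_sound[OF gq(1)] laurent_ring_closed by metis
    thus "p - q \<in> laurent_ring m"
      using assms laurent_ring_closed(2)[of p m "- q"] by (auto simp: sym_laurent_def)
    show "tensor_ract (vacuum m) (p - q) = 0"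
      using gq(2) by (simp add: x_def tensor_ract_right_simps)
  qed
  with gq(1) show ?thesis by auto
qed

section \<open>The isomorphism and its compatibility with both actions\<close>

definition weyl_iso :: "nat \<Rightarrow> uea set \<Rightarrow> lv tensor" where
  "weyl_iso m w = uea_act (SOME u. u \<in> w) (vacuum m)"

lemma weyl_coset_self: "u \<in> u +o weyl_ideal m"
  using set_plus_intro2[OF weyl_ideal_zero, of u m] by simp

lemma weyl_coset_eq_iff:
  "u +o weyl_ideal m = v +o weyl_ideal m \<longleftrightarrow> uea_act u (vacuum m) = uea_act v (vacuum m)"
proof
  assume "u +o weyl_ideal m = v +o weyl_ideal m"
  hence "u - v \<in> weyl_ideal m" using weyl_coset_self set_plus_imp_minus by blast
  thus "uea_act u (vacuum m) = uea_act v (vacuum m)" by (simp add: weyl_ideal_iff uea_act_linear)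
next
  have sub: "u +o weyl_ideal m \<subseteq> v +o weyl_ideal m"
    if "uea_act u (vacuum m) = uea_act v (vacuum m)" for u v
  proof
    fix x assume "x \<in> u +o weyl_ideal m"
    hence "x - u \<in> weyl_ideal m" by (rule set_plus_imp_minus)
    hence "x - v \<in> weyl_ideal m" using that by (simp add: weyl_ideal_iff uea_act_linear)
    thus "x \<in> v +o weyl_ideal m" by (rule set_minus_imp_plus)
  qed
  assume "uea_act u (vacuum m) = uea_act v (vacuum m)"
  thus "u +o weyl_ideal m = v +o weyl_ideal m" using sub[of u v] sub[of v u] by auto
qed

lemma weyl_iso_coset: "weyl_iso m (u +o weyl_ideal m) = uea_act u (vacuum m)"
proof -
  have "(SOME v. v \<in> u +o weyl_ideal m) \<in> u +o weyl_ideal m"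
    using weyl_coset_self by (rule someI)
  hence "(SOME v. v \<in> u +o weyl_ideal m) - u \<in> weyl_ideal m" by (rule set_plus_imp_minus)
  thus ?thesis by (simp add: weyl_iso_def weyl_ideal_iff uea_act_linear)
qed

text \<open>All products u f in the definition of \<open>weyl_ract\<close> act alike on the highest
  weight vector, so by \<open>weyl_ideal_iff\<close> they lie in a single coset.\<close>

lemma weyl_ract_coset:
  assumes "p \<in> sym_laurent m"
  shows "\<exists>v. weyl_ract m (u +o weyl_ideal m) p = v +o weyl_ideal m
    \<and> uea_act v (vacuum m) = tensor_ract (uea_act u (vacuum m)) p"
proof -
  have act: "uea_act (v * f) (vacuum m) = tensor_ract (uea_act u (vacuum m)) p"
    if "v \<in> (u +o weyl_ideal m) \<inter> U_loop" "Lambda_expr m f p" for v f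
  proof -
    have "v - u \<in> weyl_ideal m" using that(1) by (auto intro: set_plus_imp_minus)
    hence "uea_act v (vacuum m) = uea_act u (vacuum m)" by (simp add: weyl_ideal_iff uea_act_linear)
    thus ?thesis
      using that Lambda_expr_sound[OF that(2)] by (simp add: uea_act_mult uea_act_ract)
  qed
  \<comment> \<open>With no representative in U, or no f for p, the set of products would be empty;
    the spanning result and \<open>Lambda_expr_complete\<close> exclude this.\<close>
  obtain v where v: "v \<in> orb_span" "u - v \<in> weyl_ideal m" using orb_span_representative by blast
  have "v - u \<in> weyl_ideal m" using v(2) by (simp add: weyl_ideal_iff uea_act_linear)
  hence "v \<in> u +o weyl_ideal m" by (rule set_minus_imp_plus)
  hence v': "v \<in> (u +o weyl_ideal m) \<inter> U_loop" using orb_span_U_loop v(1) by blast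
  obtain f where f: "Lambda_expr m f p" using Lambda_expr_complete[OF assms] by blast
  let ?S = "{v * f | v f. v \<in> (u +o weyl_ideal m) \<inter> U_loop \<and> Lambda_expr m f p}"
  have "?S + weyl_ideal m = (v * f) +o weyl_ideal m"
  proof
    have "v * f \<in> ?S" using v' f by blast
    thus "(v * f) +o weyl_ideal m \<subseteq> ?S + weyl_ideal m" by (rule set_plus_mono3)
    show "?S + weyl_ideal m \<subseteq> (v * f) +o weyl_ideal m"
    proof
      fix x assume "x \<in> ?S + weyl_ideal m"
      then obtain w g i where "x = w * g + i" "w \<in> (u +o weyl_ideal m) \<inter> U_loop"
        "Lambda_expr m g p" "i \<in> weyl_ideal m"
        by (auto elim!: set_plus_elim)
      hence "x - v * f \<in> weyl_ideal m"
        using act[OF v' f] by (simp add: weyl_ideal_iff uea_act_linear act)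
      thus "x \<in> (v * f) +o weyl_ideal m" by (rule set_minus_imp_plus)
    qed
  qed
  thus ?thesis unfolding weyl_ract_def using act[OF v' f] by blast
qed

theorem theorem4:
  fixes m :: nat
  assumes "m \<ge> 1"
  shows "\<exists>\<phi> :: uea set \<Rightarrow> lv tensor.
           bij_betw \<phi> (weyl_module m) (symmetric_power m)
         \<and> (\<forall>v\<in>weyl_module m. \<forall>w\<in>weyl_module m. \<phi> (v + w) = \<phi> v + \<phi> w)
         \<and> (\<forall>a. \<forall>w\<in>weyl_module m. \<phi> (weyl_lact m a w) = uea_act a (\<phi> w))
         \<and> (\<forall>w\<in>weyl_module m. \<forall>p\<in>sym_laurent m.
              weyl_ract m w p \<in> weyl_module m \<and> \<phi> (weyl_ract m w p) = tensor_ract (\<phi> w) p)"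
proof (intro exI[of _ "weyl_iso m"] conjI ballI allI)
  show "bij_betw (weyl_iso m) (weyl_module m) (symmetric_power m)"
    unfolding bij_betw_def
  proof
    show "inj_on (weyl_iso m) (weyl_module m)"
      by (auto simp: inj_on_def weyl_module_def weyl_iso_coset weyl_coset_eq_iff)
    show "weyl_iso m ` weyl_module m = symmetric_power m"
    proof (intro equalityI subsetI)
      fix x :: "lv tensor" assume "x \<in> symmetric_power m"
      then obtain u where "x = uea_act u (vacuum m)" using symmetric_power_vacuum by blast
      thus "x \<in> weyl_iso m ` weyl_module m"
        unfolding weyl_module_def by (auto simp: image_iff weyl_iso_coset)
    qed (auto simp: weyl_module_def weyl_iso_coset uea_act_vacuum_symmetric)
  qed
next
  fix v w assume "v \<in> weyl_module m" "w \<in> weyl_module m"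
  thus "weyl_iso m (v + w) = weyl_iso m v + weyl_iso m w"
    by (auto simp: weyl_module_def weyl_coset_add weyl_iso_coset uea_act_linear)
next
  fix a w assume "w \<in> weyl_module m"
  thus "weyl_iso m (weyl_lact m a w) = uea_act a (weyl_iso m w)"
    by (auto simp: weyl_module_def weyl_lact_coset weyl_iso_coset uea_act_mult)
next
  fix w p assume "w \<in> weyl_module m" and p: "p \<in> sym_laurent m"
  then obtain u where w: "w = u +o weyl_ideal m" by (auto simp: weyl_module_def)
  obtain v where v: "weyl_ract m w p = v +o weyl_ideal m"
    "uea_act v (vacuum m) = tensor_ract (uea_act u (vacuum m)) p"
    using weyl_ract_coset[OF p] w by blast
  show "weyl_ract m w p \<in> weyl_module m" using v(1) by (auto simp: weyl_module_def)
  show "weyl_iso m (weyl_ract m w p) = tensor_ract (weyl_iso m w) p"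
    unfolding v(1) unfolding w weyl_iso_coset by (rule v(2))
qed

end
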